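(* Let $(\hat f_h^{\mathfrak n})_{\mathfrak n\ge0}$ be the DLR-DG solution with time step $\Delta t>0$ started from $\hat f_h^0=X^\top U^0S^0(E^0)^\top Y$. Assume there exist constants $\beta\in(0,1)$ and $\alpha\in(0,1)$ such that $\|P_{U^0}U^{\mathrm{eq}}\|\ge\beta$ and $\|(E^{\mathrm{eq}})^\top A_\chi P^\chi_{E^0}\|_{A_{\boldsymbol 1}}\ge\alpha$. Let $\gamma^*\in(\alpha,1)$, depending only on $\frac{\chi_{\max}}{\chi_{\min}}$ and $\alpha$, be such that every $E\in\mathbb R^{n\times r}$ with $E^\top A_{\boldsymbol 1}E=I_r$ and $\|(E^{\mathrm{eq}})^\top A_{\boldsymbol 1}P_E\|_{A_{\boldsymbol 1}}\ge\gamma^*$ satisfies $\|(E^{\mathrm{eq}})^\top A_\chi P_E^\chi\|_{A_{\boldsymbol 1}}\ge\alpha$. Let $c=\frac1{1+\Delta t\,\chi_{\min}}$. Then for any $\delta$ with $$0<\delta<\min\left\{(1-c)\left(1+\frac{\chi_{\max}}{\chi_{\min}}\right)^{-1},\ \frac{\sqrt{2(1-\max\{\gamma^*,\beta\}^2)}\,\|\varepsilon f_h^{\mathrm{eq}}\|_{L^2(\Omega)}}{\|\varepsilon(\hat f_h^0-f_h^{\mathrm{eq}})\|_{L^2(\Omega)}}\right\}$$ and $$\Delta t_0=\frac{\sqrt2}{\delta}\max\left\{\frac{r^{1/2}}{\beta\chi_{\min}},\ \frac{r^{1/2}\chi_{\max}^{1/2}}{\alpha\chi_{\min}^{3/2}}\right\},$$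 when $\Delta t\ge\Delta t_0$ one has $$\|\varepsilon(\hat f_h^{\mathfrak n+1}-f_h^{\mathrm{eq}})\|_{L^2(\Omega)}\le(c+\delta_\chi)^{\mathfrak n+1}\|\varepsilon(\hat f_h^0-f_h^{\mathrm{eq}})\|_{L^2(\Omega)}\qquad\forall\,\mathfrak n\ge1,$$ where $\delta_\chi=\left(1+\frac{\chi_{\max}}{\chi_{\min}}\right)\delta$. Moreover, if $\hat f_h^0=f_h^{\mathrm{eq}}$, then for any $\Delta t>0$, $\hat f_h^{\mathfrak n+1}=f_h^{\mathrm{eq}}$ (for all $\mathfrak n\ge0$).
   Context: Let $\varepsilon_{\max}>0$, $\Omega=\Omega_\mu\times\Omega_\varepsilon$ with $\Omega_\mu=[-1,1]\ni\mu$, $\Omega_\varepsilon=[0,\varepsilon_{\max}]\ni\varepsilon$. The weighted inner product is $(v,w;\varepsilon^2)_\Omega=\int_0^{\varepsilon_{\max}}\int_{-1}^1 vw\,\varepsilon^2\,d\mu\,d\varepsilon$, and $\|\varepsilon w\|_{L^2(\Omega)}=(w,w;\varepsilon^2)_\Omega^{1/2}$. The emissivity $\eta=\eta(\varepsilon)>0$ (square integrable with respect to $\varepsilon^2d\varepsilon$) and the opacity $\chi=\chi(\varepsilon)$ are given, with constants $0<\chi_{\min}\le\chi\le\chi_{\max}$. Set $\mathcal A(f,w)=(\eta,w;\varepsilon^2)_\Omega-(\chi f,w;\varepsilon^2)_\Omega$. Partition $\Omega_\mu$ and $\Omega_\varepsilon$ into $N_\mu$ and $N_\varepsilon$ intervals;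 $V_{\mu,h}$, $V_{\varepsilon,h}$ are the spaces of (discontinuous) piecewise polynomials of degree at most $k$ on these partitions, and $V_h=V_{\mu,h}\otimes V_{\varepsilon,h}$. Let $m=(k+1)N_\mu$, $n=(k+1)N_\varepsilon$, $1\le r\le\min\{m,n\}$. Let $\{x_i(\mu)\}_{i=1}^m$, $\{y_j(\varepsilon)\}_{j=1}^n$ be the bases of $V_{\mu,h}$, $V_{\varepsilon,h}$ consisting of Legendre polynomials supported on single cells and orthonormal in the unweighted $L^2$ inner product of the cell; $X=[x_1,\dots,x_m]^\top$, $Y=[y_1,\dots,y_n]^\top$. $A_{\boldsymbol 1}=[\int_{\Omega_\varepsilon}y_iy_j\varepsilon^2d\varepsilon]$, $A_\chi=[\int_{\Omega_\varepsilon}\chi y_iy_j\varepsilon^2d\varepsilon]$ are symmetric positive definite $n\times n$ matrices; $L_0=[\int_{-1}^1x_i\,d\mu]_i\in\mathbb R^{m\times1}$, $L_\eta=[\int_{\Omega_\varepsilon}\eta y_j\varepsilon^2d\varepsilon]_j\in\mathbb R^{n\times1}$. Norms: $\|\cdot\|$ is the Euclidean norm of column vectors; for $Z\in\mathbb R^{\ell\times n}$ and symmetric positive definite $M\in\mathbb R^{n\times n}$, $\|Z\|_M^2=\mathrm{tr}(ZMZ^\top)$. Equilibrium: $f_h^{\mathrm{eq}}\in V_h$ is the unique solution of $\mathcal A(f_h^{\mathrm{eq}},w_h)=0$ for all $w_h\in V_h$; its coefficient matrix is $F^{\mathrm{eq}}=L_0L_\eta^\top A_\chi^{-1}=U^{\mathrm{eq}}S^{\mathrm{eq}}(E^{\mathrm{eq}})^\top$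 (i.e. $f_h^{\mathrm{eq}}=X^\top F^{\mathrm{eq}}Y$), where $U^{\mathrm{eq}}=L_0/\|L_0\|$, $E^{\mathrm{eq}}=A_\chi^{-1}L_\eta/\|L_\eta^\top A_\chi^{-1}\|_{A_{\boldsymbol 1}}$, $S^{\mathrm{eq}}=\|L_0\|\,\|L_\eta^\top A_\chi^{-1}\|_{A_{\boldsymbol 1}}$. Projections: $P_U=UU^\top$ for $U^\top U=I_r$; $P_E=EE^\top$ and $P_E^\chi=E(E^\top A_\chi E)^{-1}E^\top$ for $E^\top A_{\boldsymbol 1}E=I_r$. DLR-DG scheme. At each step $\hat f_h^{\mathfrak n}=X^\top U^{\mathfrak n}S^{\mathfrak n}(E^{\mathfrak n})^\top Y$ with $U^{\mathfrak n}\in\mathbb R^{m\times r}$, $S^{\mathfrak n}\in\mathbb R^{r\times r}$, $E^{\mathfrak n}\in\mathbb R^{n\times r}$, $(U^{\mathfrak n})^\top U^{\mathfrak n}=I_r=(E^{\mathfrak n})^\top A_{\boldsymbol 1}E^{\mathfrak n}$. With $V_1^{\mathfrak n}=\{X^\top\mathbf K(E^{\mathfrak n})^\top Y:\mathbf K\in\mathbb R^{m\times r}\}$, $V_2^{\mathfrak n}=\{X^\top U^{\mathfrak n}\mathbf L^\top Y:\mathbf L\in\mathbb R^{n\times r}\}$, find $f_{\mathbf K}=X^\top\mathbf K^{\mathfrak n+1}(E^{\mathfrak n})^\top Y\in V_1^{\mathfrak n}$ and $f_{\mathbf L}=X^\top U^{\mathfrak n}(\mathbf L^{\mathfrak n+1})^\top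 Y\in V_2^{\mathfrak n}$ with $\frac1{\Delta t}(f_{\mathbf K}-\hat f_h^{\mathfrak n},w_1;\varepsilon^2)_\Omega=\mathcal A(f_{\mathbf K},w_1)$ for all $w_1\in V_1^{\mathfrak n}$ and $\frac1{\Delta t}(f_{\mathbf L}-\hat f_h^{\mathfrak n},w_2;\varepsilon^2)_\Omega=\mathcal A(f_{\mathbf L},w_2)$ for all $w_2\in V_2^{\mathfrak n}$ (unique solutions); factor $\mathbf K^{\mathfrak n+1}=U^{\mathfrak n+1}R_{\mathbf K}$, $\mathbf L^{\mathfrak n+1}=E^{\mathfrak n+1}R_{\mathbf L}$ with $(U^{\mathfrak n+1})^\top U^{\mathfrak n+1}=I_r=(E^{\mathfrak n+1})^\top A_{\boldsymbol 1}E^{\mathfrak n+1}$ (QR and weighted QR; any choice); set $V_0^{\mathfrak n+1}=\{X^\top U^{\mathfrak n+1}S(E^{\mathfrak n+1})^\top Y:S\in\mathbb R^{r\times r}\}$ and let $\hat f_h^{\mathfrak n+1}=X^\top U^{\mathfrak n+1}S^{\mathfrak n+1}(E^{\mathfrak n+1})^\top Y\in V_0^{\mathfrak n+1}$ be the unique solution of $\frac1{\Delta t}(\hat f_h^{\mathfrak n+1}-\hat f_h^{\mathfrak n},w_0;\varepsilon^2)_\Omega=\mathcal A(\hat f_h^{\mathfrak n+1},w_0)$ for all $w_0\in V_0^{\mathfrak n+1}$. If $\hat f_h^0=f_h^{\mathrm{eq}}$, the second entry in the minimum bounding $\delta$ is read as $+\infty$. *)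

theory Defs
  imports
    "HOL-Analysis.Analysis"
    "HOL-Computational_Algebra.Polynomial"
    "Jordan_Normal_Form.Gauss_Jordan_Elimination"
begin

section \<open>Weighted inner product and the bilinear form\<close>

definition weighted_inner ::
  "real \<Rightarrow> (real \<Rightarrow> real \<Rightarrow> real) \<Rightarrow> (real \<Rightarrow> real \<Rightarrow> real) \<Rightarrow> real" where
  "weighted_inner emax v w =
     (LINT \<epsilon>:{0..emax}|lebesgue. (LINT \<mu>:{-1..1}|lebesgue. v \<mu> \<epsilon> * w \<mu> \<epsilon> * \<epsilon>\<^sup>2))"

definition weighted_norm :: "real \<Rightarrow> (real \<Rightarrow> real \<Rightarrow> real) \<Rightarrow> real" where
  "weighted_norm emax w = sqrt (weighted_inner emax w w)"

definition emission_absorption ::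
  "real \<Rightarrow> (real \<Rightarrow> real) \<Rightarrow> (real \<Rightarrow> real) \<Rightarrow>
   (real \<Rightarrow> real \<Rightarrow> real) \<Rightarrow> (real \<Rightarrow> real \<Rightarrow> real) \<Rightarrow> real" where
  "emission_absorption emax \<eta> chi f w =
     weighted_inner emax (\<lambda>\<mu> \<epsilon>. \<eta> \<epsilon>) w - weighted_inner emax (\<lambda>\<mu> \<epsilon>. chi \<epsilon> * f \<mu> \<epsilon>) w"

section \<open>Discontinuous piecewise polynomial spaces\<close>

definition is_partition :: "real \<Rightarrow> real \<Rightarrow> nat \<Rightarrow> (nat \<Rightarrow> real) \<Rightarrow> bool" where
  "is_partition a b N p \<longleftrightarrow> 0 < N \<and> p 0 = a \<and> p N = b \<and> (\<forall>c<N. p c < p (Suc c))"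

text \<open>
  The value of a discontinuous piecewise polynomial at a break point is immaterial in \<open>L\<^sup>2\<close>.
  We fix one representative by using the half-open cells \<open>{p c..<p (Suc c)}\<close> and the value
  zero outside of them. Thus functions in the spaces below agree almost everywhere only if
  they are equal.
\<close>

definition pw_poly_space :: "nat \<Rightarrow> nat \<Rightarrow> (nat \<Rightarrow> real) \<Rightarrow> (real \<Rightarrow> real) set" where
  "pw_poly_space k N p =
     {v. \<exists>q :: nat \<Rightarrow> real poly. (\<forall>c<N. degree (q c) \<le> k) \<and>
           v = (\<lambda>t. \<Sum>c<N. indicator {p c..<p (Suc c)} t * poly (q c) t)}"

definition tensor_space ::
  "(real \<Rightarrow> real) set \<Rightarrow> (real \<Rightarrow> real) set \<Rightarrow> (real \<Rightarrow> real \<Rightarrow> real) set" where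
  "tensor_space V W =
     {f. \<exists>(d::nat) v w. (\<forall>l<d. v l \<in> V \<and> w l \<in> W) \<and> f = (\<lambda>\<mu> \<epsilon>. \<Sum>l<d. v l \<mu> * w l \<epsilon>)}"

text \<open>Rodrigues' formula.\<close>

definition legendre_poly :: "nat \<Rightarrow> real poly" where
  "legendre_poly l =
     Polynomial.smult (1 / (2 ^ l * fact l)) ((pderiv ^^ l) ([:-1, 0, 1:] ^ l))"

definition cell_legendre :: "(nat \<Rightarrow> real) \<Rightarrow> nat \<Rightarrow> nat \<Rightarrow> real \<Rightarrow> real" where
  "cell_legendre p c l t =
     indicator {p c..<p (Suc c)} t *
     poly (legendre_poly l) ((2 * t - p c - p (Suc c)) / (p (Suc c) - p c))"

text \<open>
  Basis function number \<open>i < (k + 1) * N\<close> has degree \<open>i mod (k + 1)\<close> on cell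
  \<open>i div (k + 1)\<close>, and is scaled to have unit (unweighted) \<open>L\<^sup>2\<close> norm.
\<close>

definition legendre_basis :: "nat \<Rightarrow> (nat \<Rightarrow> real) \<Rightarrow> nat \<Rightarrow> real \<Rightarrow> real" where
  "legendre_basis k p i t =
     (let \<phi> = cell_legendre p (i div (k + 1)) (i mod (k + 1))
      in \<phi> t / sqrt (LINT s|lebesgue. (\<phi> s)\<^sup>2))"

section \<open>Matrices\<close>

definition mat_inv :: "real mat \<Rightarrow> real mat" where
  "mat_inv A = the (mat_inverse A)"

definition mat_trace :: "real mat \<Rightarrow> real" where
  "mat_trace A = (\<Sum>i<dim_row A. A $$ (i, i))"

text \<open>Column vectors are matrices with one column.\<close>

definition euclid_norm :: "real mat \<Rightarrow> real" where
  "euclid_norm v = L2_set (\<lambda>i. v $$ (i, 0)) {..<dim_row v}"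

definition mat_norm :: "real mat \<Rightarrow> real mat \<Rightarrow> real" where
  "mat_norm M Z = sqrt (mat_trace (Z * M * Z\<^sup>T))"

definition weighted_mass ::
  "real \<Rightarrow> (real \<Rightarrow> real) \<Rightarrow> nat \<Rightarrow> (nat \<Rightarrow> real \<Rightarrow> real) \<Rightarrow> real mat" where
  "weighted_mass emax \<phi> n y =
     Matrix.mat n n (\<lambda>(i, j). LINT \<epsilon>:{0..emax}|lebesgue. \<phi> \<epsilon> * y i \<epsilon> * y j \<epsilon> * \<epsilon>\<^sup>2)"

definition proj_U :: "real mat \<Rightarrow> real mat" where
  "proj_U U = U * U\<^sup>T"

definition proj_E :: "real mat \<Rightarrow> real mat" where
  "proj_E E = E * E\<^sup>T"

definition proj_E_chi :: "real mat \<Rightarrow> real mat \<Rightarrow> real mat" where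
  "proj_E_chi A_chi E = E * mat_inv (E\<^sup>T * A_chi * E) * E\<^sup>T"

text \<open>The function \<open>X\<^sup>T F Y\<close> with coefficient matrix \<open>F\<close>.\<close>

definition expand ::
  "(nat \<Rightarrow> real \<Rightarrow> real) \<Rightarrow> (nat \<Rightarrow> real \<Rightarrow> real) \<Rightarrow> real mat \<Rightarrow> real \<Rightarrow> real \<Rightarrow> real" where
  "expand x y F = (\<lambda>\<mu> \<epsilon>. \<Sum>i<dim_row F. \<Sum>j<dim_col F. x i \<mu> * F $$ (i, j) * y j \<epsilon>)"

section \<open>The equilibrium and the DLR-DG scheme\<close>

definition is_equilibrium ::
  "real \<Rightarrow> (real \<Rightarrow> real) \<Rightarrow> (real \<Rightarrow> real) \<Rightarrow> (real \<Rightarrow> real \<Rightarrow> real) set \<Rightarrow>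
   (real \<Rightarrow> real \<Rightarrow> real) \<Rightarrow> bool" where
  "is_equilibrium emax \<eta> chi Vh feq \<longleftrightarrow>
     feq \<in> Vh \<and> (\<forall>w\<in>Vh. emission_absorption emax \<eta> chi feq w = 0)"

text \<open>\<open>g\<close> is a Galerkin solution in \<open>V\<close> of one backward Euler step starting from \<open>f\<close>.\<close>

definition euler_galerkin ::
  "real \<Rightarrow> (real \<Rightarrow> real) \<Rightarrow> (real \<Rightarrow> real) \<Rightarrow> real \<Rightarrow> (real \<Rightarrow> real \<Rightarrow> real) set \<Rightarrow>
   (real \<Rightarrow> real \<Rightarrow> real) \<Rightarrow> (real \<Rightarrow> real \<Rightarrow> real) \<Rightarrow> bool" where
  "euler_galerkin emax \<eta> chi \<Delta>t V f g \<longleftrightarrow>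
     g \<in> V \<and>
     (\<forall>w\<in>V. 1 / \<Delta>t * weighted_inner emax (\<lambda>\<mu> \<epsilon>. g \<mu> \<epsilon> - f \<mu> \<epsilon>) w
             = emission_absorption emax \<eta> chi g w)"

definition space_K ::
  "(nat \<Rightarrow> real \<Rightarrow> real) \<Rightarrow> (nat \<Rightarrow> real \<Rightarrow> real) \<Rightarrow> nat \<Rightarrow> nat \<Rightarrow> real mat \<Rightarrow>
   (real \<Rightarrow> real \<Rightarrow> real) set" where
  "space_K x y m r E = {expand x y (K * E\<^sup>T) | K. K \<in> carrier_mat m r}"

definition space_L ::
  "(nat \<Rightarrow> real \<Rightarrow> real) \<Rightarrow> (nat \<Rightarrow> real \<Rightarrow> real) \<Rightarrow> nat \<Rightarrow> nat \<Rightarrow> real mat \<Rightarrow>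
   (real \<Rightarrow> real \<Rightarrow> real) set" where
  "space_L x y n r U = {expand x y (U * L\<^sup>T) | L. L \<in> carrier_mat n r}"

definition space_S ::
  "(nat \<Rightarrow> real \<Rightarrow> real) \<Rightarrow> (nat \<Rightarrow> real \<Rightarrow> real) \<Rightarrow> nat \<Rightarrow> real mat \<Rightarrow> real mat \<Rightarrow>
   (real \<Rightarrow> real \<Rightarrow> real) set" where
  "space_S x y r U E = {expand x y (U * S * E\<^sup>T) | S. S \<in> carrier_mat r r}"

definition dlr_factors ::
  "nat \<Rightarrow> nat \<Rightarrow> nat \<Rightarrow> real mat \<Rightarrow> real mat \<Rightarrow> real mat \<Rightarrow> real mat \<Rightarrow> bool" where
  "dlr_factors m n r A\<^sub>1 U S E \<longleftrightarrow>
     U \<in> carrier_mat m r \<and> S \<in> carrier_mat r r \<and> E \<in> carrier_mat n r \<and>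
     U\<^sup>T * U = 1\<^sub>m r \<and> E\<^sup>T * A\<^sub>1 * E = 1\<^sub>m r"

text \<open>
  The factors of \<open>K\<close> and \<open>L\<close> are not unique, so that a step is a relation. The square
  factors need not be triangular: the scheme depends on the new bases only through their
  column spans.
\<close>

definition dlr_dg_step ::
  "real \<Rightarrow> (real \<Rightarrow> real) \<Rightarrow> (real \<Rightarrow> real) \<Rightarrow> (nat \<Rightarrow> real \<Rightarrow> real) \<Rightarrow> (nat \<Rightarrow> real \<Rightarrow> real) \<Rightarrow>
   nat \<Rightarrow> nat \<Rightarrow> nat \<Rightarrow> real mat \<Rightarrow> real \<Rightarrow>
   real mat \<Rightarrow> real mat \<Rightarrow> real mat \<Rightarrow> real mat \<Rightarrow> real mat \<Rightarrow> real mat \<Rightarrow> bool" where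
  "dlr_dg_step emax \<eta> chi x y m n r A\<^sub>1 \<Delta>t U S E U' S' E' \<longleftrightarrow>
     dlr_factors m n r A\<^sub>1 U' S' E' \<and>
     (\<exists>K L R\<^sub>K R\<^sub>L.
        K \<in> carrier_mat m r \<and> L \<in> carrier_mat n r \<and>
        R\<^sub>K \<in> carrier_mat r r \<and> R\<^sub>L \<in> carrier_mat r r \<and>
        euler_galerkin emax \<eta> chi \<Delta>t (space_K x y m r E)
          (expand x y (U * S * E\<^sup>T)) (expand x y (K * E\<^sup>T)) \<and>
        euler_galerkin emax \<eta> chi \<Delta>t (space_L x y n r U)
          (expand x y (U * S * E\<^sup>T)) (expand x y (U * L\<^sup>T)) \<and>
        K = U' * R\<^sub>K \<and> L = E' * R\<^sub>L) \<and>
     euler_galerkin emax \<eta> chi \<Delta>t (space_S x y r U' E')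
       (expand x y (U * S * E\<^sup>T)) (expand x y (U' * S' * E'\<^sup>T))"

definition dlr_dg_solution ::
  "real \<Rightarrow> (real \<Rightarrow> real) \<Rightarrow> (real \<Rightarrow> real) \<Rightarrow> (nat \<Rightarrow> real \<Rightarrow> real) \<Rightarrow> (nat \<Rightarrow> real \<Rightarrow> real) \<Rightarrow>
   nat \<Rightarrow> nat \<Rightarrow> nat \<Rightarrow> real mat \<Rightarrow> real \<Rightarrow>
   (nat \<Rightarrow> real mat) \<Rightarrow> (nat \<Rightarrow> real mat) \<Rightarrow> (nat \<Rightarrow> real mat) \<Rightarrow> bool" where
  "dlr_dg_solution emax \<eta> chi x y m n r A\<^sub>1 \<Delta>t U S E \<longleftrightarrow>
     dlr_factors m n r A\<^sub>1 (U 0) (S 0) (E 0) \<and>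
     (\<forall>\<nn>. dlr_dg_step emax \<eta> chi x y m n r A\<^sub>1 \<Delta>t
            (U \<nn>) (S \<nn>) (E \<nn>) (U (Suc \<nn>)) (S (Suc \<nn>)) (E (Suc \<nn>)))"

end

theory Submission
  imports Defs "Jordan_Normal_Form.Determinant"
begin

text \<open>
  Since the basis \<open>x\<close> is orthonormal, the weighted inner product of two functions
  \<open>X\<^sup>T F Y\<close> and \<open>X\<^sup>T G Y\<close> is \<open>tr (F A\<^sub>1 G\<^sup>T)\<close>, and with the opacity as an additional
  weight it is \<open>tr (F A_chi G\<^sup>T)\<close>. The equilibrium is the rank one matrix
  \<open>s u e\<close> with the unit column \<open>u = Ueq\<close>, the unit row \<open>e = Eeq\<^sup>T\<close> and
  \<open>s = \<parallel>L\<^sub>0\<parallel> \<parallel>L\<eta>\<^sup>T A_chi\<^sup>-\<^sup>1\<parallel>\<close>, and the residual of \<open>F\<close> is the inner product of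
  \<open>Feq - F\<close> with the test matrix in the weight \<open>A_chi\<close>. Hence the scheme can be studied on
  coefficient matrices alone, by energy arguments: each estimate below comes from one or two
  well chosen test matrices.

  Let \<open>D\<close> be the norm of the error before a step, and let the defects of the new bases be
  \<open>q_U = s \<parallel>(I - P\<^sub>U) u\<parallel>\<close> and \<open>q_E = s \<parallel>e - e A\<^sub>1 P\<^sub>E\<parallel>\<close>. In the K-step the solution lies in the
  range of the new column basis, so testing with a rank one matrix whose column is
  \<open>(I - P\<^sub>U) u\<close> isolates \<open>q_U\<close>; the overlap of \<open>e\<close> with the old row basis, at least \<open>\<alpha>\<close>, makes
  the test effective (\<open>K_step_column_defect\<close>). The L-step bounds \<open>q_E\<close> in the same way, with the
  overlap \<open>\<beta>\<close> of \<open>u\<close> with the old column basis (\<open>L_step_row_defect\<close>). For a large time step both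
  defects are at most \<open>\<delta> D / sqrt 2\<close>. In the S-step the Galerkin error splits into a damped part
  and the best approximation error of the equilibrium in the new space, whose norm is at most
  \<open>sqrt (q_U\<^sup>2 + q_E\<^sup>2) \<le> \<delta> D\<close> (\<open>S_step_error\<close>). The damping factor is \<open>c\<close>, and the lack of
  orthogonality in the weight \<open>A_chi\<close> costs at most \<open>(chi_max / chi_min) q_E\<close>.

  The same defect bounds keep the iteration going: by Pythagoras the overlap of \<open>u\<close> and of \<open>e\<close>
  with the new bases is at least \<open>max \<gamma> \<beta>\<close>, because the error has not grown and the upper bound
  on \<open>\<delta>\<close> was chosen for the initial error. This gives the contraction by induction
  (\<open>contraction\<close>). If the initial value is the equilibrium, all three substeps reproduce it, for
  any time step (\<open>step_preserves_equilibrium\<close>).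

  The passage from functions to coefficients rests on two facts about the Legendre basis: it is
  orthonormal, and it spans the piecewise polynomials.
\<close>

section \<open>Weighted Frobenius inner products\<close>

text \<open>
  With \<open>M = A\<^sub>1\<close> this is the weighted \<open>L\<^sup>2\<close> inner product of the functions with coefficient
  matrices \<open>F\<close> and \<open>G\<close>. The number of rows is left open, so that row vectors of coefficients
  are covered as well.
\<close>

definition frob :: "real mat \<Rightarrow> real mat \<Rightarrow> real mat \<Rightarrow> real" where
  "frob M F G = mat_trace (F * M * G\<^sup>T)"

lemma mat_trace_add:
  "A \<in> carrier_mat p p \<Longrightarrow> B \<in> carrier_mat p p \<Longrightarrow> mat_trace (A + B) = mat_trace A + mat_trace B"
  by (simp add: mat_trace_def sum.distrib)

lemma mat_trace_smult: "A \<in> carrier_mat p p \<Longrightarrow> mat_trace (a \<cdot>\<^sub>m A) = a * mat_trace A"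
  by (simp add: mat_trace_def sum_distrib_left)

lemma mat_trace_transpose: "A \<in> carrier_mat p p \<Longrightarrow> mat_trace (A\<^sup>T) = mat_trace A"
  by (simp add: mat_trace_def)

lemma mat_trace_mult_commute:
  assumes "A \<in> carrier_mat p q" "B \<in> carrier_mat q p"
  shows "mat_trace (A * B) = mat_trace (B * A)"
proof -
  have "mat_trace (A * B) = (\<Sum>i<p. \<Sum>j<q. A $$ (i, j) * B $$ (j, i))"
    using assms by (simp add: mat_trace_def scalar_prod_def atLeast0LessThan)
  also have "\<dots> = (\<Sum>j<q. \<Sum>i<p. B $$ (j, i) * A $$ (i, j))"
    by (subst sum.swap) (simp add: mult.commute)
  also have "\<dots> = mat_trace (B * A)"
    using assms by (simp add: mat_trace_def scalar_prod_def atLeast0LessThan)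
  finally show ?thesis .
qed

lemma frob_commute:
  assumes [simp]: "M \<in> carrier_mat n n" "F \<in> carrier_mat p n" "G \<in> carrier_mat p n"
    and sym: "M\<^sup>T = M"
  shows "frob M F G = frob M G F"
proof -
  have [simp]: "F\<^sup>T \<in> carrier_mat n p" "G\<^sup>T \<in> carrier_mat n p"
    using assms by auto
  have "(F * M * G\<^sup>T)\<^sup>T = G\<^sup>T\<^sup>T * (F * M)\<^sup>T"
    by (rule transpose_mult[of _ p n _ p]) (auto intro: mult_carrier_mat[of _ _ n])
  also have "(F * M)\<^sup>T = M\<^sup>T * F\<^sup>T"
    by (rule transpose_mult[of _ p n _ n]) auto
  finally have "(F * M * G\<^sup>T)\<^sup>T = G * (M * F\<^sup>T)"
    using sym by simp
  also have "\<dots> = G * M * F\<^sup>T"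
    by (rule assoc_mult_mat[symmetric, of _ p n _ n _ p]) auto
  finally have "G * M * F\<^sup>T = (F * M * G\<^sup>T)\<^sup>T" by simp
  moreover have "F * M * G\<^sup>T \<in> carrier_mat p p"
    by (auto intro!: mult_carrier_mat[of _ _ n])
  ultimately show ?thesis
    unfolding frob_def by (simp add: mat_trace_transpose)
qed

lemma frob_add_left:
  assumes [simp]: "M \<in> carrier_mat n n" "F \<in> carrier_mat p n" "G \<in> carrier_mat p n" "H \<in> carrier_mat p n"
  shows "frob M (F + G) H = frob M F H + frob M G H"
proof -
  have H: "H\<^sup>T \<in> carrier_mat n p" by simp
  have FM: "F * M \<in> carrier_mat p n" "G * M \<in> carrier_mat p n"
    using assms mult_carrier_mat by blast+
  have "(F + G) * M * H\<^sup>T = F * M * H\<^sup>T + G * M * H\<^sup>T"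
    by (simp add: add_mult_distrib_mat[OF assms(2,3,1)] add_mult_distrib_mat[OF FM H])
  then show ?thesis
    unfolding frob_def
    using mat_trace_add[OF mult_carrier_mat[OF FM(1) H] mult_carrier_mat[OF FM(2) H]] by simp
qed

lemma frob_smult_left:
  assumes [simp]: "M \<in> carrier_mat n n" "F \<in> carrier_mat p n" "G \<in> carrier_mat p n"
  shows "frob M (a \<cdot>\<^sub>m F) G = a * frob M F G"
proof -
  have G: "G\<^sup>T \<in> carrier_mat n p" by simp
  have FM: "F * M \<in> carrier_mat p n"
    using assms mult_carrier_mat by blast
  have "(a \<cdot>\<^sub>m F) * M * G\<^sup>T = a \<cdot>\<^sub>m (F * M * G\<^sup>T)"
    by (simp add: mult_smult_assoc_mat[OF assms(2,1)] mult_smult_assoc_mat[OF FM G])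
  then show ?thesis
    unfolding frob_def using mat_trace_smult[OF mult_carrier_mat[OF FM G]] by simp
qed

lemma frob_diff_left:
  assumes [simp]: "M \<in> carrier_mat n n" "F \<in> carrier_mat p n" "G \<in> carrier_mat p n" "H \<in> carrier_mat p n"
  shows "frob M (F - G) H = frob M F H - frob M G H"
proof -
  have "F - G = F + (-1) \<cdot>\<^sub>m G" by (rule eq_matI) (auto simp: carrier_matD[OF assms(2)] carrier_matD[OF assms(3)])
  then show ?thesis
    using frob_add_left[OF assms(1,2) smult_carrier_mat[OF assms(3)] assms(4)]
      frob_smult_left[OF assms(1,3,4)] by simp
qed

lemma frob_mult_left:
  assumes [simp]: "M \<in> carrier_mat n n" "A \<in> carrier_mat p q" "F \<in> carrier_mat q n" "G \<in> carrier_mat p n"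
  shows "frob M (A * F) G = frob M F (A\<^sup>T * G)"
proof -
  have T: "G\<^sup>T \<in> carrier_mat n p" "A\<^sup>T \<in> carrier_mat q p" by simp_all
  have FM: "F * M \<in> carrier_mat q n" by (rule mult_carrier_mat[of _ _ n]) auto
  have FMG: "F * M * G\<^sup>T \<in> carrier_mat q p" by (rule mult_carrier_mat[OF FM T(1)])
  have "A * F * M * G\<^sup>T = A * (F * M * G\<^sup>T)"
    by (simp only: assoc_mult_mat[OF assms(2,3,1)] assoc_mult_mat[OF assms(2) FM T(1)])
  then have "frob M (A * F) G = mat_trace (F * M * G\<^sup>T * A)"
    unfolding frob_def using mat_trace_mult_commute[OF assms(2) FMG] by simp
  also have "F * M * G\<^sup>T * A = F * M * (A\<^sup>T * G)\<^sup>T"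
    by (simp only: transpose_mult[OF T(2) assms(4)] assoc_mult_mat[OF FM T(1) assms(2)] transpose_transpose)
  finally show ?thesis by (simp add: frob_def)
qed

lemma frob_mult_right:
  assumes [simp]: "M \<in> carrier_mat n n" "F \<in> carrier_mat p n" "H \<in> carrier_mat p r" "E \<in> carrier_mat n r"
  shows "frob M F (H * E\<^sup>T) = mat_trace (F * M * E * H\<^sup>T)"
proof -
  have [simp]: "E\<^sup>T \<in> carrier_mat r n" "H\<^sup>T \<in> carrier_mat r p" by simp_all
  have FM [simp]: "F * M \<in> carrier_mat p n" by (rule mult_carrier_mat[of _ _ n]) auto
  show ?thesis
    unfolding frob_def
    by (subst transpose_mult[of _ p r _ n], simp_all) (subst assoc_mult_mat[of "F * M" p n _ r _ p], simp_all)
qed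

lemma frob_smult_col:
  assumes "k \<in> carrier_mat 1 1" "M \<in> carrier_mat n n" "F \<in> carrier_mat 1 n" "G \<in> carrier_mat 1 n"
  shows "frob M F (k * G) = k $$ (0, 0) * frob M F G"
proof -
  have "k * G = k $$ (0, 0) \<cdot>\<^sub>m G"
    using assms by (intro eq_matI) (auto simp: scalar_prod_def)
  moreover have "(F * M * (k $$ (0, 0) \<cdot>\<^sub>m G)\<^sup>T) = k $$ (0, 0) \<cdot>\<^sub>m (F * M * G\<^sup>T)"
  proof -
    have "F * M \<in> carrier_mat 1 n" "G\<^sup>T \<in> carrier_mat n 1"
      using assms mult_carrier_mat by (blast, simp)
    then have "F * M * (k $$ (0, 0) \<cdot>\<^sub>m G\<^sup>T) = k $$ (0, 0) \<cdot>\<^sub>m (F * M * G\<^sup>T)"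
      by (rule mult_smult_distrib)
    moreover have "(k $$ (0, 0) \<cdot>\<^sub>m G)\<^sup>T = k $$ (0, 0) \<cdot>\<^sub>m G\<^sup>T"
      by (intro eq_matI) auto
    ultimately show ?thesis by simp
  qed
  moreover have "F * M * G\<^sup>T \<in> carrier_mat 1 1"
    using assms by (auto intro!: mult_carrier_mat[of _ _ n])
  ultimately show ?thesis unfolding frob_def by (simp add: mat_trace_smult)
qed

definition dot :: "real mat \<Rightarrow> real mat \<Rightarrow> real" where
  "dot a c = (a\<^sup>T * c) $$ (0, 0)"

text \<open>
  Inner products of rank one matrices factor; this is why the errors in the two bases can be
  estimated one at a time.
\<close>

lemma frob_outer:
  assumes "M \<in> carrier_mat n n" "a \<in> carrier_mat p 1" "c \<in> carrier_mat p 1"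
    "b \<in> carrier_mat 1 n" "d \<in> carrier_mat 1 n"
  shows "frob M (a * b) (c * d) = dot a c * frob M b d"
proof -
  have a: "a\<^sup>T \<in> carrier_mat 1 p" using assms by (simp del: One_nat_def)
  have cd: "c * d \<in> carrier_mat p n" using assms mult_carrier_mat by blast
  have "frob M (a * b) (c * d) = frob M b (a\<^sup>T * (c * d))"
    by (rule frob_mult_left[OF assms(1,2,4) cd])
  also have "a\<^sup>T * (c * d) = a\<^sup>T * c * d"
    by (rule assoc_mult_mat[OF a assms(3,5), symmetric])
  also have "frob M b \<dots> = dot a c * frob M b d"
    unfolding dot_def by (rule frob_smult_col[OF mult_carrier_mat[OF a assms(3)] assms(1,4,5)])
  finally show ?thesis .
qed

lemma dot_eq_sum: "a \<in> carrier_mat p 1 \<Longrightarrow> c \<in> carrier_mat p 1 \<Longrightarrow> dot a c = (\<Sum>i<p. a $$ (i, 0) * c $$ (i, 0))"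
  by (simp add: dot_def scalar_prod_def atLeast0LessThan)

lemma euclid_norm_sq: "a \<in> carrier_mat p 1 \<Longrightarrow> (euclid_norm a)\<^sup>2 = dot a a"
  by (simp add: dot_eq_sum euclid_norm_def L2_set_def sum_nonneg power2_eq_square)

lemma euclid_norm_nonneg: "euclid_norm a \<ge> 0"
  by (simp add: euclid_norm_def L2_set_def sum_nonneg)

text \<open>
  The form is only assumed to be nonnegative, so the usual quadratic polynomial in \<open>t\<close> may
  degenerate to a linear one.
\<close>

lemma frob_Cauchy_Schwarz:
  assumes M: "M \<in> carrier_mat n n" "M\<^sup>T = M"
    and pos: "\<And>F. F \<in> carrier_mat p n \<Longrightarrow> 0 \<le> frob M F F"
    and FG: "F \<in> carrier_mat p n" "G \<in> carrier_mat p n"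
  shows "\<bar>frob M F G\<bar> \<le> sqrt (frob M F F) * sqrt (frob M G G)"
proof -
  define a b g where "a = frob M F F" and "b = frob M F G" and "g = frob M G G"
  have q: "0 \<le> a + 2 * t * b + t\<^sup>2 * g" for t
  proof -
    have tG: "t \<cdot>\<^sub>m G \<in> carrier_mat p n" using FG by simp
    have FtG: "F + t \<cdot>\<^sub>m G \<in> carrier_mat p n" using FG by simp
    have "frob M (F + t \<cdot>\<^sub>m G) (F + t \<cdot>\<^sub>m G) = frob M F (F + t \<cdot>\<^sub>m G) + t * frob M G (F + t \<cdot>\<^sub>m G)"
      using frob_add_left[OF M(1) FG(1) tG FtG] frob_smult_left[OF M(1) FG(2) FtG] by simp
    also have "\<dots> = frob M (F + t \<cdot>\<^sub>m G) F + t * frob M (F + t \<cdot>\<^sub>m G) G"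
      using frob_commute[OF M(1) FtG FG(1) M(2)] frob_commute[OF M(1) FtG FG(2) M(2)] by simp
    also have "\<dots> = a + t * b + t * (b + t * g)"
      using frob_add_left[OF M(1) FG(1) tG FG(1)] frob_add_left[OF M(1) FG(1) tG FG(2)]
        frob_smult_left[OF M(1) FG(2) FG(1)] frob_smult_left[OF M(1) FG(2) FG(2)]
        frob_commute[OF M(1) FG(2) FG(1) M(2)] by (simp add: a_def b_def g_def)
    finally show ?thesis using pos[OF FtG] by (simp add: power2_eq_square algebra_simps)
  qed
  have a0: "0 \<le> a" and g0: "0 \<le> g" using pos FG by (auto simp: a_def g_def)
  have "b\<^sup>2 \<le> a * g"
  proof (cases "g = 0")
    case True
    have "b = 0"
    proof (rule ccontr)
      \<comment> \<open>if \<open>b \<noteq> 0\<close> the linear polynomial \<open>a + 2 * t * b\<close> takes the value \<open>-1\<close>\<close>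
      assume "b \<noteq> 0"
      then show False using q[of "- (a + 1) / (2 * b)"] True a0 by (simp add: field_simps)
    qed
    then show ?thesis using True by simp
  next
    case False
    then show ?thesis
      using q[of "- b / g"] g0 by (simp add: field_simps power2_eq_square)
  qed
  then have "sqrt (b\<^sup>2) \<le> sqrt (a * g)" by (rule real_sqrt_le_mono)
  then show ?thesis by (simp add: real_sqrt_mult a_def b_def g_def)
qed

lemma frob_add_right:
  assumes "M \<in> carrier_mat n n" "M\<^sup>T = M"
    and "H \<in> carrier_mat p n" "F \<in> carrier_mat p n" "G \<in> carrier_mat p n"
  shows "frob M H (F + G) = frob M H F + frob M H G"
  using frob_add_left[OF assms(1,4,5,3)] frob_commute[OF assms(1) _ _ assms(2)] assms
  by (metis add_carrier_mat)

lemma frob_smult_right: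
  assumes "M \<in> carrier_mat n n" "M\<^sup>T = M" "F \<in> carrier_mat p n" "G \<in> carrier_mat p n"
  shows "frob M F (a \<cdot>\<^sub>m G) = a * frob M F G"
  using frob_smult_left[OF assms(1,4,3)] frob_commute[OF assms(1) _ _ assms(2)] assms
  by (metis smult_carrier_mat)

lemma mat_norm_eq_frob: "mat_norm M F = sqrt (frob M F F)"
  by (simp add: mat_norm_def frob_def)

text \<open>
  This and the next lemma discard the computed solution when a step is tested with \<open>a b\<close>: one
  of its factors lies in the span of the new basis, to which \<open>a\<close> or \<open>b\<close> is orthogonal.
\<close>

lemma frob_orthogonal_col:
  assumes M: "M \<in> carrier_mat n n" and U: "U \<in> carrier_mat p q" and Z: "Z \<in> carrier_mat q n"
    and a: "a \<in> carrier_mat p 1" and b: "b \<in> carrier_mat 1 n"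
    and orth: "U\<^sup>T * a = 0\<^sub>m q 1"
  shows "frob M (U * Z) (a * b) = 0"
proof -
  have UT: "U\<^sup>T \<in> carrier_mat q p" using U by simp
  have "U\<^sup>T * (a * b) = U\<^sup>T * a * b"
    by (rule assoc_mult_mat[OF UT a b, symmetric])
  also have "\<dots> = 0\<^sub>m q n"
    using b by (simp add: orth del: One_nat_def)
  finally have *: "U\<^sup>T * (a * b) = 0\<^sub>m q n" .
  have "frob M (U * Z) (a * b) = frob M Z (0\<^sub>m q n)"
    using frob_mult_left[OF M U Z mult_carrier_mat[OF a b]] by (simp add: *)
  also have "\<dots> = 0"
  proof -
    have "(0\<^sub>m q n :: real mat)\<^sup>T = 0\<^sub>m n q" by (intro eq_matI) auto
    moreover have "Z * M \<in> carrier_mat q n" using Z M mult_carrier_mat by blast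
    then have "Z * M * 0\<^sub>m n q = 0\<^sub>m q q" by (rule right_mult_zero_mat)
    ultimately show ?thesis by (simp add: frob_def mat_trace_def)
  qed
  finally show ?thesis .
qed

lemma frob_orthogonal_row:
  assumes M: "M \<in> carrier_mat n n" and H: "H \<in> carrier_mat p q" and E: "E \<in> carrier_mat n q"
    and a: "a \<in> carrier_mat p 1" and b: "b \<in> carrier_mat 1 n"
    and orth: "b * M * E = 0\<^sub>m 1 q"
  shows "frob M (a * b) (H * E\<^sup>T) = 0"
proof -
  have bM: "b * M \<in> carrier_mat 1 n" using b M mult_carrier_mat by blast
  have "a * b * M * E = a * (b * M * E)"
    by (simp only: assoc_mult_mat[OF a b M] assoc_mult_mat[OF a bM E])
  also have "\<dots> = 0\<^sub>m p q"
    using a by (simp add: orth del: One_nat_def)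
  finally have *: "a * b * M * E = 0\<^sub>m p q" .
  have "H\<^sup>T \<in> carrier_mat q p" using H by simp
  then show ?thesis
    unfolding frob_mult_right[OF M mult_carrier_mat[OF a b] H E] * by (simp add: mat_trace_def)
qed

lemmas mat_carrier_intros = mult_carrier_mat smult_carrier_mat minus_carrier_mat add_carrier_mat
  transpose_carrier_mat[THEN iffD2]

text \<open>
  The pointwise opacity bounds survive discretisation as bounds between the two forms. They are
  stated for any number of rows because the energy estimates apply them to whole coefficient
  matrices as well as to single rows.
\<close>

locale mass_matrices =
  fixes n :: nat and A\<^sub>1 A_chi :: "real mat" and chi_min chi_max :: real
  assumes A1_carrier [simp]: "A\<^sub>1 \<in> carrier_mat n n"
    and Achi_carrier [simp]: "A_chi \<in> carrier_mat n n"
    and A1_sym: "A\<^sub>1\<^sup>T = A\<^sub>1"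
    and Achi_sym: "A_chi\<^sup>T = A_chi"
    and chi_min_pos: "0 < chi_min"
    and frob_A1_nonneg: "F \<in> carrier_mat p n \<Longrightarrow> 0 \<le> frob A\<^sub>1 F F"
    and frob_A1_definite: "F \<in> carrier_mat p n \<Longrightarrow> frob A\<^sub>1 F F = 0 \<Longrightarrow> F = 0\<^sub>m p n"
    and frob_lower: "F \<in> carrier_mat p n \<Longrightarrow> chi_min * frob A\<^sub>1 F F \<le> frob A_chi F F"
    and frob_upper: "F \<in> carrier_mat p n \<Longrightarrow> frob A_chi F F \<le> chi_max * frob A\<^sub>1 F F"
begin

lemma frob_Achi_nonneg: "F \<in> carrier_mat p n \<Longrightarrow> 0 \<le> frob A_chi F F"
  using frob_lower frob_A1_nonneg chi_min_pos by (meson order.trans mult_nonneg_nonneg less_imp_le)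

lemma chi_min_le_chi_max_if_nonzero: assumes "F \<in> carrier_mat p n" "frob A\<^sub>1 F F \<noteq> 0" shows "chi_min \<le> chi_max"
proof -
  have "chi_min * frob A\<^sub>1 F F \<le> chi_max * frob A\<^sub>1 F F"
    using frob_lower[OF assms(1)] frob_upper[OF assms(1)] by linarith
  then show ?thesis
    using frob_A1_nonneg[OF assms(1)] assms(2) by simp
qed

abbreviation nrm :: "real mat \<Rightarrow> real" where "nrm F \<equiv> mat_norm A\<^sub>1 F"

lemma nrm_sq: "F \<in> carrier_mat p n \<Longrightarrow> (nrm F)\<^sup>2 = frob A\<^sub>1 F F"
  by (simp add: mat_norm_eq_frob frob_A1_nonneg)

lemma nrm_nonneg: "F \<in> carrier_mat p n \<Longrightarrow> 0 \<le> nrm F"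
  by (simp add: mat_norm_eq_frob frob_A1_nonneg)

lemma Cauchy_Schwarz_A1:
  "F \<in> carrier_mat p n \<Longrightarrow> G \<in> carrier_mat p n \<Longrightarrow> \<bar>frob A\<^sub>1 F G\<bar> \<le> nrm F * nrm G"
  unfolding mat_norm_eq_frob
  by (rule frob_Cauchy_Schwarz[OF A1_carrier A1_sym frob_A1_nonneg])

lemma Cauchy_Schwarz_Achi:
  "F \<in> carrier_mat p n \<Longrightarrow> G \<in> carrier_mat p n \<Longrightarrow>
    \<bar>frob A_chi F G\<bar> \<le> sqrt (frob A_chi F F) * sqrt (frob A_chi G G)"
  by (rule frob_Cauchy_Schwarz[OF Achi_carrier Achi_sym frob_Achi_nonneg])

text \<open>
  Cauchy-Schwarz in the weight \<open>A_chi\<close>, followed by the upper opacity bound for both factors.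
\<close>

lemma Achi_bounded:
  assumes "F \<in> carrier_mat p n" "G \<in> carrier_mat p n"
  shows "\<bar>frob A_chi F G\<bar> \<le> chi_max * (nrm F * nrm G)"
proof (cases "frob A\<^sub>1 F F = 0")
  case True
  then have "frob A_chi F F = 0"
    using frob_upper[OF assms(1)] frob_Achi_nonneg[OF assms(1)] by simp
  then show ?thesis
    using Cauchy_Schwarz_Achi[OF assms] True by (simp add: mat_norm_eq_frob)
next
  case False
  have pos: "0 \<le> chi_max" using chi_min_le_chi_max_if_nonzero[OF assms(1) False] chi_min_pos by simp
  have "sqrt (frob A_chi F F) * sqrt (frob A_chi G G) \<le> (sqrt chi_max * nrm F) * (sqrt chi_max * nrm G)"
    unfolding mat_norm_eq_frob real_sqrt_mult[symmetric]
    using frob_upper[OF assms(1)] frob_upper[OF assms(2)]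
    by (intro real_sqrt_le_mono mult_mono) (auto simp: frob_Achi_nonneg[OF assms(2)] pos frob_A1_nonneg[OF assms(1)])
  also have "\<dots> = chi_max * (nrm F * nrm G)" using pos by simp
  finally show ?thesis using Cauchy_Schwarz_Achi[OF assms] by linarith
qed

lemma nrm_triangle:
  assumes "F \<in> carrier_mat p n" "G \<in> carrier_mat p n"
  shows "nrm (F + G) \<le> nrm F + nrm G"
proof (rule power2_le_imp_le)
  have FG: "F + G \<in> carrier_mat p n" using assms by simp
  have "(nrm (F + G))\<^sup>2 = (nrm F)\<^sup>2 + 2 * frob A\<^sub>1 F G + (nrm G)\<^sup>2"
    unfolding nrm_sq[OF FG] nrm_sq[OF assms(1)] nrm_sq[OF assms(2)]
    using frob_add_left[OF A1_carrier assms FG] frob_add_right[OF A1_carrier A1_sym assms(1) assms]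
      frob_add_right[OF A1_carrier A1_sym assms(2) assms] frob_commute[OF A1_carrier assms A1_sym]
    by simp
  also have "\<dots> \<le> (nrm F)\<^sup>2 + 2 * (nrm F * nrm G) + (nrm G)\<^sup>2"
    using Cauchy_Schwarz_A1[OF assms] by simp
  finally show "(nrm (F + G))\<^sup>2 \<le> (nrm F + nrm G)\<^sup>2"
    by (simp add: power2_sum)
  show "0 \<le> nrm F + nrm G" using nrm_nonneg assms by (simp add: add_nonneg_nonneg)
qed

lemma nrm_outer:
  "a \<in> carrier_mat p 1 \<Longrightarrow> b \<in> carrier_mat 1 n \<Longrightarrow> nrm (a * b) = euclid_norm a * nrm b"
  unfolding mat_norm_eq_frob
  by (subst frob_outer[OF A1_carrier], assumption+)
    (simp add: euclid_norm_sq[symmetric] real_sqrt_mult euclid_norm_nonneg)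

lemma eq_if_nrm_diff_eq_0:
  assumes "F \<in> carrier_mat p n" "G \<in> carrier_mat p n" "nrm (F - G) = 0"
  shows "F = G"
proof (rule eq_matI)
  have c: "F - G \<in> carrier_mat p n" using assms(1,2) by (blast intro: mat_carrier_intros)
  have "frob A\<^sub>1 (F - G) (F - G) = 0" using assms(3) by (simp add: mat_norm_eq_frob)
  then have 0: "F - G = 0\<^sub>m p n" by (rule frob_A1_definite[OF c])
  fix i j assume "i < dim_row G" "j < dim_col G"
  then have ij: "i < p" "j < n" using assms(2) by auto
  have "(F - G) $$ (i, j) = 0" using ij by (simp add: 0)
  then show "F $$ (i, j) = G $$ (i, j)" using ij assms(1,2) by simp
qed (use assms in auto)

end

text \<open>
  The unit matrices as test matrices single out the entries.
\<close>

lemma mat_eq_if_traces_eq: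
  assumes X: "X \<in> carrier_mat p q" and Y: "Y \<in> carrier_mat p q"
    and eq: "\<And>W. W \<in> carrier_mat p q \<Longrightarrow> mat_trace (X * W\<^sup>T) = mat_trace (Y * W\<^sup>T)"
  shows "X = Y"
proof (rule eq_matI)
  fix i j assume "i < dim_row Y" "j < dim_col Y"
  then have ij: "i < p" "j < q" using Y by auto
  define W where "W = Matrix.mat p q (\<lambda>(k, l). if k = i then (if l = j then 1 else 0) else (0 :: real))"
  have W: "W \<in> carrier_mat p q" by (simp add: W_def)
  have "mat_trace (Z * W\<^sup>T) = Z $$ (i, j)" if Z: "Z \<in> carrier_mat p q" for Z
  proof -
    have "mat_trace (Z * W\<^sup>T) = (\<Sum>k<p. \<Sum>l<q. Z $$ (k, l) * (if k = i then (if l = j then 1 else 0) else 0))"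
      using Z by (simp add: mat_trace_def scalar_prod_def W_def atLeast0LessThan)
    also have "\<dots> = (\<Sum>k<p. if k = i then (\<Sum>l<q. if l = j then Z $$ (k, l) else 0) else 0)"
      by (intro sum.cong refl) (simp add: mult_delta_right)
    also have "\<dots> = Z $$ (i, j)" using ij by simp
    finally show ?thesis .
  qed
  then show "X $$ (i, j) = Y $$ (i, j)" using eq[OF W] X Y by simp
qed (use X Y in auto)

section \<open>Inverse mass matrices and the equilibrium factors\<close>

lemma mat_inv_if_left_kernel_trivial:
  assumes N: "N \<in> carrier_mat p p"
    and ker: "\<And>v. v \<in> carrier_mat 1 p \<Longrightarrow> v * N = 0\<^sub>m 1 p \<Longrightarrow> v = 0\<^sub>m 1 p"
  shows "mat_inv N \<in> carrier_mat p p" "N * mat_inv N = 1\<^sub>m p" "mat_inv N * N = 1\<^sub>m p"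
proof -
  have "Determinant.det N \<noteq> 0"
  proof
    assume "Determinant.det N = 0"
    then have "Determinant.det (N\<^sup>T) = 0" using det_transpose[OF N] by simp
    moreover have NT: "N\<^sup>T \<in> carrier_mat p p" using N by simp
    ultimately obtain w where w: "w \<in> carrier_vec p" "w \<noteq> 0\<^sub>v p" "N\<^sup>T *\<^sub>v w = 0\<^sub>v p"
      using det_0_iff_vec_prod_zero_field by blast
    define v where "v = Matrix.mat 1 p (\<lambda>(i, j). w $ j)"
    have v: "v \<in> carrier_mat 1 p" by (simp add: v_def)
    have "v * N = 0\<^sub>m 1 p"
    proof (rule eq_matI)
      fix i j assume "i < dim_row (0\<^sub>m 1 p)" "j < dim_col (0\<^sub>m 1 p)"
      then have ij: "i = 0" "j < p" by auto
      have "(v * N) $$ (0, j) = (N\<^sup>T *\<^sub>v w) $ j"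
        using N ij w(1) by (simp add: v_def scalar_prod_def mult.commute)
      then show "(v * N) $$ (i, j) = 0\<^sub>m 1 p $$ (i, j)" using ij w(3) by simp
    qed (use v N in auto)
    then have v0: "v = 0\<^sub>m 1 p" by (rule ker[OF v])
    have "w $ j = 0" if "j < p" for j
    proof -
      have "v $$ (0, j) = w $ j" using that by (simp add: v_def)
      then show ?thesis using v0 that by simp
    qed
    then have "w = 0\<^sub>v p" using w(1) by (intro eq_vecI) auto
    then show False using w(2) by simp
  qed
  then have "N \<in> Units (ring_mat TYPE(real) p ())" by (rule det_non_zero_imp_unit[OF N])
  then obtain B where B: "mat_inverse N = Some B" using mat_inverse(1)[OF N, of "()"] by (cases "mat_inverse N") auto
  then have "mat_inv N = B" by (simp add: mat_inv_def)
  then show "mat_inv N \<in> carrier_mat p p" "N * mat_inv N = 1\<^sub>m p" "mat_inv N * N = 1\<^sub>m p"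
    using mat_inverse(2)[OF N B] by auto
qed

context mass_matrices
begin

lemma Achi_definite:
  assumes "F \<in> carrier_mat p n" "frob A_chi F F = 0" shows "F = 0\<^sub>m p n"
proof (rule frob_A1_definite[OF assms(1)])
  have "chi_min * frob A\<^sub>1 F F \<le> 0" using frob_lower[OF assms(1)] assms(2) by simp
  then show "frob A\<^sub>1 F F = 0"
    using frob_A1_nonneg[OF assms(1)] chi_min_pos by (simp add: mult_le_0_iff)
qed

lemma mat_inv_Achi:
  "mat_inv A_chi \<in> carrier_mat n n" "A_chi * mat_inv A_chi = 1\<^sub>m n" "mat_inv A_chi * A_chi = 1\<^sub>m n"
proof -
  have "v = 0\<^sub>m 1 n" if v: "v \<in> carrier_mat 1 n" and 0: "v * A_chi = 0\<^sub>m 1 n" for v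
  proof (rule Achi_definite[OF v])
    have "v\<^sup>T \<in> carrier_mat n 1" using v by (simp del: One_nat_def)
    then show "frob A_chi v v = 0" unfolding frob_def 0 by (simp add: mat_trace_def)
  qed
  note * = mat_inv_if_left_kernel_trivial[OF Achi_carrier this]
  show "mat_inv A_chi \<in> carrier_mat n n" "A_chi * mat_inv A_chi = 1\<^sub>m n" "mat_inv A_chi * A_chi = 1\<^sub>m n"
    by (rule *; assumption)+
qed

text \<open>
  \<open>P_E^chi\<close> is the orthogonal projection onto the span of the row basis in the weight \<open>A_chi\<close>;
  the Gram matrix \<open>E\<^sup>T A_chi E\<close> is invertible since its kernel would give a row of vanishing
  \<open>A_chi\<close> norm.
\<close>

lemma chi_projection:
  assumes E: "E \<in> carrier_mat n q" and EE: "E\<^sup>T * A\<^sub>1 * E = 1\<^sub>m q" and e: "e \<in> carrier_mat 1 n"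
  shows "\<exists>z \<in> carrier_mat 1 q. e * A_chi * proj_E_chi A_chi E = z * E\<^sup>T \<and>
           frob A_chi e (z * E\<^sup>T) = frob A_chi (z * E\<^sup>T) (z * E\<^sup>T)"
proof -
  define N where "N = E\<^sup>T * A_chi * E"
  define x where "x = e * A_chi * E"
  define z where "z = x * mat_inv N"
  have ET: "E\<^sup>T \<in> carrier_mat q n" using E by simp
  have ETA: "E\<^sup>T * A_chi \<in> carrier_mat q n" "E\<^sup>T * A\<^sub>1 \<in> carrier_mat q n"
    using ET A1_carrier Achi_carrier by (blast intro: mat_carrier_intros)+
  have N: "N \<in> carrier_mat q q" unfolding N_def using ETA E by (blast intro: mat_carrier_intros)
  have eA: "e * A_chi \<in> carrier_mat 1 n" using e Achi_carrier by (blast intro: mat_carrier_intros)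
  have x: "x \<in> carrier_mat 1 q" unfolding x_def using eA E by (blast intro: mat_carrier_intros)
  have vN: "v * E\<^sup>T * A_chi * E = v * N" if v: "v \<in> carrier_mat 1 q" for v
    unfolding N_def by (simp only: assoc_mult_mat[OF v ET Achi_carrier] assoc_mult_mat[OF v ETA(1) E])
  have ker: "v = 0\<^sub>m 1 q" if v: "v \<in> carrier_mat 1 q" and 0: "v * N = 0\<^sub>m 1 q" for v
  proof -
    have vE: "v * E\<^sup>T \<in> carrier_mat 1 n" using v ET by (blast intro: mat_carrier_intros)
    have "v\<^sup>T \<in> carrier_mat q 1" using v by (simp del: One_nat_def)
    then have "frob A_chi (v * E\<^sup>T) (v * E\<^sup>T) = 0"
      unfolding frob_mult_right[OF Achi_carrier vE v E] vN[OF v] 0 by (simp add: mat_trace_def)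
    then have "v * E\<^sup>T = 0\<^sub>m 1 n" by (rule Achi_definite[OF vE])
    moreover have "v * E\<^sup>T * A\<^sub>1 * E = v * (E\<^sup>T * A\<^sub>1 * E)"
      by (simp only: assoc_mult_mat[OF v ET A1_carrier] assoc_mult_mat[OF v ETA(2) E])
    ultimately show ?thesis
      using v E by (simp add: EE left_mult_zero_mat[OF A1_carrier] left_mult_zero_mat[OF E] del: One_nat_def)
  qed
  note inv = mat_inv_if_left_kernel_trivial[OF N ker]
  have z: "z \<in> carrier_mat 1 q" unfolding z_def using x inv(1) by (blast intro: mat_carrier_intros)
  have zE: "z * E\<^sup>T \<in> carrier_mat 1 n" using z ET by (blast intro: mat_carrier_intros)
  have Ei: "E * mat_inv N \<in> carrier_mat n q" using E inv(1) by (blast intro: mat_carrier_intros)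
  have "e * A_chi * proj_E_chi A_chi E = z * E\<^sup>T"
    unfolding proj_E_chi_def N_def[symmetric] z_def x_def
    by (simp only: assoc_mult_mat[OF eA Ei ET, symmetric] assoc_mult_mat[OF eA E inv(1), symmetric])
  moreover have "z * N = x * (mat_inv N * N)"
    unfolding z_def by (rule assoc_mult_mat[OF x inv(1) N])
  then have "z * N = x" by (simp only: inv(3) right_mult_one_mat[OF x])
  then have "frob A_chi e (z * E\<^sup>T) = frob A_chi (z * E\<^sup>T) (z * E\<^sup>T)"
    unfolding frob_mult_right[OF Achi_carrier e z E] frob_mult_right[OF Achi_carrier zE z E] vN[OF z]
    by (simp add: x_def)
  ultimately show ?thesis using z by blast
qed

lemma mat_inv_Achi_symmetric: "(mat_inv A_chi)\<^sup>T = mat_inv A_chi"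
proof -
  define B where "B = mat_inv A_chi"
  note B = mat_inv_Achi[folded B_def]
  have BT: "B\<^sup>T \<in> carrier_mat n n" using B(1) by simp
  have "B\<^sup>T * A_chi = (A_chi * B)\<^sup>T"
    using transpose_mult[OF Achi_carrier B(1)] by (simp add: Achi_sym)
  then have "B\<^sup>T * A_chi = 1\<^sub>m n" by (simp add: B(2))
  moreover have "B\<^sup>T * A_chi * B = B\<^sup>T * (A_chi * B)" by (rule assoc_mult_mat[OF BT Achi_carrier B(1)])
  ultimately have "B\<^sup>T = B"
    by (simp only: B(2) right_mult_one_mat[OF BT] left_mult_one_mat[OF B(1)])
  then show ?thesis by (simp add: B_def)
qed

lemma normalised_equilibrium_factors:
  assumes L0: "L\<^sub>0 \<in> carrier_mat m 1" and L\<eta>: "L\<eta> \<in> carrier_mat n 1"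
  defines "l \<equiv> euclid_norm L\<^sub>0" and "N \<equiv> nrm (L\<eta>\<^sup>T * mat_inv A_chi)"
  defines "Ueq \<equiv> (1 / l) \<cdot>\<^sub>m L\<^sub>0" and "Eeq \<equiv> (1 / N) \<cdot>\<^sub>m (mat_inv A_chi * L\<eta>)"
  assumes nz: "l \<noteq> 0" "N \<noteq> 0"
  shows "Ueq \<in> carrier_mat m 1" "Eeq\<^sup>T \<in> carrier_mat 1 n"
    and "dot Ueq Ueq = 1" and "frob A\<^sub>1 (Eeq\<^sup>T) (Eeq\<^sup>T) = 1" and "0 < l * N"
    and "(l * N) \<cdot>\<^sub>m (Ueq * Eeq\<^sup>T) = L\<^sub>0 * L\<eta>\<^sup>T * mat_inv A_chi"
proof -
  define B where "B = mat_inv A_chi"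
  have B: "B \<in> carrier_mat n n" using mat_inv_Achi(1) by (simp add: B_def)
  have LT: "L\<eta>\<^sup>T \<in> carrier_mat 1 n" using L\<eta> by (simp del: One_nat_def)
  have LB: "L\<eta>\<^sup>T * B \<in> carrier_mat 1 n" using LT B by (blast intro: mat_carrier_intros)
  have BL: "B * L\<eta> \<in> carrier_mat n 1" using L\<eta> B by (blast intro: mat_carrier_intros)
  have ET: "Eeq\<^sup>T = (1 / N) \<cdot>\<^sub>m (L\<eta>\<^sup>T * B)"
  proof -
    have "Eeq\<^sup>T = (1 / N) \<cdot>\<^sub>m (B * L\<eta>)\<^sup>T"
      unfolding Eeq_def B_def[symmetric] by (intro eq_matI) auto
    also have "(B * L\<eta>)\<^sup>T = L\<eta>\<^sup>T * B"
      using transpose_mult[OF B L\<eta>] mat_inv_Achi_symmetric by (simp add: B_def)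
    finally show ?thesis .
  qed
  show U: "Ueq \<in> carrier_mat m 1" unfolding Ueq_def using L0 by (blast intro: mat_carrier_intros)
  show E: "Eeq\<^sup>T \<in> carrier_mat 1 n" unfolding ET using LB by (blast intro: mat_carrier_intros)
  have "dot Ueq Ueq = (1 / l) * (1 / l) * dot L\<^sub>0 L\<^sub>0"
    unfolding dot_eq_sum[OF U U] dot_eq_sum[OF L0 L0] sum_distrib_left
    using L0 by (intro sum.cong refl) (simp add: Ueq_def)
  also have "dot L\<^sub>0 L\<^sub>0 = l * l" using euclid_norm_sq[OF L0] by (simp add: l_def power2_eq_square)
  finally show "dot Ueq Ueq = 1" using nz by simp
  have "frob A\<^sub>1 (Eeq\<^sup>T) (Eeq\<^sup>T) = (1 / N) * ((1 / N) * frob A\<^sub>1 (L\<eta>\<^sup>T * B) (L\<eta>\<^sup>T * B))"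
    unfolding ET frob_smult_left[OF A1_carrier LB smult_carrier_mat[OF LB]]
      frob_smult_right[OF A1_carrier A1_sym LB LB] ..
  also have "frob A\<^sub>1 (L\<eta>\<^sup>T * B) (L\<eta>\<^sup>T * B) = N * N"
    using nrm_sq[OF LB] by (simp add: N_def B_def power2_eq_square)
  finally show "frob A\<^sub>1 (Eeq\<^sup>T) (Eeq\<^sup>T) = 1" using nz by simp
  have "0 \<le> N" unfolding N_def B_def[symmetric] by (rule nrm_nonneg[OF LB])
  then show "0 < l * N" using nz euclid_norm_nonneg[of L\<^sub>0] by (simp add: l_def less_le)
  have "Ueq * Eeq\<^sup>T = (1 / l) \<cdot>\<^sub>m ((1 / N) \<cdot>\<^sub>m (L\<^sub>0 * (L\<eta>\<^sup>T * B)))"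
    unfolding Ueq_def ET mult_smult_assoc_mat[OF L0 smult_carrier_mat[OF LB]] mult_smult_distrib[OF L0 LB] ..
  then have "(l * N) \<cdot>\<^sub>m (Ueq * Eeq\<^sup>T) = L\<^sub>0 * (L\<eta>\<^sup>T * B)"
    using nz by (intro eq_matI) auto
  also have "\<dots> = L\<^sub>0 * L\<eta>\<^sup>T * B" by (rule assoc_mult_mat[OF L0 LT B, symmetric])
  finally show "(l * N) \<cdot>\<^sub>m (Ueq * Eeq\<^sup>T) = L\<^sub>0 * L\<eta>\<^sup>T * mat_inv A_chi" by (simp add: B_def)
qed

text \<open>
  Testing with all coefficient matrices identifies \<open>F A_chi\<close> with the source \<open>L\<^sub>0 L\<eta>\<^sup>T\<close>.
\<close>

lemma equilibrium_coefficients: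
  assumes F: "F \<in> carrier_mat m n" and L0: "L\<^sub>0 \<in> carrier_mat m 1" and L\<eta>: "L\<eta> \<in> carrier_mat n 1"
    and eq: "\<And>W. W \<in> carrier_mat m n \<Longrightarrow> frob A_chi F W = mat_trace (L\<^sub>0 * L\<eta>\<^sup>T * W\<^sup>T)"
  shows "F = L\<^sub>0 * L\<eta>\<^sup>T * mat_inv A_chi"
proof -
  have LT: "L\<eta>\<^sup>T \<in> carrier_mat 1 n" using L\<eta> by (simp del: One_nat_def)
  have "F * A_chi = L\<^sub>0 * L\<eta>\<^sup>T"
    by (rule mat_eq_if_traces_eq[OF mult_carrier_mat[OF F Achi_carrier] mult_carrier_mat[OF L0 LT]])
      (rule eq[unfolded frob_def])
  then have "L\<^sub>0 * L\<eta>\<^sup>T * mat_inv A_chi = F * (A_chi * mat_inv A_chi)"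
    using assoc_mult_mat[OF F Achi_carrier mat_inv_Achi(1)] by simp
  then show ?thesis by (simp only: mat_inv_Achi(2) right_mult_one_mat[OF F])
qed

end

section \<open>The scheme in coefficient form\<close>

lemma le_if_square_le_mult:
  fixes x y :: real
  assumes "x\<^sup>2 \<le> x * y" "0 \<le> y"
  shows "x \<le> y"
proof (rule ccontr)
  assume "\<not> x \<le> y"
  then have "0 < x \<and> y < x" using assms(2) by auto
  then show False using assms(1) by (simp add: power2_eq_square)
qed

lemma mat_smult_regroup:
  fixes X Y Z :: "real mat"
  assumes "X \<in> carrier_mat p q" "Y \<in> carrier_mat p q" "Z \<in> carrier_mat p q"
  shows "k \<cdot>\<^sub>m (X + (Y + Z)) = k \<cdot>\<^sub>m Y + (k \<cdot>\<^sub>m X + k \<cdot>\<^sub>m Z)"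
  using assms by (intro eq_matI) (auto simp: algebra_simps)

lemma mat_diff_add_eq:
  fixes X Y Z :: "real mat"
  assumes "X \<in> carrier_mat p q" "Y \<in> carrier_mat p q" "Z \<in> carrier_mat p q"
  shows "X - (Y + Z) = X - Y + (- 1) \<cdot>\<^sub>m Z"
  using assms by (intro eq_matI) (auto simp: algebra_simps)

text \<open>
  Normalising the two factors of the rank one equilibrium separates the error caused by the
  column basis from the one caused by the row basis.
\<close>

locale rank_one_equilibrium = mass_matrices +
  fixes m r :: nat and Ueq e :: "real mat" and s dt :: real
  assumes Ueq [simp]: "Ueq \<in> carrier_mat m 1" and e [simp]: "e \<in> carrier_mat 1 n"
    and Ueq_unit: "dot Ueq Ueq = 1" and e_unit: "frob A\<^sub>1 e e = 1"
    and s_pos: "0 < s" and dt_pos: "0 < dt"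
begin

lemma s_nonneg: "0 \<le> s" using s_pos by simp

definition Feq :: "real mat" where "Feq = s \<cdot>\<^sub>m (Ueq * e)"

lemma Feq_carrier [simp]: "Feq \<in> carrier_mat m n"
  unfolding Feq_def using Ueq e by (blast intro: mat_carrier_intros)

lemma chi_min_le_max: "chi_min \<le> chi_max"
  using chi_min_le_chi_max_if_nonzero[OF e] e_unit by simp

text \<open>
  One backward Euler step in coefficient form. The source term has been replaced by the
  equilibrium, whose residual vanishes.
\<close>

definition galerkin :: "real mat set \<Rightarrow> real mat \<Rightarrow> real mat \<Rightarrow> bool" where
  "galerkin V F G \<longleftrightarrow> G \<in> V \<and>
     (\<forall>W\<in>V. frob A\<^sub>1 (G - F) W = dt * (frob A_chi Feq W - frob A_chi G W))"

definition V_K :: "real mat \<Rightarrow> real mat set" where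
  "V_K E = {K * E\<^sup>T | K. K \<in> carrier_mat m r}"

definition V_L :: "real mat \<Rightarrow> real mat set" where
  "V_L U = {U * L\<^sup>T | L. L \<in> carrier_mat n r}"

definition V_S :: "real mat \<Rightarrow> real mat \<Rightarrow> real mat set" where
  "V_S U E = {U * S * E\<^sup>T | S. S \<in> carrier_mat r r}"

text \<open>
  Since \<open>P\<^sub>U\<close> is an orthogonal projection, Pythagoras relates the overlap of \<open>Ueq\<close> with the basis
  to its defect, so that an upper bound for the defect is a lower bound for the overlap.
\<close>

lemma col_split:
  assumes U: "U \<in> carrier_mat m r" and UU: "U\<^sup>T * U = 1\<^sub>m r"
  defines "a \<equiv> proj_U U * Ueq"
  shows "a \<in> carrier_mat m 1" and "a = U * (U\<^sup>T * Ueq)"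
    and "U\<^sup>T * (Ueq - a) = 0\<^sub>m r 1"
    and "dot Ueq (Ueq - a) = dot (Ueq - a) (Ueq - a)"
    and "(euclid_norm a)\<^sup>2 + (euclid_norm (Ueq - a))\<^sup>2 = 1"
proof -
  define y where "y = U\<^sup>T * Ueq"
  have UT: "U\<^sup>T \<in> carrier_mat r m" using U by simp
  have y: "y \<in> carrier_mat r 1" unfolding y_def using UT Ueq by (blast intro: mat_carrier_intros)
  show a_eq: "a = U * (U\<^sup>T * Ueq)"
    unfolding a_def proj_U_def by (rule assoc_mult_mat[OF U UT Ueq])
  show a: "a \<in> carrier_mat m 1" unfolding a_eq using U UT Ueq by (blast intro: mat_carrier_intros)
  define c where "c = Ueq - a"
  have c: "c \<in> carrier_mat m 1" unfolding c_def using Ueq a by (blast intro: mat_carrier_intros)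
  have "U\<^sup>T * a = (U\<^sup>T * U) * y" unfolding a_eq y_def[symmetric] by (rule assoc_mult_mat[OF UT U y, symmetric])
  then have "U\<^sup>T * a = y" using y by (simp add: UU)
  then show orth: "U\<^sup>T * (Ueq - a) = 0\<^sub>m r 1"
    using mult_minus_distrib_mat[OF UT Ueq a] y y_def by simp
  have "a\<^sup>T * c = y\<^sup>T * (U\<^sup>T * c)"
    unfolding a_eq y_def[symmetric] transpose_mult[OF U y]
    by (rule assoc_mult_mat[OF _ UT c, of _ 1]) (use y in \<open>simp del: One_nat_def\<close>)
  then have ac: "dot a c = 0"
    using orth y unfolding dot_def c_def by simp
  have split: "dot Ueq w = dot a w + dot c w" if w: "w \<in> carrier_mat m 1" for w
    unfolding dot_eq_sum[OF Ueq w] dot_eq_sum[OF a w] dot_eq_sum[OF c w] sum.distrib[symmetric]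
    by (rule sum.cong) (use a Ueq in \<open>auto simp: c_def algebra_simps\<close>)
  show "dot Ueq (Ueq - a) = dot (Ueq - a) (Ueq - a)"
    using split[OF c] ac by (simp add: c_def)
  have "dot w v = dot v w" if "w \<in> carrier_mat m 1" "v \<in> carrier_mat m 1" for v w
    using that by (simp add: dot_eq_sum mult.commute)
  then have "dot Ueq Ueq = dot a a + dot c c"
    using split[OF Ueq] split[OF a] split[OF c] ac a c Ueq by simp
  then show "(euclid_norm a)\<^sup>2 + (euclid_norm (Ueq - a))\<^sup>2 = 1"
    using Ueq_unit euclid_norm_sq[OF a] euclid_norm_sq[OF c] by (simp add: c_def)
qed

text \<open>
  The counterpart of the preceding lemma for the rows, where orthogonality refers to \<open>A\<^sub>1\<close>.
\<close>

lemma row_split: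
  assumes E: "E \<in> carrier_mat n r" and EE: "E\<^sup>T * A\<^sub>1 * E = 1\<^sub>m r"
  defines "b \<equiv> e * A\<^sub>1 * proj_E E"
  shows "b \<in> carrier_mat 1 n" and "b = (e * A\<^sub>1 * E) * E\<^sup>T"
    and "(e - b) * A\<^sub>1 * E = 0\<^sub>m 1 r"
    and "frob A\<^sub>1 e (e - b) = frob A\<^sub>1 (e - b) (e - b)"
    and "(nrm b)\<^sup>2 + (nrm (e - b))\<^sup>2 = 1"
proof -
  define z where "z = e * A\<^sub>1 * E"
  have ET: "E\<^sup>T \<in> carrier_mat r n" using E by simp
  have eA: "e * A\<^sub>1 \<in> carrier_mat 1 n" using e A1_carrier by (blast intro: mat_carrier_intros)
  have z: "z \<in> carrier_mat 1 r" unfolding z_def using eA E by (blast intro: mat_carrier_intros)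
  have zET: "z * E\<^sup>T \<in> carrier_mat 1 n" using z ET by (blast intro: mat_carrier_intros)
  show b_eq: "b = (e * A\<^sub>1 * E) * E\<^sup>T"
    unfolding b_def proj_E_def by (rule assoc_mult_mat[OF eA E ET, symmetric])
  then have bz: "b = z * E\<^sup>T" by (simp add: z_def)
  show b: "b \<in> carrier_mat 1 n" unfolding bz by (rule zET)
  define c where "c = e - b"
  have c: "c \<in> carrier_mat 1 n" unfolding c_def using e b by (blast intro: mat_carrier_intros)
  have ETA: "E\<^sup>T * A\<^sub>1 \<in> carrier_mat r n" using ET A1_carrier by (blast intro: mat_carrier_intros)
  have bA: "b * A\<^sub>1 \<in> carrier_mat 1 n" using b A1_carrier by (blast intro: mat_carrier_intros)
  have "b * A\<^sub>1 * E = z * (E\<^sup>T * A\<^sub>1 * E)"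
    unfolding bz by (simp only: assoc_mult_mat[OF z ET A1_carrier] assoc_mult_mat[OF z ETA E])
  then have "b * A\<^sub>1 * E = z" using z by (simp add: EE)
  then show orth: "(e - b) * A\<^sub>1 * E = 0\<^sub>m 1 r"
    unfolding minus_mult_distrib_mat[OF e b A1_carrier] minus_mult_distrib_mat[OF eA bA E]
    using z by (simp add: z_def del: One_nat_def)
  have "frob A\<^sub>1 c b = 0"
    unfolding bz frob_mult_right[OF A1_carrier c z E] using orth z by (simp add: c_def mat_trace_def)
  then have cb: "frob A\<^sub>1 c b = 0" "frob A\<^sub>1 b c = 0"
    using frob_commute[OF A1_carrier c b A1_sym] by auto
  have e_eq: "e = b + c" unfolding c_def using e b by (intro eq_matI) auto
  show "frob A\<^sub>1 e (e - b) = frob A\<^sub>1 (e - b) (e - b)"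
    using frob_add_left[OF A1_carrier b c c] cb(2) by (simp add: e_eq[symmetric] flip: c_def)
  have "frob A\<^sub>1 (b + c) (b + c) = frob A\<^sub>1 b b + frob A\<^sub>1 c c"
    using frob_add_left[OF A1_carrier b c] frob_add_right[OF A1_carrier A1_sym _ b c] b c cb
    by (metis add.left_neutral add.right_neutral add_carrier_mat)
  then show "(nrm b)\<^sup>2 + (nrm (e - b))\<^sup>2 = 1"
    using nrm_sq[OF b] nrm_sq[OF c] e_unit by (simp add: e_eq[symmetric] flip: c_def)
qed

text \<open>
  Tested with the error itself, the left hand side is a squared norm and the right hand side is
  minus a squared norm.
\<close>

lemma galerkin_exact:
  assumes "galerkin V Feq G" "G - Feq \<in> V" "G \<in> carrier_mat m n"
  shows "G = Feq"
proof -
  define d where "d = G - Feq"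
  have d: "d \<in> carrier_mat m n" unfolding d_def using assms(3) Feq_carrier by (blast intro: mat_carrier_intros)
  have "frob A\<^sub>1 d d = dt * (frob A_chi Feq d - frob A_chi G d)"
    using assms(1,2) unfolding galerkin_def d_def by blast
  also have "\<dots> = - (dt * frob A_chi d d)"
    using frob_diff_left[OF Achi_carrier assms(3) Feq_carrier d, folded d_def]
    by (simp add: right_diff_distrib)
  finally have "frob A\<^sub>1 d d = 0"
    using frob_A1_nonneg[OF d] frob_Achi_nonneg[OF d] dt_pos
    by (metis add.inverse_inverse less_eq_real_def mult_nonneg_nonneg neg_le_0_iff_le order_antisym_conv)
  then have "nrm (G - Feq) = 0" by (simp add: mat_norm_eq_frob d_def)
  then show ?thesis by (rule eq_if_nrm_diff_eq_0[OF assms(3) Feq_carrier])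
qed

text \<open>
  Tested with the increment itself, the step is dissipative: its increment is at most as large as
  the error in the \<open>A_chi\<close> norm. Passing to the \<open>A\<^sub>1\<close> norm costs the square root of the
  ratio of the opacity bounds.
\<close>

lemma K_increment_le:
  assumes E: "E \<in> carrier_mat n r" and H: "H \<in> carrier_mat m r" and K: "K \<in> carrier_mat m r"
    and F: "F = H * E\<^sup>T"
    and gal: "galerkin (V_K E) F (K * E\<^sup>T)"
  shows "nrm (K * E\<^sup>T - F) \<le> sqrt (chi_max / chi_min) * nrm (F - Feq)"
proof -
  define FK where "FK = K * E\<^sup>T"
  define d where "d = FK - F"
  have ET: "E\<^sup>T \<in> carrier_mat r n" using E by simp
  have FK: "FK \<in> carrier_mat m n" unfolding FK_def using K ET by (blast intro: mat_carrier_intros)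
  have Fc: "F \<in> carrier_mat m n" unfolding F using H ET by (blast intro: mat_carrier_intros)
  have d: "d \<in> carrier_mat m n" unfolding d_def using FK Fc by (blast intro: mat_carrier_intros)
  have D: "F - Feq \<in> carrier_mat m n" using Fc Feq_carrier by (blast intro: mat_carrier_intros)
  have "d = (K - H) * E\<^sup>T"
    unfolding d_def FK_def F by (rule minus_mult_distrib_mat[OF K H ET, symmetric])
  then have "d \<in> V_K E" unfolding V_K_def using K H by (blast intro: mat_carrier_intros)
  then have "frob A\<^sub>1 d d = dt * (frob A_chi Feq d - frob A_chi FK d)"
    using gal unfolding galerkin_def FK_def d_def by blast
  also have "frob A_chi Feq d - frob A_chi FK d = - frob A_chi (F - Feq) d - frob A_chi d d"
  proof -
    have "frob A_chi d d = frob A_chi FK d - frob A_chi F d"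
      using frob_diff_left[OF Achi_carrier FK Fc d] by (simp add: d_def)
    then show ?thesis using frob_diff_left[OF Achi_carrier Fc Feq_carrier d] by simp
  qed
  finally have eq: "dt * (- frob A_chi (F - Feq) d - frob A_chi d d) = frob A\<^sub>1 d d" ..
  then have "0 \<le> dt * (- frob A_chi (F - Feq) d - frob A_chi d d)" using frob_A1_nonneg[OF d] by simp
  \<comment> \<open>the positive term \<open>frob A\<^sub>1 d d\<close> is dropped\<close>
  then have "frob A_chi d d \<le> - frob A_chi (F - Feq) d"
    using dt_pos by (simp add: zero_le_mult_iff)
  also have "\<dots> \<le> sqrt (frob A_chi d d) * sqrt (frob A_chi (F - Feq) (F - Feq))"
    using Cauchy_Schwarz_Achi[OF D d] by (simp add: mult.commute)
  finally have "(sqrt (frob A_chi d d))\<^sup>2 \<le> sqrt (frob A_chi d d) * sqrt (frob A_chi (F - Feq) (F - Feq))"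
    by (simp add: frob_Achi_nonneg[OF d])
  then have "sqrt (frob A_chi d d) \<le> sqrt (frob A_chi (F - Feq) (F - Feq))"
    by (rule le_if_square_le_mult) (simp add: frob_Achi_nonneg[OF D])
  then have "chi_min * frob A\<^sub>1 d d \<le> chi_max * frob A\<^sub>1 (F - Feq) (F - Feq)"
    using frob_lower[OF d] frob_upper[OF D] by simp
  then have "frob A\<^sub>1 d d \<le> chi_max / chi_min * frob A\<^sub>1 (F - Feq) (F - Feq)"
    using chi_min_pos by (simp add: field_simps)
  then show ?thesis
    unfolding mat_norm_eq_frob real_sqrt_mult[symmetric] by (simp add: d_def FK_def)
qed

text \<open>
  The test matrix \<open>a b\<close> is admissible since \<open>b\<close> lies in the span of the old row basis. The
  computed solution has its columns in the range of \<open>U'\<close>, hence is orthogonal to \<open>a b\<close>, so that only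
  the equilibrium remains on the right hand side, and the increment on the left hand side is
  controlled by the preceding lemma. The factor \<open>dt\<close> in front of the defect is what makes it small.
\<close>

lemma K_step_column_defect:
  assumes U': "U' \<in> carrier_mat m r" and E: "E \<in> carrier_mat n r"
    and H: "H \<in> carrier_mat m r" and R: "R \<in> carrier_mat r r"
    and F: "F = H * E\<^sup>T"
    and gal: "galerkin (V_K E) F (U' * R * E\<^sup>T)"
    and a: "a \<in> carrier_mat m 1" and a_orth: "U'\<^sup>T * a = 0\<^sub>m r 1" and Ueq_a: "dot Ueq a = dot a a"
    and z: "z \<in> carrier_mat 1 r" and b: "b = z * E\<^sup>T" and e_b: "frob A_chi e b = frob A_chi b b"
  shows "dt * chi_min * nrm b * (s * euclid_norm a) \<le> sqrt (chi_max / chi_min) * nrm (F - Feq)"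
proof -
  define K where "K = U' * R"
  define FK where "FK = K * E\<^sup>T"
  have ET: "E\<^sup>T \<in> carrier_mat r n" using E by simp
  have K: "K \<in> carrier_mat m r" unfolding K_def using U' R by (blast intro: mat_carrier_intros)
  have FK: "FK \<in> carrier_mat m n" unfolding FK_def using K ET by (blast intro: mat_carrier_intros)
  have Fc: "F \<in> carrier_mat m n" unfolding F using H ET by (blast intro: mat_carrier_intros)
  have d: "FK - F \<in> carrier_mat m n" using FK Fc by (blast intro: mat_carrier_intros)
  have D: "F - Feq \<in> carrier_mat m n" using Fc Feq_carrier by (blast intro: mat_carrier_intros)
  have bc: "b \<in> carrier_mat 1 n" unfolding b using z ET by (blast intro: mat_carrier_intros)
  have ab: "a * b \<in> carrier_mat m n" using a bc by (blast intro: mat_carrier_intros)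
  have inc: "nrm (FK - F) \<le> sqrt (chi_max / chi_min) * nrm (F - Feq)"
    unfolding FK_def by (rule K_increment_le[OF E H K F]) (use gal in \<open>simp add: K_def\<close>)
  have FK': "FK = U' * (R * E\<^sup>T)"
    unfolding FK_def K_def by (rule assoc_mult_mat[OF U' R ET])
  have "a * b = (a * z) * E\<^sup>T" unfolding b by (rule assoc_mult_mat[OF a z ET, symmetric])
  then have "a * b \<in> V_K E" unfolding V_K_def using a z by (blast intro: mat_carrier_intros)
  then have "frob A\<^sub>1 (FK - F) (a * b) = dt * (frob A_chi Feq (a * b) - frob A_chi FK (a * b))"
    using gal unfolding galerkin_def FK_def K_def by blast
  also have "frob A_chi FK (a * b) = 0"
    unfolding FK' by (rule frob_orthogonal_col[OF Achi_carrier U' _ a bc a_orth])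
      (use R ET in \<open>blast intro: mat_carrier_intros\<close>)
  also have "frob A_chi Feq (a * b) = s * (euclid_norm a)\<^sup>2 * frob A_chi b b"
    unfolding Feq_def
    using frob_smult_left[OF Achi_carrier mult_carrier_mat[OF Ueq e] ab, of s]
      frob_outer[OF Achi_carrier Ueq a e bc] Ueq_a e_b euclid_norm_sq[OF a] by simp
  finally have eq: "frob A\<^sub>1 (FK - F) (a * b) = dt * (s * (euclid_norm a)\<^sup>2 * frob A_chi b b)" by simp
  have "dt * (s * (euclid_norm a)\<^sup>2 * (chi_min * (nrm b)\<^sup>2)) \<le> frob A\<^sub>1 (FK - F) (a * b)"
    unfolding eq nrm_sq[OF bc]
    using dt_pos s_nonneg frob_lower[OF bc] by (intro mult_left_mono) auto
  also have "\<dots> \<le> nrm (FK - F) * (euclid_norm a * nrm b)"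
    using Cauchy_Schwarz_A1[OF d ab] nrm_outer[OF a bc] by simp
  also have "\<dots> \<le> sqrt (chi_max / chi_min) * nrm (F - Feq) * (euclid_norm a * nrm b)"
    using inc by (intro mult_right_mono) (auto simp: euclid_norm_nonneg nrm_nonneg[OF bc])
  finally have *: "(dt * chi_min * nrm b * (s * euclid_norm a)) * (euclid_norm a * nrm b)
      \<le> sqrt (chi_max / chi_min) * nrm (F - Feq) * (euclid_norm a * nrm b)"
    by (simp add: power2_eq_square mult_ac)
  show ?thesis
  proof (cases "euclid_norm a * nrm b = 0")
    case True
    have "0 \<le> sqrt (chi_max / chi_min) * nrm (F - Feq)"
      using chi_min_pos chi_min_le_max nrm_nonneg[OF D] by simp
    then show ?thesis using True by auto
  next
    case False
    then have "0 < euclid_norm a * nrm b"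
      using euclid_norm_nonneg[of a] nrm_nonneg[OF bc] by (simp add: less_le)
    then show ?thesis by (rule mult_right_le_imp_le[OF *])
  qed
qed

text \<open>
  The difference \<open>G\<close> of the solution and the projection of the equilibrium onto \<open>V_L\<close> lies in
  \<open>V_L\<close>; tested with itself it is seen to be damped by \<open>1 / (1 + dt * chi_min)\<close>. A second test with
  \<open>a b\<close>, where \<open>b\<close> is orthogonal to the new row basis and hence to the solution, extracts the defect
  from \<open>G\<close>.
\<close>

lemma L_step_row_defect:
  assumes U: "U \<in> carrier_mat m r" and UU: "U\<^sup>T * U = 1\<^sub>m r"
    and E': "E' \<in> carrier_mat n r" and R: "R \<in> carrier_mat r r"
    and F: "F \<in> carrier_mat m n"
    and gal: "galerkin (V_L U) F (U * (E' * R)\<^sup>T)"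
    and b: "b \<in> carrier_mat 1 n" and b_orth: "b * A\<^sub>1 * E' = 0\<^sub>m 1 r" and e_b: "frob A\<^sub>1 e b = frob A\<^sub>1 b b"
  shows "(1 + dt * chi_min) * euclid_norm (proj_U U * Ueq) * (s * nrm b) \<le> nrm (F - Feq)"
proof -
  define FL where "FL = U * (E' * R)\<^sup>T"
  define y where "y = U\<^sup>T * Ueq"
  define a where "a = U * y"
  define a' where "a' = Ueq - a"
  define Z where "Z = (E' * R)\<^sup>T - s \<cdot>\<^sub>m (y * e)"
  define G where "G = U * Z"
  have UT: "U\<^sup>T \<in> carrier_mat r m" using U by simp
  have ER: "E' * R \<in> carrier_mat n r" using E' R by (blast intro: mat_carrier_intros)
  have ERT: "(E' * R)\<^sup>T \<in> carrier_mat r n" using ER by simp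
  have y: "y \<in> carrier_mat r 1" unfolding y_def using UT Ueq by (blast intro: mat_carrier_intros)
  have a: "a \<in> carrier_mat m 1" unfolding a_def using U y by (blast intro: mat_carrier_intros)
  have a': "a' \<in> carrier_mat m 1" unfolding a'_def using Ueq a by (blast intro: mat_carrier_intros)
  have ye: "y * e \<in> carrier_mat r n" using y e by (blast intro: mat_carrier_intros)
  have Z: "Z \<in> carrier_mat r n" unfolding Z_def using ye ERT by (blast intro: mat_carrier_intros)
  have G: "G \<in> carrier_mat m n" unfolding G_def using Z U by (blast intro: mat_carrier_intros)
  have FL: "FL \<in> carrier_mat m n" unfolding FL_def using U ERT by (blast intro: mat_carrier_intros)
  have D: "F - Feq \<in> carrier_mat m n" using F Feq_carrier by (blast intro: mat_carrier_intros)
  have ab: "a * b \<in> carrier_mat m n" using a b by (blast intro: mat_carrier_intros)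
  have ae: "a * e \<in> carrier_mat m n" using a e by (blast intro: mat_carrier_intros)
  have a'e: "a' * e \<in> carrier_mat m n" using a' e by (blast intro: mat_carrier_intros)
  have a_proj: "a = proj_U U * Ueq"
    unfolding a_def y_def using col_split(2)[OF U UU] by simp
  have a'_orth: "U\<^sup>T * a' = 0\<^sub>m r 1"
    using col_split(3)[OF U UU] unfolding a'_def a_proj .
  have G_eq: "G = FL - s \<cdot>\<^sub>m (a * e)"
  proof -
    have "G = FL - U * (s \<cdot>\<^sub>m (y * e))"
      unfolding G_def Z_def FL_def
      by (rule mult_minus_distrib_mat[OF U ERT smult_carrier_mat[OF ye]])
    also have "U * (s \<cdot>\<^sub>m (y * e)) = s \<cdot>\<^sub>m (a * e)"
      unfolding a_def using mult_smult_distrib[OF U ye] assoc_mult_mat[OF U y e] by simp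
    finally show ?thesis .
  qed
  have Feq_eq: "Feq = s \<cdot>\<^sub>m (a * e) + s \<cdot>\<^sub>m (a' * e)"
  proof -
    have "Ueq = a + a'" unfolding a'_def using Ueq a by (intro eq_matI) auto
    then have "Ueq * e = a * e + a' * e" using add_mult_distrib_mat[OF a a' e] by simp
    then show ?thesis unfolding Feq_def using ae a'e by (simp add: add_smult_distrib_left_mat)
  qed
  have zero: "frob M (a' * e) G = 0" if M: "M \<in> carrier_mat n n" "M\<^sup>T = M" for M
    using frob_orthogonal_col[OF M(1) U Z a' e a'_orth] frob_commute[OF M(1) a'e G M(2)]
    by (simp add: G_def)
  \<comment> \<open>the part of the equilibrium outside the range of \<open>U\<close> is invisible to \<open>G\<close> in both weights\<close>
  have residual: "frob M FL G - frob M Feq G = frob M G G" if M: "M \<in> carrier_mat n n" "M\<^sup>T = M" for M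
  proof -
    have "frob M Feq G = frob M (s \<cdot>\<^sub>m (a * e)) G + s * frob M (a' * e) G"
      unfolding Feq_eq
      using frob_add_left[OF M(1) smult_carrier_mat[OF ae] smult_carrier_mat[OF a'e] G]
        frob_smult_left[OF M(1) a'e G] by simp
    moreover have "frob M G G = frob M FL G - frob M (s \<cdot>\<^sub>m (a * e)) G"
      using frob_diff_left[OF M(1) FL smult_carrier_mat[OF ae] G] G_eq by simp
    ultimately show ?thesis using zero[OF M] by simp
  qed
  have "G \<in> V_L U"
    unfolding V_L_def G_def using Z by (intro CollectI exI[of _ "Z\<^sup>T"]) auto
  then have "frob A\<^sub>1 (FL - F) G = dt * (frob A_chi Feq G - frob A_chi FL G)"
    using gal unfolding galerkin_def FL_def by blast
  moreover have "frob A\<^sub>1 (FL - F) G = frob A\<^sub>1 G G - frob A\<^sub>1 (F - Feq) G"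
    using frob_diff_left[OF A1_carrier FL F G] frob_diff_left[OF A1_carrier F Feq_carrier G]
      residual[OF A1_carrier A1_sym] by simp
  ultimately have "frob A\<^sub>1 G G + dt * frob A_chi G G = frob A\<^sub>1 (F - Feq) G"
    using residual[OF Achi_carrier Achi_sym] by (simp add: algebra_simps)
  moreover have "dt * (chi_min * frob A\<^sub>1 G G) \<le> dt * frob A_chi G G"
    using frob_lower[OF G] dt_pos by simp
  ultimately have "(1 + dt * chi_min) * (nrm G)\<^sup>2 \<le> nrm (F - Feq) * nrm G"
    using Cauchy_Schwarz_A1[OF D G] unfolding nrm_sq[OF G] by (simp add: algebra_simps)
  then have Gle: "(1 + dt * chi_min) * nrm G \<le> nrm (F - Feq)"
    using nrm_nonneg[OF G] nrm_nonneg[OF D]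
    by (cases "nrm G = 0") (auto simp: power2_eq_square mult.assoc[symmetric] order.order_iff_strict[of 0 "nrm G"])
  have "frob A\<^sub>1 FL (a * b) = 0"
  proof -
    have "FL = U * (R\<^sup>T * E'\<^sup>T)" unfolding FL_def using transpose_mult[OF E' R] by simp
    also have "\<dots> = U * R\<^sup>T * E'\<^sup>T"
      using U R E' by (intro assoc_mult_mat[symmetric, of _ m r _ r _ n]) auto
    finally have "FL = U * R\<^sup>T * E'\<^sup>T" .
    moreover have "U * R\<^sup>T \<in> carrier_mat m r" using U R by (blast intro: mat_carrier_intros)
    ultimately have "frob A\<^sub>1 (a * b) FL = 0"
      using frob_orthogonal_row[OF A1_carrier _ E' a b b_orth] by simp
    then show ?thesis using frob_commute[OF A1_carrier FL ab A1_sym] by simp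
  qed
  then have "frob A\<^sub>1 G (a * b) = - (s * (euclid_norm a)\<^sup>2 * (nrm b)\<^sup>2)"
    unfolding G_eq
    using frob_diff_left[OF A1_carrier FL smult_carrier_mat[OF ae] ab]
      frob_smult_left[OF A1_carrier ae ab] frob_outer[OF A1_carrier a a e b] e_b
      euclid_norm_sq[OF a] nrm_sq[OF b] by simp
  then have "s * (euclid_norm a)\<^sup>2 * (nrm b)\<^sup>2 \<le> nrm G * (euclid_norm a * nrm b)"
    using Cauchy_Schwarz_A1[OF G ab] nrm_outer[OF a b] by simp
  then have "(s * euclid_norm a * nrm b) * (euclid_norm a * nrm b) \<le> nrm G * (euclid_norm a * nrm b)"
    by (simp add: power2_eq_square mult_ac)
  then have "s * euclid_norm a * nrm b \<le> nrm G"
    using euclid_norm_nonneg[of a] nrm_nonneg[OF b] nrm_nonneg[OF G]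
    by (cases "euclid_norm a * nrm b = 0") (auto simp: less_le)
  then have "(1 + dt * chi_min) * (s * euclid_norm a * nrm b) \<le> (1 + dt * chi_min) * nrm G"
    using dt_pos chi_min_pos by (intro mult_left_mono) auto
  then show ?thesis using Gle unfolding a_proj by (simp add: mult_ac)
qed

text \<open>
  Let \<open>G\<close> be the difference of the solution and the \<open>A\<^sub>1\<close> best approximation of the equilibrium
  in \<open>V_S\<close>, and \<open>Q\<close> the approximation error. Then \<open>Q\<close> is orthogonal to \<open>V_S\<close> in the weight \<open>A\<^sub>1\<close>.
  In the weight \<open>A_chi\<close> only the part of \<open>Q\<close> caused by the column basis is; the other part
  contributes the term with \<open>dt * chi_max * q_E\<close>.
\<close>

lemma S_step_error:
  assumes U': "U' \<in> carrier_mat m r" and UU: "U'\<^sup>T * U' = 1\<^sub>m r"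
    and E': "E' \<in> carrier_mat n r" and EE: "E'\<^sup>T * A\<^sub>1 * E' = 1\<^sub>m r"
    and S': "S' \<in> carrier_mat r r"
    and F: "F \<in> carrier_mat m n"
    and gal: "galerkin (V_S U' E') F (U' * S' * E'\<^sup>T)"
  defines "q_U \<equiv> s * euclid_norm (Ueq - proj_U U' * Ueq)"
    and "q_E \<equiv> s * nrm (e - e * A\<^sub>1 * proj_E E')"
  shows "nrm (U' * S' * E'\<^sup>T - Feq) \<le>
      (nrm (F - Feq) + dt * chi_max * q_E) / (1 + dt * chi_min) + sqrt (q_U\<^sup>2 + q_E\<^sup>2)"
proof -
  define F' where "F' = U' * S' * E'\<^sup>T"
  define y where "y = U'\<^sup>T * Ueq"
  define a where "a = proj_U U' * Ueq"
  define a' where "a' = Ueq - a"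
  define z where "z = e * A\<^sub>1 * E'"
  define b where "b = e * A\<^sub>1 * proj_E E'"
  define b' where "b' = e - b"
  define Z where "Z = S' - s \<cdot>\<^sub>m (y * z)"
  define G where "G = U' * Z * E'\<^sup>T"
  define Q where "Q = s \<cdot>\<^sub>m (a' * e) + s \<cdot>\<^sub>m (a * b')"
  have UT: "U'\<^sup>T \<in> carrier_mat r m" using U' by simp
  have ET: "E'\<^sup>T \<in> carrier_mat r n" using E' by simp
  note cs = col_split[OF U' UU, folded a_def, folded a'_def y_def]
  note rs = row_split[OF E' EE, folded b_def, folded b'_def z_def]
  have y: "y \<in> carrier_mat r 1" unfolding y_def using UT Ueq by (blast intro: mat_carrier_intros)
  have a: "a \<in> carrier_mat m 1" by (rule cs(1))
  have b: "b \<in> carrier_mat 1 n" by (rule rs(1))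
  have a': "a' \<in> carrier_mat m 1" unfolding a'_def using Ueq a by (blast intro: mat_carrier_intros)
  have b': "b' \<in> carrier_mat 1 n" unfolding b'_def using e b by (blast intro: mat_carrier_intros)
  have z: "z \<in> carrier_mat 1 r" unfolding z_def using e A1_carrier E' by (blast intro: mat_carrier_intros)
  have yz: "y * z \<in> carrier_mat r r" using y z by (blast intro: mat_carrier_intros)
  have Z: "Z \<in> carrier_mat r r" unfolding Z_def using yz S' by (blast intro: mat_carrier_intros)
  have UZ: "U' * Z \<in> carrier_mat m r" using U' Z by (blast intro: mat_carrier_intros)
  have ZE: "Z * E'\<^sup>T \<in> carrier_mat r n" using Z ET by (blast intro: mat_carrier_intros)
  have G: "G \<in> carrier_mat m n" unfolding G_def using UZ ET by (blast intro: mat_carrier_intros)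
  have US: "U' * S' \<in> carrier_mat m r" using U' S' by (blast intro: mat_carrier_intros)
  have F': "F' \<in> carrier_mat m n" unfolding F'_def using US ET by (blast intro: mat_carrier_intros)
  have D: "F - Feq \<in> carrier_mat m n" using F Feq_carrier by (blast intro: mat_carrier_intros)
  have ab: "a * b \<in> carrier_mat m n" using a b by (blast intro: mat_carrier_intros)
  have ab': "a * b' \<in> carrier_mat m n" using a b' by (blast intro: mat_carrier_intros)
  have a'e: "a' * e \<in> carrier_mat m n" using a' e by (blast intro: mat_carrier_intros)
  have Q: "Q \<in> carrier_mat m n" unfolding Q_def using ab' a'e by (blast intro: mat_carrier_intros)
  have G_eq: "G = F' - s \<cdot>\<^sub>m (a * b)"
  proof -
    have "U' * (s \<cdot>\<^sub>m (y * z)) = s \<cdot>\<^sub>m (a * z)"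
      unfolding cs(2) using mult_smult_distrib[OF U' yz] assoc_mult_mat[OF U' y z] by simp
    then have "U' * Z = U' * S' - s \<cdot>\<^sub>m (a * z)"
      unfolding Z_def using mult_minus_distrib_mat[OF U' S' smult_carrier_mat[OF yz]] by simp
    moreover have az: "a * z \<in> carrier_mat m r" using a z by (blast intro: mat_carrier_intros)
    ultimately have "G = F' - (s \<cdot>\<^sub>m (a * z)) * E'\<^sup>T"
      unfolding G_def F'_def using minus_mult_distrib_mat[OF US smult_carrier_mat[OF az] ET] by simp
    also have "(s \<cdot>\<^sub>m (a * z)) * E'\<^sup>T = s \<cdot>\<^sub>m (a * b)"
      unfolding rs(2) using mult_smult_assoc_mat[OF az ET] assoc_mult_mat[OF a z ET] by simp
    finally show ?thesis .
  qed
  have Feq_eq: "Feq = s \<cdot>\<^sub>m (a * b) + Q"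
  proof -
    have "Ueq = a' + a" unfolding a'_def using Ueq a by (intro eq_matI) auto
    then have "Ueq * e = a' * e + a * e" using add_mult_distrib_mat[OF a' a e] by simp
    moreover have "e = b + b'" unfolding b'_def using e b by (intro eq_matI) auto
    then have "a * e = a * b + a * b'" using mult_add_distrib_mat[OF a b b'] by simp
    ultimately have "Feq = s \<cdot>\<^sub>m (a' * e + (a * b + a * b'))" by (simp add: Feq_def)
    then show ?thesis unfolding Q_def using mat_smult_regroup[OF a'e ab ab'] by simp
  qed
  have err: "F' - Feq = G + (- 1) \<cdot>\<^sub>m Q"
    unfolding Feq_eq G_eq by (rule mat_diff_add_eq[OF F' smult_carrier_mat[OF ab] Q])
  have G': "G = U' * (Z * E'\<^sup>T)" unfolding G_def by (rule assoc_mult_mat[OF U' Z ET])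
  have zero: "frob M (a' * e) G = 0" if M: "M \<in> carrier_mat n n" "M\<^sup>T = M" for M
    using frob_orthogonal_col[OF M(1) U' ZE a' e cs(3)] frob_commute[OF M(1) a'e G M(2)]
    by (simp add: G')
  have QG: "frob M Q G = s * frob M (a * b') G" if M: "M \<in> carrier_mat n n" "M\<^sup>T = M" for M
    unfolding Q_def
    using frob_add_left[OF M(1) smult_carrier_mat[OF a'e] smult_carrier_mat[OF ab'] G]
      frob_smult_left[OF M(1) a'e G] frob_smult_left[OF M(1) ab' G] zero[OF M] by simp
  have QG1: "frob A\<^sub>1 Q G = 0"
    using QG[OF A1_carrier A1_sym] frob_orthogonal_row[OF A1_carrier UZ E' a b' rs(3), folded G_def]
    by simp
  have a_le: "euclid_norm a \<le> 1"
  proof (rule power2_le_imp_le)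
    show "(euclid_norm a)\<^sup>2 \<le> 1\<^sup>2"
      unfolding power_one using cs(5) zero_le_power2[of "euclid_norm a'"] by linarith
  qed simp
  have chi_max: "0 \<le> chi_max" using chi_min_le_max chi_min_pos by simp
  have qE: "q_E = s * nrm b'" unfolding q_E_def b'_def b_def ..
  have qU: "q_U = s * euclid_norm a'" unfolding q_U_def a'_def a_def ..
  have q0: "0 \<le> q_E" unfolding qE using s_nonneg nrm_nonneg[OF b'] by simp
  have QGchi: "frob A_chi Q G \<le> chi_max * q_E * nrm G"
  proof -
    have "frob A_chi (a * b') G \<le> chi_max * (euclid_norm a * nrm b' * nrm G)"
      using Achi_bounded[OF ab' G] nrm_outer[OF a b'] by simp
    also have "\<dots> \<le> chi_max * (1 * nrm b' * nrm G)"
      using a_le chi_max nrm_nonneg[OF b'] nrm_nonneg[OF G] by (intro mult_left_mono mult_right_mono) auto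
    finally have "s * frob A_chi (a * b') G \<le> s * (chi_max * (1 * nrm b' * nrm G))"
      using s_nonneg by (rule mult_left_mono)
    then show ?thesis using QG[OF Achi_carrier Achi_sym] by (simp add: qE mult_ac)
  qed
  have GV: "G \<in> V_S U' E'" unfolding V_S_def G_def using Z by blast
  have residual: "frob M (F' - Feq) G = frob M G G - frob M Q G"
    if M: "M \<in> carrier_mat n n" "M\<^sup>T = M" for M
    unfolding err using frob_add_left[OF M(1) G smult_carrier_mat[OF Q] G] frob_smult_left[OF M(1) Q G]
    by simp
  have "frob A_chi Feq G - frob A_chi F' G = frob A_chi Q G - frob A_chi G G"
    using residual[OF Achi_carrier Achi_sym] frob_diff_left[OF Achi_carrier F' Feq_carrier G] by simp
  then have "frob A\<^sub>1 (F' - F) G = dt * (frob A_chi Q G - frob A_chi G G)"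
    using gal GV unfolding galerkin_def F'_def by metis
  moreover have "frob A\<^sub>1 (F' - F) G = frob A\<^sub>1 G G - frob A\<^sub>1 (F - Feq) G"
    using residual[OF A1_carrier A1_sym] QG1 frob_diff_left[OF A1_carrier F' F G]
      frob_diff_left[OF A1_carrier F Feq_carrier G] frob_diff_left[OF A1_carrier F' Feq_carrier G]
    by simp
  ultimately have "frob A\<^sub>1 G G + dt * frob A_chi G G = frob A\<^sub>1 (F - Feq) G + dt * frob A_chi Q G"
    by (simp add: algebra_simps)
  moreover have "dt * (chi_min * frob A\<^sub>1 G G) \<le> dt * frob A_chi G G"
    using frob_lower[OF G] dt_pos by simp
  moreover have "dt * frob A_chi Q G \<le> dt * (chi_max * q_E * nrm G)"
    using QGchi dt_pos by simp
  moreover have "frob A\<^sub>1 (F - Feq) G \<le> nrm (F - Feq) * nrm G"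
    using Cauchy_Schwarz_A1[OF D G] by simp
  ultimately have "(1 + dt * chi_min) * nrm G * nrm G \<le> (nrm (F - Feq) + dt * chi_max * q_E) * nrm G"
    using nrm_sq[OF G] by (simp add: algebra_simps power2_eq_square)
  then have "(1 + dt * chi_min) * nrm G \<le> nrm (F - Feq) + dt * chi_max * q_E"
    using nrm_nonneg[OF G] nrm_nonneg[OF D] dt_pos chi_max q0
    by (cases "nrm G = 0") (auto simp: order.order_iff_strict[of 0 "nrm G"])
  then have Gle: "nrm G \<le> (nrm (F - Feq) + dt * chi_max * q_E) / (1 + dt * chi_min)"
    using dt_pos chi_min_pos by (simp add: pos_le_divide_eq add_pos_pos mult.commute)
  have "(nrm Q)\<^sup>2 \<le> q_U\<^sup>2 + q_E\<^sup>2"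
  proof -
    have "U'\<^sup>T * a' = 0\<^sub>m r 1" by (rule cs(3))
    moreover have Ub: "(U'\<^sup>T * Ueq) * b' \<in> carrier_mat r n"
      using UT Ueq b' by (blast intro: mat_carrier_intros)
    moreover have ab'_eq: "a * b' = U' * (y * b')"
      unfolding cs(2) by (rule assoc_mult_mat[OF U' y b'])
    ultimately have orth: "frob A\<^sub>1 (a * b') (a' * e) = 0"
      using frob_orthogonal_col[OF A1_carrier U' _ a' e] by (simp add: y_def)
    have "frob A\<^sub>1 Q Q = frob A\<^sub>1 (s \<cdot>\<^sub>m (a' * e)) Q + frob A\<^sub>1 (s \<cdot>\<^sub>m (a * b')) Q"
      using frob_add_left[OF A1_carrier smult_carrier_mat[OF a'e] smult_carrier_mat[OF ab'] Q]
      by (simp add: Q_def)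
    also have "\<dots> = s * (frob A\<^sub>1 (a' * e) Q + frob A\<^sub>1 (a * b') Q)"
      using frob_smult_left[OF A1_carrier a'e Q] frob_smult_left[OF A1_carrier ab' Q]
      by (simp add: algebra_simps)
    also have "frob A\<^sub>1 (a' * e) Q = s * frob A\<^sub>1 (a' * e) (a' * e)"
      unfolding Q_def
      using frob_add_right[OF A1_carrier A1_sym a'e smult_carrier_mat[OF a'e] smult_carrier_mat[OF ab']]
        frob_smult_right[OF A1_carrier A1_sym a'e a'e] frob_smult_right[OF A1_carrier A1_sym a'e ab']
        orth frob_commute[OF A1_carrier a'e ab' A1_sym] by simp
    also have "frob A\<^sub>1 (a * b') Q = s * frob A\<^sub>1 (a * b') (a * b')"
      unfolding Q_def
      using frob_add_right[OF A1_carrier A1_sym ab' smult_carrier_mat[OF a'e] smult_carrier_mat[OF ab']]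
        frob_smult_right[OF A1_carrier A1_sym ab' a'e] frob_smult_right[OF A1_carrier A1_sym ab' ab']
        orth by simp
    also have "s * (s * frob A\<^sub>1 (a' * e) (a' * e) + s * frob A\<^sub>1 (a * b') (a * b'))
        = q_U\<^sup>2 + (euclid_norm a)\<^sup>2 * q_E\<^sup>2"
      unfolding frob_outer[OF A1_carrier a' a' e e] frob_outer[OF A1_carrier a a b' b']
        euclid_norm_sq[OF a, symmetric] euclid_norm_sq[OF a', symmetric] nrm_sq[OF b', symmetric] e_unit qE qU
      by (simp add: power2_eq_square algebra_simps)
    also have "\<dots> \<le> q_U\<^sup>2 + 1\<^sup>2 * q_E\<^sup>2"
      using a_le euclid_norm_nonneg[of a] by (intro add_left_mono mult_right_mono power_mono) auto
    finally show ?thesis by (simp add: nrm_sq[OF Q])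
  qed
  then have Qle: "nrm Q \<le> sqrt (q_U\<^sup>2 + q_E\<^sup>2)" by (rule real_le_rsqrt)
  have "nrm ((- 1) \<cdot>\<^sub>m Q) = nrm Q"
    unfolding mat_norm_eq_frob
    using frob_smult_left[OF A1_carrier Q smult_carrier_mat[OF Q]] frob_smult_right[OF A1_carrier A1_sym Q Q]
    by simp
  then have "nrm (F' - Feq) \<le> nrm G + nrm Q"
    unfolding err using nrm_triangle[OF G smult_carrier_mat[OF Q]] by metis
  then show ?thesis using Gle Qle unfolding F'_def by linarith
qed

end

section \<open>Contraction towards the equilibrium\<close>

context rank_one_equilibrium
begin

text \<open>
  A step of the scheme, with the factorisations \<open>K = U' R\<^sub>K\<close> and \<open>L = E' R\<^sub>L\<close> substituted.
\<close>

definition step :: "real mat \<Rightarrow> real mat \<Rightarrow> real mat \<Rightarrow> real mat \<Rightarrow> real mat \<Rightarrow> real mat \<Rightarrow> bool" where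
  "step U S E U' S' E' \<longleftrightarrow>
     dlr_factors m n r A\<^sub>1 U' S' E' \<and>
     (\<exists>R\<^sub>K \<in> carrier_mat r r. galerkin (V_K E) (U * S * E\<^sup>T) (U' * R\<^sub>K * E\<^sup>T)) \<and>
     (\<exists>R\<^sub>L \<in> carrier_mat r r. galerkin (V_L U) (U * S * E\<^sup>T) (U * (E' * R\<^sub>L)\<^sup>T)) \<and>
     galerkin (V_S U' E') (U * S * E\<^sup>T) (U' * S' * E'\<^sup>T)"

text \<open>
  The K- and the L-step start at the equilibrium and contain it in their spaces, so they
  reproduce it. Hence its columns lie in the range of \<open>U'\<close> and its rows in the span of \<open>E'\<close>, and
  it belongs to the space of the S-step too.
\<close>

lemma step_preserves_equilibrium:
  assumes fac: "dlr_factors m n r A\<^sub>1 U S E" and st: "step U S E U' S' E'"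
    and eq: "U * S * E\<^sup>T = Feq"
  shows "U' * S' * E'\<^sup>T = Feq"
proof -
  from fac have U: "U \<in> carrier_mat m r" and S: "S \<in> carrier_mat r r" and E: "E \<in> carrier_mat n r"
    by (auto simp: dlr_factors_def)
  from st have U': "U' \<in> carrier_mat m r" and S': "S' \<in> carrier_mat r r" and E': "E' \<in> carrier_mat n r"
    and UU: "U'\<^sup>T * U' = 1\<^sub>m r"
    by (auto simp: step_def dlr_factors_def)
  from st eq obtain R\<^sub>K R\<^sub>L where RK: "R\<^sub>K \<in> carrier_mat r r" and RL: "R\<^sub>L \<in> carrier_mat r r"
    and gK: "galerkin (V_K E) Feq (U' * R\<^sub>K * E\<^sup>T)" and gL: "galerkin (V_L U) Feq (U * (E' * R\<^sub>L)\<^sup>T)"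
    and gS: "galerkin (V_S U' E') Feq (U' * S' * E'\<^sup>T)"
    unfolding step_def by auto
  have T: "E\<^sup>T \<in> carrier_mat r n" "E'\<^sup>T \<in> carrier_mat r n" "U'\<^sup>T \<in> carrier_mat r m" "R\<^sub>L\<^sup>T \<in> carrier_mat r r"
    using E E' U' RL by auto
  have K: "U' * R\<^sub>K \<in> carrier_mat m r" and US: "U * S \<in> carrier_mat m r" and UR: "U * R\<^sub>L\<^sup>T \<in> carrier_mat m r"
    and RE: "R\<^sub>K * E\<^sup>T \<in> carrier_mat r n" and US': "U' * S' \<in> carrier_mat m r"
    and RLE: "R\<^sub>L\<^sup>T * E'\<^sup>T \<in> carrier_mat r n" and SE: "S * E\<^sup>T \<in> carrier_mat r n"
    using U' RK U S T S' by (blast intro: mat_carrier_intros)+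
  have "U' * R\<^sub>K * E\<^sup>T - Feq = (U' * R\<^sub>K - U * S) * E\<^sup>T"
    unfolding eq[symmetric] by (rule minus_mult_distrib_mat[OF K US T(1), symmetric])
  moreover have "U' * R\<^sub>K - U * S \<in> carrier_mat m r" using K US by (blast intro: mat_carrier_intros)
  ultimately have "U' * R\<^sub>K * E\<^sup>T = Feq"
    using K T by (intro galerkin_exact[OF gK]) (unfold V_K_def, blast, blast intro: mat_carrier_intros)
  then have FK: "Feq = U' * (R\<^sub>K * E\<^sup>T)" using assoc_mult_mat[OF U' RK T(1)] by simp
  have L_eq: "U * (E' * R\<^sub>L)\<^sup>T = U * (R\<^sub>L\<^sup>T * E'\<^sup>T)" using transpose_mult[OF E' RL] by simp
  have "U * (E' * R\<^sub>L)\<^sup>T - Feq = U * (R\<^sub>L\<^sup>T * E'\<^sup>T - S * E\<^sup>T)"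
    unfolding eq[symmetric] L_eq assoc_mult_mat[OF U S T(1)]
    by (rule mult_minus_distrib_mat[OF U RLE SE, symmetric])
  moreover define W where "W = R\<^sub>L\<^sup>T * E'\<^sup>T - S * E\<^sup>T"
  have W: "W \<in> carrier_mat r n" unfolding W_def using RLE SE by (blast intro: mat_carrier_intros)
  ultimately have "U * (E' * R\<^sub>L)\<^sup>T - Feq \<in> V_L U"
    unfolding V_L_def W_def[symmetric] by (intro CollectI exI[of _ "W\<^sup>T"]) auto
  then have "U * (E' * R\<^sub>L)\<^sup>T = Feq"
    by (rule galerkin_exact[OF gL]) (unfold L_eq, use U RLE in \<open>blast intro: mat_carrier_intros\<close>)
  then have FL: "Feq = U * R\<^sub>L\<^sup>T * E'\<^sup>T" unfolding L_eq using assoc_mult_mat[OF U T(4) T(2)] by simp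
  define P where "P = U'\<^sup>T * (U * R\<^sub>L\<^sup>T)"
  have P: "P \<in> carrier_mat r r" unfolding P_def using T UR by (blast intro: mat_carrier_intros)
  have UP: "U' * P \<in> carrier_mat m r" using U' P by (blast intro: mat_carrier_intros)
  have "U'\<^sup>T * Feq = R\<^sub>K * E\<^sup>T"
  proof -
    have "U'\<^sup>T * Feq = (U'\<^sup>T * U') * (R\<^sub>K * E\<^sup>T)"
      unfolding FK by (rule assoc_mult_mat[OF T(3) U' RE, symmetric])
    then show ?thesis using RE by (simp only: UU left_mult_one_mat[OF RE])
  qed
  then have "Feq = U' * (U'\<^sup>T * Feq)" using FK by simp
  also have "U'\<^sup>T * Feq = P * E'\<^sup>T"
    unfolding P_def FL by (rule assoc_mult_mat[OF T(3) UR T(2), symmetric])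
  finally have FP: "Feq = U' * P * E'\<^sup>T" using assoc_mult_mat[OF U' P T(2)] by simp
  have "U' * S' * E'\<^sup>T - Feq = (U' * S' - U' * P) * E'\<^sup>T"
    unfolding FP by (rule minus_mult_distrib_mat[OF US' UP T(2), symmetric])
  also have "U' * S' - U' * P = U' * (S' - P)" by (rule mult_minus_distrib_mat[OF U' S' P, symmetric])
  finally have "U' * S' * E'\<^sup>T - Feq \<in> V_S U' E'"
    unfolding V_S_def using S' P by (blast intro: mat_carrier_intros)
  then show ?thesis
    by (rule galerkin_exact[OF gS]) (use US' T in \<open>blast intro: mat_carrier_intros\<close>)
qed

text \<open>
  The bounds on \<open>dt\<close> make each defect at most \<open>\<delta> / sqrt 2\<close> times the error. The root of two is
  absorbed when the two orthogonal defects are added as squares.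
\<close>

lemma one_step_estimates:
  fixes \<alpha> \<beta> \<delta> :: real
  assumes fac: "dlr_factors m n r A\<^sub>1 U S E" and st: "step U S E U' S' E'"
    and \<alpha>: "0 < \<alpha>" "\<alpha> \<le> nrm (e * A_chi * proj_E_chi A_chi E)"
    and \<beta>: "0 < \<beta>" "\<beta> \<le> euclid_norm (proj_U U * Ueq)"
    and \<delta>: "0 < \<delta>"
    and dt1: "sqrt 2 \<le> \<delta> * (dt * \<beta> * chi_min)"
    and dt2: "sqrt 2 * sqrt (chi_max / chi_min) \<le> \<delta> * (dt * \<alpha> * chi_min)"
  shows "s * euclid_norm (Ueq - proj_U U' * Ueq) \<le> \<delta> / sqrt 2 * nrm (U * S * E\<^sup>T - Feq)" (is ?A)
    and "s * nrm (e - e * A\<^sub>1 * proj_E E') \<le> \<delta> / sqrt 2 * nrm (U * S * E\<^sup>T - Feq)" (is ?B)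
    and "nrm (U' * S' * E'\<^sup>T - Feq) \<le>
           (1 / (1 + dt * chi_min) + (1 + chi_max / chi_min) * \<delta>) * nrm (U * S * E\<^sup>T - Feq)" (is ?C)
proof -
  define F where "F = U * S * E\<^sup>T"
  define D where "D = nrm (F - Feq)"
  define \<kappa> where "\<kappa> = chi_max / chi_min"
  define qU where "qU = s * euclid_norm (Ueq - proj_U U' * Ueq)"
  define qE where "qE = s * nrm (e - e * A\<^sub>1 * proj_E E')"
  from fac have U: "U \<in> carrier_mat m r" and S: "S \<in> carrier_mat r r" and E: "E \<in> carrier_mat n r"
    and UU: "U\<^sup>T * U = 1\<^sub>m r" and EE: "E\<^sup>T * A\<^sub>1 * E = 1\<^sub>m r"
    by (auto simp: dlr_factors_def)
  from st have U': "U' \<in> carrier_mat m r" and S': "S' \<in> carrier_mat r r" and E': "E' \<in> carrier_mat n r"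
    and UU': "U'\<^sup>T * U' = 1\<^sub>m r" and EE': "E'\<^sup>T * A\<^sub>1 * E' = 1\<^sub>m r"
    by (auto simp: step_def dlr_factors_def)
  from st obtain R\<^sub>K R\<^sub>L where RK: "R\<^sub>K \<in> carrier_mat r r" and RL: "R\<^sub>L \<in> carrier_mat r r"
    and gK: "galerkin (V_K E) F (U' * R\<^sub>K * E\<^sup>T)" and gL: "galerkin (V_L U) F (U * (E' * R\<^sub>L)\<^sup>T)"
    and gS: "galerkin (V_S U' E') F (U' * S' * E'\<^sup>T)"
    unfolding step_def F_def by auto
  have US: "U * S \<in> carrier_mat m r" using U S by (blast intro: mat_carrier_intros)
  have Fc: "F \<in> carrier_mat m n"
    unfolding F_def using US E by (blast intro: mat_carrier_intros)
  have "F - Feq \<in> carrier_mat m n" using Fc Feq_carrier by (blast intro: mat_carrier_intros)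
  then have D0: "0 \<le> D" unfolding D_def by (rule nrm_nonneg)
  note csU = col_split[OF U' UU'] and rsE = row_split[OF E' EE']
  have a: "Ueq - proj_U U' * Ueq \<in> carrier_mat m 1" using csU(1) Ueq by (blast intro: mat_carrier_intros)
  have b': "e - e * A\<^sub>1 * proj_E E' \<in> carrier_mat 1 n" using rsE(1) e by (blast intro: mat_carrier_intros)
  have qU0: "0 \<le> qU" unfolding qU_def using s_nonneg by (simp add: euclid_norm_nonneg)
  have qE0: "0 \<le> qE" unfolding qE_def using s_nonneg nrm_nonneg[OF b'] by simp
  have \<kappa>1: "1 \<le> \<kappa>" unfolding \<kappa>_def using chi_min_le_max chi_min_pos by simp
  obtain z where z: "z \<in> carrier_mat 1 r" and zb: "e * A_chi * proj_E_chi A_chi E = z * E\<^sup>T"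
    and eb: "frob A_chi e (z * E\<^sup>T) = frob A_chi (z * E\<^sup>T) (z * E\<^sup>T)"
    using chi_projection[OF E EE e] by blast
  have "dt * chi_min * \<alpha> * qU \<le> dt * chi_min * nrm (z * E\<^sup>T) * qU"
    using \<alpha> zb dt_pos chi_min_pos qU0 by (intro mult_right_mono mult_left_mono) auto
  also have "\<dots> \<le> sqrt \<kappa> * D"
    using K_step_column_defect[OF U' E US RK F_def gK a csU(3,4) z refl eb] by (simp add: qU_def D_def \<kappa>_def)
  finally have K: "dt * chi_min * \<alpha> * qU \<le> sqrt \<kappa> * D" .
  have "sqrt \<kappa> * (sqrt 2 * qU) = sqrt 2 * sqrt \<kappa> * qU" by simp
  also have "\<dots> \<le> \<delta> * (dt * \<alpha> * chi_min) * qU"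
    using dt2 qU0 by (intro mult_right_mono) (simp_all add: \<kappa>_def)
  also have "\<dots> = \<delta> * (dt * chi_min * \<alpha> * qU)" by simp
  also have "\<dots> \<le> \<delta> * (sqrt \<kappa> * D)" using K \<delta> by simp
  finally have "sqrt \<kappa> * (sqrt 2 * qU) \<le> sqrt \<kappa> * (\<delta> * D)" by (simp add: mult_ac)
  then have qU: "sqrt 2 * qU \<le> \<delta> * D" using \<kappa>1 by simp
  have b'_orth: "frob A\<^sub>1 e (e - e * A\<^sub>1 * proj_E E') = frob A\<^sub>1 (e - e * A\<^sub>1 * proj_E E') (e - e * A\<^sub>1 * proj_E E')"
    by (rule rsE(4))
  have "dt * chi_min * \<beta> * qE \<le> (1 + dt * chi_min) * euclid_norm (proj_U U * Ueq) * qE"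
    using \<beta> dt_pos chi_min_pos qE0 by (intro mult_right_mono mult_mono) auto
  also have "\<dots> \<le> D"
    using L_step_row_defect[OF U UU E' RL Fc gL b' rsE(3,4)] by (simp add: qE_def D_def)
  finally have L: "dt * chi_min * \<beta> * qE \<le> D" .
  have "sqrt 2 * qE \<le> \<delta> * (dt * \<beta> * chi_min) * qE"
    using dt1 qE0 by (rule mult_right_mono)
  also have "\<dots> = \<delta> * (dt * chi_min * \<beta> * qE)" by simp
  also have "\<dots> \<le> \<delta> * D" using L \<delta> by simp
  finally have qE: "sqrt 2 * qE \<le> \<delta> * D" .
  show ?A using qU unfolding qU_def D_def F_def by (simp add: field_simps)
  show ?B using qE unfolding qE_def D_def F_def by (simp add: field_simps)
  have "sqrt (qU\<^sup>2 + qE\<^sup>2) \<le> \<delta> * D"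
  proof (rule real_le_lsqrt)
    have "(sqrt 2 * qU)\<^sup>2 \<le> (\<delta> * D)\<^sup>2" "(sqrt 2 * qE)\<^sup>2 \<le> (\<delta> * D)\<^sup>2"
      using qU qE qU0 qE0 by (auto intro!: power_mono)
    then show "qU\<^sup>2 + qE\<^sup>2 \<le> (\<delta> * D)\<^sup>2" by (simp add: power_mult_distrib)
  qed (use \<delta> D0 in auto)
  moreover have "(D + dt * chi_max * qE) / (1 + dt * chi_min) \<le> D / (1 + dt * chi_min) + \<kappa> * (\<delta> * D)"
  proof -
    have pos: "0 < 1 + dt * chi_min" using dt_pos chi_min_pos by (simp add: add_pos_pos)
    have "qE \<le> sqrt 2 * qE" using mult_right_mono[OF _ qE0, of 1 "sqrt 2"] by simp
    then have "qE \<le> \<delta> * D" using qE by linarith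
    then have "\<kappa> * qE \<le> \<kappa> * (\<delta> * D)" using \<kappa>1 by (intro mult_left_mono) auto
    moreover have "dt * chi_max * qE / (1 + dt * chi_min) \<le> \<kappa> * qE"
    proof -
      have "dt * chi_max = \<kappa> * (dt * chi_min)" unfolding \<kappa>_def using chi_min_pos by simp
      also have "\<dots> \<le> \<kappa> * (1 + dt * chi_min)" using \<kappa>1 by (intro mult_left_mono) auto
      finally have "dt * chi_max * qE \<le> \<kappa> * (1 + dt * chi_min) * qE" using qE0 by (rule mult_right_mono)
      then show ?thesis using pos by (simp add: pos_divide_le_eq mult_ac)
    qed
    ultimately show ?thesis by (simp add: add_divide_distrib)
  qed
  moreover have "nrm (U' * S' * E'\<^sup>T - Feq) \<le> (D + dt * chi_max * qE) / (1 + dt * chi_min) + sqrt (qU\<^sup>2 + qE\<^sup>2)"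
    using S_step_error[OF U' UU' E' EE' S' Fc gS] by (simp add: D_def qU_def qE_def)
  ultimately have "nrm (U' * S' * E'\<^sup>T - Feq) \<le> D / (1 + dt * chi_min) + \<kappa> * (\<delta> * D) + \<delta> * D" by linarith
  also have "\<dots> = (1 / (1 + dt * chi_min) + (1 + \<kappa>) * \<delta>) * D" by (simp add: algebra_simps)
  finally show ?C by (simp add: D_def F_def \<kappa>_def)
qed

text \<open>
  The induction carries along the lower bounds on the overlaps, without which the defects of the
  next step could not be estimated. They persist because the error is at most the initial error,
  for which \<open>\<delta>_init\<close> provides the required smallness.
\<close>

lemma contraction:
  fixes \<alpha> \<beta> \<gamma> \<delta> :: real and U S E :: "nat \<Rightarrow> real mat"
  assumes fac0: "dlr_factors m n r A\<^sub>1 (U 0) (S 0) (E 0)"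
    and st: "\<And>i. step (U i) (S i) (E i) (U (Suc i)) (S (Suc i)) (E (Suc i))"
    and \<alpha>: "0 < \<alpha>" and init_E: "\<alpha> \<le> nrm (e * A_chi * proj_E_chi A_chi (E 0))"
    and \<beta>: "0 < \<beta>" and init_U: "\<beta> \<le> euclid_norm (proj_U (U 0) * Ueq)"
    and \<gamma>: "0 < \<gamma>"
    and \<gamma>_prop: "\<And>E'. E' \<in> carrier_mat n r \<Longrightarrow> E'\<^sup>T * A\<^sub>1 * E' = 1\<^sub>m r \<Longrightarrow>
        \<gamma> \<le> nrm (e * A\<^sub>1 * proj_E E') \<Longrightarrow> \<alpha> \<le> nrm (e * A_chi * proj_E_chi A_chi E')"
    and \<delta>: "0 < \<delta>" "(1 + chi_max / chi_min) * \<delta> < 1 - 1 / (1 + dt * chi_min)"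
    and \<delta>_init: "\<delta> * nrm (U 0 * S 0 * (E 0)\<^sup>T - Feq) \<le> sqrt (2 * (1 - (max \<gamma> \<beta>)\<^sup>2)) * s"
    and \<gamma>\<beta>_less: "max \<gamma> \<beta> < 1"
    and dt1: "sqrt 2 \<le> \<delta> * (dt * \<beta> * chi_min)"
    and dt2: "sqrt 2 * sqrt (chi_max / chi_min) \<le> \<delta> * (dt * \<alpha> * chi_min)"
  shows "nrm (U i * S i * (E i)\<^sup>T - Feq) \<le>
      (1 / (1 + dt * chi_min) + (1 + chi_max / chi_min) * \<delta>) ^ i * nrm (U 0 * S 0 * (E 0)\<^sup>T - Feq)"
proof -
  define \<rho> where "\<rho> = 1 / (1 + dt * chi_min) + (1 + chi_max / chi_min) * \<delta>"
  define D where "D i = nrm (U i * S i * (E i)\<^sup>T - Feq)" for i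
  define g where "g = max \<gamma> \<beta>"
  have \<rho>0: "0 \<le> \<rho>"
    unfolding \<rho>_def using dt_pos chi_min_pos chi_min_le_max \<delta>(1) by (intro add_nonneg_nonneg mult_nonneg_nonneg) auto
  have \<rho>1: "\<rho> \<le> 1" unfolding \<rho>_def using \<delta>(2) by simp
  have g: "0 < g" "g < 1" "\<gamma> \<le> g" "\<beta> \<le> g" unfolding g_def using \<gamma> \<gamma>\<beta>_less by auto
  have fac: "dlr_factors m n r A\<^sub>1 (U i) (S i) (E i)" for i
    by (cases i) (use fac0 st in \<open>auto simp: step_def\<close>)
  have D0: "0 \<le> D i" for i
    unfolding D_def mat_norm_eq_frob
  proof (rule real_sqrt_ge_zero, rule frob_A1_nonneg)
    from fac[of i] have "U i * S i * (E i)\<^sup>T \<in> carrier_mat m n"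
      unfolding dlr_factors_def by (blast intro: mat_carrier_intros)
    then show "U i * S i * (E i)\<^sup>T - Feq \<in> carrier_mat m n"
      using Feq_carrier by (blast intro: mat_carrier_intros)
  qed
  have "D i \<le> \<rho> ^ i * D 0 \<and> \<beta> \<le> euclid_norm (proj_U (U i) * Ueq) \<and>
      \<alpha> \<le> nrm (e * A_chi * proj_E_chi A_chi (E i))"
  proof (induction i)
    case 0
    then show ?case using init_E init_U by simp
  next
    case (Suc i)
    note os = one_step_estimates[OF fac st \<alpha>(1) conjunct2[OF conjunct2[OF Suc.IH]] \<beta>(1)
        conjunct1[OF conjunct2[OF Suc.IH]] \<delta>(1) dt1 dt2, folded D_def \<rho>_def]
    have "D (Suc i) \<le> \<rho> * D i" using os(3) by (simp add: D_def)
    also have "\<dots> \<le> \<rho> * (\<rho> ^ i * D 0)" using Suc.IH \<rho>0 by (intro mult_left_mono) auto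
    finally have contr: "D (Suc i) \<le> \<rho> ^ Suc i * D 0" by simp
    have "\<rho> ^ i * D 0 \<le> 1 * D 0" using \<rho>0 \<rho>1 D0 by (intro mult_right_mono power_le_one) auto
    then have "D i \<le> D 0" using Suc.IH by linarith
    then have "\<delta> * D i \<le> \<delta> * D 0" using \<delta>(1) by simp
    also have "\<dots> \<le> sqrt (2 * (1 - g\<^sup>2)) * s" using \<delta>_init by (simp add: D_def g_def)
    also have "\<dots> = sqrt 2 * (sqrt (1 - g\<^sup>2) * s)" unfolding real_sqrt_mult by simp
    finally have \<delta>D: "\<delta> / sqrt 2 * D i \<le> sqrt (1 - g\<^sup>2) * s" by (simp add: field_simps)
    have g2: "g\<^sup>2 < 1" using g by (simp add: power_less_one_iff abs_square_less_1)
    \<comment> \<open>\<open>p\<close> stands for an overlap and \<open>q\<close> for the corresponding relative defect\<close>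
    have lower: "g \<le> p" if "p\<^sup>2 + q\<^sup>2 = 1" "0 \<le> p" "0 \<le> q" "s * q \<le> \<delta> / sqrt 2 * D i" for p q
    proof (rule power2_le_imp_le[OF _ that(2)])
      have "q * s \<le> sqrt (1 - g\<^sup>2) * s" using that(4) \<delta>D by (simp add: mult.commute)
      then have "q \<le> sqrt (1 - g\<^sup>2)" using s_pos by simp
      then have "q\<^sup>2 \<le> (sqrt (1 - g\<^sup>2))\<^sup>2" using that(3) by (rule power_mono)
      then show "g\<^sup>2 \<le> p\<^sup>2" using that(1) g2 by simp
    qed
    from st[of i] have U': "U (Suc i) \<in> carrier_mat m r" and E': "E (Suc i) \<in> carrier_mat n r"
      and UU': "(U (Suc i))\<^sup>T * U (Suc i) = 1\<^sub>m r" and EE': "(E (Suc i))\<^sup>T * A\<^sub>1 * E (Suc i) = 1\<^sub>m r"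
      by (auto simp: step_def dlr_factors_def)
    note csU = col_split[OF U' UU'] and rsE = row_split[OF E' EE']
    have b': "e - e * A\<^sub>1 * proj_E (E (Suc i)) \<in> carrier_mat 1 n"
      using rsE(1) e by (blast intro: mat_carrier_intros)
    have "g \<le> euclid_norm (proj_U (U (Suc i)) * Ueq)"
      by (rule lower[OF csU(5) euclid_norm_nonneg euclid_norm_nonneg os(1)])
    moreover have "g \<le> nrm (e * A\<^sub>1 * proj_E (E (Suc i)))"
      by (rule lower[OF rsE(5) nrm_nonneg[OF rsE(1)] nrm_nonneg[OF b'] os(2)])
    ultimately show ?case using contr g \<gamma>_prop[OF E' EE'] by auto
  qed
  then show ?thesis unfolding D_def \<rho>_def by blast
qed

end

section \<open>Legendre polynomials\<close>

lemma degree_legendre_poly: "degree (legendre_poly l) = l"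
proof -
  have "degree ([:-1, 0, 1::real:] ^ l) = 2 * l" by (simp add: degree_power_eq)
  then show ?thesis by (simp add: legendre_poly_def degree_higher_pderiv)
qed

lemma legendre_poly_nonzero: "legendre_poly l \<noteq> 0"
proof (cases "l = 0")
  case False
  then show ?thesis using degree_legendre_poly[of l] by (metis degree_0)
qed (simp add: legendre_poly_def)

lemma power_dvd_pderiv:
  fixes q f :: "real poly"
  assumes "q ^ Suc i dvd f" shows "q ^ i dvd pderiv f"
proof -
  obtain g where f: "f = q ^ Suc i * g" using assms by (auto elim: dvdE)
  have "pderiv f = q ^ Suc i * pderiv g + g * (Polynomial.smult (of_nat (Suc i)) (q ^ i) * pderiv q)"
    by (simp only: f pderiv_mult pderiv_power_Suc)
  moreover have "q ^ i dvd q ^ Suc i" by (rule le_imp_power_dvd) simp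
  moreover have "q ^ i dvd Polynomial.smult (of_nat (Suc i)) (q ^ i)" by (rule dvd_smult) simp
  ultimately show ?thesis by (simp only: dvd_add dvd_mult dvd_mult2)
qed

text \<open>
  Each differentiation lowers the order of a zero by at most one.
\<close>

lemma higher_pderiv_power_vanishes:
  fixes q :: "real poly"
  assumes "j < l" "poly q t = 0" shows "poly ((pderiv ^^ j) (q ^ l)) t = 0"
proof -
  have "j \<le> l \<Longrightarrow> q ^ (l - j) dvd (pderiv ^^ j) (q ^ l)"
  proof (induction j)
    case (Suc j)
    then have "q ^ Suc (l - Suc j) dvd (pderiv ^^ j) (q ^ l)" by (simp add: Suc_diff_le[symmetric] del: power_Suc)
    then show ?case using power_dvd_pderiv by simp
  qed simp
  then have "q ^ (l - j) dvd (pderiv ^^ j) (q ^ l)" using assms by simp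
  then obtain h where "(pderiv ^^ j) (q ^ l) = q ^ (l - j) * h" by (auto elim: dvdE)
  then show ?thesis using assms by (simp add: poly_power)
qed

text \<open>
  Repeated integration by parts, carried out on polynomials: the boundary terms vanish since
  \<open>(t\<^sup>2 - 1) ^ l\<close> has zeros of order \<open>l\<close> at both ends, and after \<open>degree q + 1\<close> steps the factor
  \<open>q\<close> has been differentiated away.
\<close>

lemma antiderivative_vanishing_at_ends:
  assumes "degree q < j" "j \<le> l"
  shows "\<exists>G. pderiv G = q * (pderiv ^^ j) ([:-1, 0, 1::real:] ^ l) \<and> poly G 1 = 0 \<and> poly G (-1) = 0"
  using assms
proof (induction j arbitrary: q)
  case (Suc j)
  let ?w = "[:-1, 0, 1::real:] ^ l"
  have "\<exists>G. pderiv G = pderiv q * (pderiv ^^ j) ?w \<and> poly G 1 = 0 \<and> poly G (-1) = 0"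
  proof (cases "degree q = 0")
    case True
    then show ?thesis by (intro exI[of _ 0]) (simp add: pderiv_eq_0_iff[THEN iffD2])
  next
    case False
    then show ?thesis using Suc by (intro Suc.IH) (auto simp: degree_pderiv)
  qed
  then obtain G where G: "pderiv G = pderiv q * (pderiv ^^ j) ?w" "poly G 1 = 0" "poly G (-1) = 0" by blast
  have "poly ((pderiv ^^ j) ?w) 1 = 0" "poly ((pderiv ^^ j) ?w) (-1) = 0"
    using Suc.prems by (auto intro!: higher_pderiv_power_vanishes)
  then show ?case using G
    by (intro exI[of _ "q * (pderiv ^^ j) ?w - G"]) (simp add: pderiv_diff pderiv_mult mult.commute)
qed simp

text \<open>
  Rodrigues' formula is applied to the factor of larger degree; this is the orthogonality of the
  Legendre polynomials in a form that can be transported to any cell.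
\<close>

lemma legendre_product_antiderivative:
  assumes "i \<noteq> l"
  shows "\<exists>G. pderiv G = legendre_poly i * legendre_poly l \<and> poly G 1 = 0 \<and> poly G (-1) = 0"
proof -
  have *: "\<exists>G. pderiv G = legendre_poly i * legendre_poly l \<and> poly G 1 = 0 \<and> poly G (-1) = 0"
    if less: "i < l" for i l
  proof -
    obtain G where G: "pderiv G = legendre_poly i * (pderiv ^^ l) ([:-1, 0, 1::real:] ^ l)"
        "poly G 1 = 0" "poly G (-1) = 0"
      using antiderivative_vanishing_at_ends[of "legendre_poly i" l l] less by (auto simp: degree_legendre_poly)
    then show ?thesis
      by (intro exI[of _ "Polynomial.smult (1 / (2 ^ l * fact l)) G"]) (simp add: pderiv_smult legendre_poly_def[of l])
  qed
  show ?thesis using *[of i l] *[of l i] assms by (cases "i < l") (auto simp: mult.commute)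
qed

text \<open>
  The affine map of the cell onto the reference interval from \<open>-1\<close> to \<open>1\<close>, as a polynomial.
\<close>

definition cell_map :: "real \<Rightarrow> real \<Rightarrow> real poly" where
  "cell_map a b = [:- (a + b) / (b - a), 2 / (b - a):]"

lemma poly_cell_map: "poly (cell_map a b) t = (2 * t - a - b) / (b - a)"
  by (simp add: cell_map_def diff_divide_distrib add_divide_distrib)

lemma cell_legendre_eq:
  "cell_legendre p c l t = indicator {p c..<p (Suc c)} t * poly (pcompose (legendre_poly l) (cell_map (p c) (p (Suc c)))) t"
  by (simp add: cell_legendre_def poly_pcompose poly_cell_map)

lemma has_bochner_integral_poly_cell:
  fixes H :: "real poly"
  assumes "a \<le> b"
  shows "has_bochner_integral lebesgue (\<lambda>t. indicator {a..<b} t * poly (pderiv H) t) (poly H b - poly H a)"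
proof -
  have "has_bochner_integral lborel (\<lambda>t. poly (pderiv H) t * indicator {a..b} t) (poly H b - poly H a)"
    using assms by (intro has_bochner_integral_FTC_Icc_real poly_DERIV) auto
  \<comment> \<open>the closed and the half-open cell differ by a null set\<close>
  moreover have "AE t in lborel. poly (pderiv H) t * indicator {a..b} t = indicator {a..<b} t * poly (pderiv H) t"
    using AE_lborel_singleton[of b] by eventually_elim (auto simp: indicator_def)
  moreover have poly [measurable]: "poly (pderiv H) \<in> borel_measurable borel"
    by (intro borel_measurable_continuous_onI continuous_intros)
  then have "(\<lambda>t. indicator {a..<b} t * poly (pderiv H) t) \<in> borel_measurable lborel" by measurable
  ultimately have "has_bochner_integral lborel (\<lambda>t. indicator {a..<b} t * poly (pderiv H) t) (poly H b - poly H a)"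
    by (subst (asm) has_bochner_integral_cong_AE) auto
  then show ?thesis
    using poly by (auto simp: has_bochner_integral_iff integrable_completion integral_completion)
qed

lemma cell_legendre_orthogonal:
  assumes "p c < p (Suc c)" "i \<noteq> l"
  shows "(LINT t|lebesgue. cell_legendre p c i t * cell_legendre p c l t) = 0"
proof -
  define a b where "a = p c" and "b = p (Suc c)"
  have ab: "a < b" using assms by (simp add: a_def b_def)
  obtain G where G: "pderiv G = legendre_poly i * legendre_poly l" "poly G 1 = 0" "poly G (-1) = 0"
    using legendre_product_antiderivative[OF assms(2)] by blast
  define H where "H = Polynomial.smult ((b - a) / 2) (pcompose G (cell_map a b))"
  have dcell: "pderiv (cell_map a b) = [:2 / (b - a):]" by (simp add: cell_map_def pderiv_pCons)
  have "pderiv H = pcompose (legendre_poly i * legendre_poly l) (cell_map a b)"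
  proof -
    have "(b - a) / 2 * (2 / (b - a)) = 1" using ab by simp
    then show ?thesis by (simp add: H_def pderiv_smult pderiv_pcompose G dcell del: times_divide_eq_left times_divide_eq_right)
  qed
  then have *: "cell_legendre p c i t * cell_legendre p c l t = indicator {a..<b} t * poly (pderiv H) t" for t
    by (simp add: cell_legendre_eq pcompose_mult a_def b_def indicator_def)
  have "poly (cell_map a b) b = 1" "poly (cell_map a b) a = -1"
    using ab by (simp_all add: poly_cell_map divide_eq_eq)
  then have "poly H b - poly H a = 0" by (simp add: H_def poly_pcompose G)
  then show ?thesis
    using has_bochner_integral_integral_eq[OF has_bochner_integral_poly_cell[of a b H]] ab by (simp add: *)
qed

lemma cell_legendre_norm_pos:
  assumes "p c < p (Suc c)"
  shows "0 < (LINT t|lebesgue. (cell_legendre p c l t)\<^sup>2)"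
proof -
  define a b where "a = p c" and "b = p (Suc c)"
  have ab: "a < b" using assms by (simp add: a_def b_def)
  define q where "q = pcompose (legendre_poly l) (cell_map a b)"
  have "degree (cell_map a b) = 1" using ab by (simp add: cell_map_def)
  then have q0: "q \<noteq> 0"
    unfolding q_def using pcompose_eq_0[of "legendre_poly l" "cell_map a b"] legendre_poly_nonzero by auto
  have eq: "(cell_legendre p c l t)\<^sup>2 = indicator {a..<b} t * poly (q\<^sup>2) t" for t
    by (simp add: cell_legendre_eq a_def b_def q_def power_mult_distrib poly_power indicator_def)
  have cont: "continuous_on {a..b} (poly (q\<^sup>2))" by (intro continuous_intros)
  have int: "integrable lebesgue (\<lambda>t. indicator {a..<b} t * poly (q\<^sup>2) t)"
  proof -
    have "set_integrable lborel {a..<b} (poly (q\<^sup>2))"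
      using borel_integrable_atLeastAtMost'[OF cont] by (rule set_integrable_subset) auto
    then show ?thesis
      by (simp add: set_integrable_def integrable_completion)
  qed
  have "(LINT t|lebesgue. indicator {a..<b} t * poly (q\<^sup>2) t) \<noteq> 0"
  proof
    assume "(LINT t|lebesgue. indicator {a..<b} t * poly (q\<^sup>2) t) = 0"
    then have ae: "AE t in lebesgue. indicator {a..<b} t * poly (q\<^sup>2) t = 0"
      by (subst (asm) integral_nonneg_eq_0_iff_AE[OF int]) (auto simp: poly_power)
    have "AE t in lebesgue. t \<notin> {x. poly q x = 0}"
      using poly_roots_finite[OF q0] by (intro AE_not_in) (auto intro: null_sets_completionI finite_imp_null_set_lborel)
    with ae have "AE t in lebesgue. t \<notin> {a..<b}"
      by eventually_elim (auto simp: indicator_def poly_power split: if_splits)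
    then have "emeasure lebesgue {a..<b} = 0"
      by (subst (asm) AE_iff_measurable[where N = "{a..<b}"]) auto
    then show False using ab by simp
  qed
  moreover have "(LINT t|lebesgue. indicator {a..<b} t * poly (q\<^sup>2) t) \<ge> 0"
    by (intro integral_nonneg_AE AE_I2) (auto simp: poly_power)
  ultimately show ?thesis by (simp add: eq less_le)
qed

text \<open>
  The leading coefficient is eliminated first. Vanishing coefficients rather than a degree
  bound allow the induction to start at the zero polynomial.
\<close>

lemma triangular_degrees_span:
  fixes e :: "nat \<Rightarrow> 'a::field poly"
  assumes "\<And>l. degree (e l) = l" "\<And>l. e l \<noteq> 0"
  shows "(\<And>j. j \<ge> k \<Longrightarrow> coeff q j = 0) \<Longrightarrow> \<exists>d. q = (\<Sum>l<k. Polynomial.smult (d l) (e l))"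
proof (induction k arbitrary: q)
  case 0
  then have "q = 0" by (intro poly_eqI) simp
  then show ?case by simp
next
  case (Suc k)
  define d where "d = coeff q k / coeff (e k) k"
  have lc: "coeff (e k) k \<noteq> 0" using assms by (metis leading_coeff_0_iff)
  have "coeff (q - Polynomial.smult d (e k)) j = 0" if "j \<ge> k" for j
  proof (cases "j = k")
    case True
    then show ?thesis using lc by (simp add: d_def)
  next
    case False
    then have "coeff (e k) j = 0" using that by (intro coeff_eq_0) (simp add: assms)
    then show ?thesis using Suc.prems[of j] that False by simp
  qed
  from Suc.IH[OF this] obtain d' where d': "q - Polynomial.smult d (e k) = (\<Sum>l<k. Polynomial.smult (d' l) (e l))" by blast
  have "q = (\<Sum>l<k. Polynomial.smult (d' l) (e l)) + Polynomial.smult d (e k)" using d' by (simp add: diff_eq_eq)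
  also have "\<dots> = (\<Sum>l<Suc k. Polynomial.smult ((d'(k := d)) l) (e l))" by simp
  finally show ?case by blast
qed

section \<open>Piecewise Legendre bases\<close>

text \<open>
  Apart from its span, this is all that is needed of the Legendre basis. Boundedness and
  measurability are required on the whole line, which the cut-off at the cells provides.
\<close>

locale orthonormal_system =
  fixes a b :: real and n :: nat and y :: "nat \<Rightarrow> real \<Rightarrow> real"
  assumes basis_measurable: "i < n \<Longrightarrow> y i \<in> borel_measurable borel"
    and basis_bounded: "i < n \<Longrightarrow> \<exists>B. \<forall>t. \<bar>y i t\<bar> \<le> B"
    and orthonormal: "i < n \<Longrightarrow> j < n \<Longrightarrow>
      (LINT t:{a..b}|lebesgue. y i t * y j t) = (if i = j then 1 else 0)"

lemma is_partition_mono: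
  assumes "is_partition a b N p" "i \<le> j" "j \<le> N"
  shows "p i \<le> p j"
  using assms(2,3)
proof (induction j rule: dec_induct)
  case (step j)
  then have "p j < p (Suc j)" using assms(1) by (simp add: is_partition_def)
  then show ?case using step by simp
qed simp

lemma is_partition_cell:
  assumes "is_partition a b N p" "c < N"
  shows "p c < p (Suc c)" "a \<le> p c" "p (Suc c) \<le> b"
  using is_partition_mono[OF assms(1), of 0 c] is_partition_mono[OF assms(1), of "Suc c" N] assms
  by (auto simp: is_partition_def)

definition basis_scale :: "nat \<Rightarrow> (nat \<Rightarrow> real) \<Rightarrow> nat \<Rightarrow> real" where
  "basis_scale k p i = sqrt (LINT s|lebesgue. (cell_legendre p (i div (k + 1)) (i mod (k + 1)) s)\<^sup>2)"

lemma legendre_basis_eq: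
  "legendre_basis k p i t = cell_legendre p (i div (k + 1)) (i mod (k + 1)) t / basis_scale k p i"
  by (simp add: legendre_basis_def basis_scale_def Let_def)

lemma indicator_poly_bounded: "\<exists>B. \<forall>t. \<bar>indicator {a..<b::real} t * poly q t\<bar> \<le> B"
proof -
  have "bounded (poly q ` {a..b})"
    by (intro compact_imp_bounded compact_continuous_image continuous_intros) auto
  then obtain B where "\<forall>s \<in> poly q ` {a..b}. \<bar>s\<bar> \<le> B" unfolding bounded_real by blast
  then have B: "\<bar>poly q t\<bar> \<le> B" if "t \<in> {a..b}" for t using that by blast
  have "\<bar>indicator {a..<b} t * poly q t\<bar> \<le> max B 0" for t
    using B[of t] by (auto simp: indicator_def)
  then show ?thesis by blast
qed

lemma orthonormal_system_legendre_basis: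
  assumes part: "is_partition a b N p"
  shows "orthonormal_system a b ((k + 1) * N) (legendre_basis k p)"
proof
  fix i assume i: "i < (k + 1) * N"
  have poly [measurable]: "poly q \<in> borel_measurable borel" for q :: "real poly"
    by (intro borel_measurable_continuous_onI continuous_intros)
  show "legendre_basis k p i \<in> borel_measurable borel"
    unfolding legendre_basis_eq[abs_def] cell_legendre_eq by measurable
  obtain B where B: "\<And>t. \<bar>cell_legendre p (i div (k + 1)) (i mod (k + 1)) t\<bar> \<le> B"
    unfolding cell_legendre_eq using indicator_poly_bounded by blast
  have "\<bar>legendre_basis k p i t\<bar> \<le> B / basis_scale k p i" for t
    unfolding legendre_basis_eq using B[of t] by (simp add: basis_scale_def divide_right_mono)
  then show "\<exists>B. \<forall>t. \<bar>legendre_basis k p i t\<bar> \<le> B" by blast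
next
  fix i j assume i: "i < (k + 1) * N" and j: "j < (k + 1) * N"
  define ci di cj dj where defs: "ci = i div (k + 1)" "di = i mod (k + 1)" "cj = j div (k + 1)" "dj = j mod (k + 1)"
  have c: "ci < N" "cj < N"
    unfolding defs using i j by (auto intro!: less_mult_imp_div_less simp: mult.commute)
  note ci = is_partition_cell[OF part c(1)] and cj = is_partition_cell[OF part c(2)]
  have supp: "indicator {a..b} t * (legendre_basis k p i t * legendre_basis k p j t)
      = cell_legendre p ci di t * cell_legendre p cj dj t / (basis_scale k p i * basis_scale k p j)" for t
    using ci by (auto simp: legendre_basis_eq cell_legendre_eq defs indicator_def)
  have I: "(LINT t:{a..b}|lebesgue. legendre_basis k p i t * legendre_basis k p j t) =
      (LINT t|lebesgue. cell_legendre p ci di t * cell_legendre p cj dj t) / (basis_scale k p i * basis_scale k p j)"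
    unfolding set_lebesgue_integral_def real_scaleR_def supp by simp
  show "(LINT t:{a..b}|lebesgue. legendre_basis k p i t * legendre_basis k p j t) = (if i = j then 1 else 0)"
  proof (cases "ci = cj")
    case False
    have "cell_legendre p ci di t * cell_legendre p cj dj t = 0" for t
    proof (cases "ci < cj")
      case True
      then have "p (Suc ci) \<le> p cj" using c by (intro is_partition_mono[OF part]) auto
      then show ?thesis by (auto simp: cell_legendre_eq indicator_def)
    next
      case False
      then have "p (Suc cj) \<le> p ci" using c \<open>ci \<noteq> cj\<close> by (intro is_partition_mono[OF part]) auto
      then show ?thesis by (auto simp: cell_legendre_eq indicator_def)
    qed
    then have "(\<lambda>t. cell_legendre p ci di t * cell_legendre p cj dj t) = (\<lambda>_. 0)" by blast
    moreover have "i \<noteq> j" using False by (auto simp: defs)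
    ultimately show ?thesis unfolding I by simp
  next
    case same: True
    show ?thesis
    proof (cases "di = dj")
      case True
      then have ij: "i = j" using same unfolding defs by (metis div_mult_mod_eq)
      have pos: "0 < (LINT t|lebesgue. (cell_legendre p ci di t)\<^sup>2)"
        by (rule cell_legendre_norm_pos[of p, OF ci(1)])
      have "basis_scale k p i * basis_scale k p i = (LINT t|lebesgue. (cell_legendre p ci di t)\<^sup>2)"
        using pos unfolding basis_scale_def defs by simp
      then show ?thesis
        unfolding I using ij same True pos by (simp add: power2_eq_square)
    next
      case False
      then have "i \<noteq> j" by (auto simp: defs)
      then show ?thesis
        unfolding I using cell_legendre_orthogonal[of p ci di dj, OF ci(1) False] same by simp
    qed
  qed
qed

lemma sum_cells:
  fixes f :: "nat \<Rightarrow> 'a::comm_monoid_add"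
  shows "(\<Sum>i<(k + 1) * N. f i) = (\<Sum>c<N. \<Sum>l<k + 1. f (c * (k + 1) + l))"
proof -
  have cell: "sum f {c * (k + 1)..<c * (k + 1) + (k + 1)} = (\<Sum>l<k + 1. f (c * (k + 1) + l))" for c
    using sum.shift_bounds_nat_ivl[of f 0 "c * (k + 1)" "k + 1"]
    by (simp add: atLeast0LessThan add.commute)
  have "(\<Sum>i<(k + 1) * N. f i) = (\<Sum>c<N. sum f {c * (k + 1)..<c * (k + 1) + (k + 1)})"
    using sum.nat_group[of f "k + 1" N] by (simp add: mult.commute)
  then show ?thesis unfolding cell .
qed

text \<open>
  On each cell the transported Legendre polynomials have degrees \<open>0, \<dots>, k\<close> and therefore span
  all polynomials of degree at most \<open>k\<close>.
\<close>

lemma pw_poly_space_eq_span: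
  assumes part: "is_partition a b N p"
  shows "pw_poly_space k N p = {v. \<exists>c. v = (\<lambda>t. \<Sum>i<(k + 1) * N. c i * legendre_basis k p i t)}"
proof (intro equalityI subsetI)
  fix v assume "v \<in> {v. \<exists>c. v = (\<lambda>t. \<Sum>i<(k + 1) * N. c i * legendre_basis k p i t)}"
  then obtain c where v: "v = (\<lambda>t. \<Sum>i<(k + 1) * N. c i * legendre_basis k p i t)" by blast
  define w where "w i = c i / basis_scale k p i" for i
  define q where "q j = (\<Sum>l<k + 1. Polynomial.smult (w (j * (k + 1) + l))
      (pcompose (legendre_poly l) (cell_map (p j) (p (Suc j)))))" for j
  have "degree (q j) \<le> k" for j
    unfolding q_def
  proof (rule degree_sum_le)
    fix l assume "l \<in> {..<k + 1}"
    then have "degree (pcompose (legendre_poly l) (cell_map (p j) (p (Suc j)))) \<le> k"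
      using degree_pcompose_le[of "legendre_poly l" "cell_map (p j) (p (Suc j))"]
      by (auto simp: degree_legendre_poly cell_map_def split: if_splits)
    then show "degree (Polynomial.smult (w (j * (k + 1) + l)) (pcompose (legendre_poly l) (cell_map (p j) (p (Suc j))))) \<le> k"
      using degree_smult_le le_trans by blast
  qed simp
  moreover have "v t = (\<Sum>j<N. indicator {p j..<p (Suc j)} t * poly (q j) t)" for t
    unfolding v sum_cells
  proof (rule sum.cong[OF refl])
    fix j
    show "(\<Sum>l<k + 1. c (j * (k + 1) + l) * legendre_basis k p (j * (k + 1) + l) t) =
        indicator {p j..<p (Suc j)} t * poly (q j) t"
      unfolding q_def poly_sum sum_distrib_left
    proof (rule sum.cong[OF refl])
      fix l assume "l \<in> {..<k + 1}"
      then have "(j * (k + 1) + l) div (k + 1) = j" "(j * (k + 1) + l) mod (k + 1) = l"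
        by (auto simp: div_mult_self3 simp del: mult_Suc_right)
      then show "c (j * (k + 1) + l) * legendre_basis k p (j * (k + 1) + l) t =
         indicator {p j..<p (Suc j)} t * poly (Polynomial.smult (w (j * (k + 1) + l))
           (pcompose (legendre_poly l) (cell_map (p j) (p (Suc j))))) t"
        unfolding legendre_basis_eq w_def cell_legendre_eq by simp
    qed
  qed
  ultimately show "v \<in> pw_poly_space k N p" unfolding pw_poly_space_def by blast
next
  fix v assume "v \<in> pw_poly_space k N p"
  then obtain q where deg: "\<And>c. c < N \<Longrightarrow> degree (q c) \<le> k"
    and v: "v = (\<lambda>t. \<Sum>c<N. indicator {p c..<p (Suc c)} t * poly (q c) t)"
    unfolding pw_poly_space_def by blast
  have "\<exists>d. q j = (\<Sum>l<k + 1. Polynomial.smult (d l) (pcompose (legendre_poly l) (cell_map (p j) (p (Suc j)))))"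
    if j: "j < N" for j
  proof (rule triangular_degrees_span)
    have "p j < p (Suc j)" by (rule is_partition_cell[OF part j])
    then have d1: "degree (cell_map (p j) (p (Suc j))) = 1" by (simp add: cell_map_def)
    then show "degree (pcompose (legendre_poly l) (cell_map (p j) (p (Suc j)))) = l" for l
      by (simp add: degree_pcompose degree_legendre_poly)
    show "pcompose (legendre_poly l) (cell_map (p j) (p (Suc j))) \<noteq> 0" for l
      using pcompose_eq_0 legendre_poly_nonzero d1 by fastforce
    show "coeff (q j) i = 0" if "k + 1 \<le> i" for i
      using deg[OF j] that by (intro coeff_eq_0) simp
  qed
  then obtain d where d: "\<And>j. j < N \<Longrightarrow> q j = (\<Sum>l<k + 1. Polynomial.smult (d j l)
      (pcompose (legendre_poly l) (cell_map (p j) (p (Suc j)))))" by metis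
  define c where "c i = d (i div (k + 1)) (i mod (k + 1)) * basis_scale k p i" for i
  have "v t = (\<Sum>i<(k + 1) * N. c i * legendre_basis k p i t)" for t
    unfolding v sum_cells
  proof (rule sum.cong[OF refl])
    fix j assume "j \<in> {..<N}"
    then have j: "j < N" by simp
    show "indicator {p j..<p (Suc j)} t * poly (q j) t =
      (\<Sum>l<k + 1. c (j * (k + 1) + l) * legendre_basis k p (j * (k + 1) + l) t)"
      unfolding d[OF j] poly_sum sum_distrib_left
    proof (rule sum.cong[OF refl])
      fix l assume "l \<in> {..<k + 1}"
      then have idx: "(j * (k + 1) + l) div (k + 1) = j" "(j * (k + 1) + l) mod (k + 1) = l"
        by (auto simp: div_mult_self3 simp del: mult_Suc_right)
      have "basis_scale k p (j * (k + 1) + l) \<noteq> 0"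
        unfolding basis_scale_def idx
        using cell_legendre_norm_pos[of p j l] is_partition_cell[OF part j] by simp
      then show "indicator {p j..<p (Suc j)} t * poly (Polynomial.smult (d j l)
           (pcompose (legendre_poly l) (cell_map (p j) (p (Suc j))))) t =
         c (j * (k + 1) + l) * legendre_basis k p (j * (k + 1) + l) t"
        unfolding legendre_basis_eq c_def idx cell_legendre_eq by simp
    qed
  qed
  then show "v \<in> {v. \<exists>c. v = (\<lambda>t. \<Sum>i<(k + 1) * N. c i * legendre_basis k p i t)}" by blast
qed

section \<open>Mass matrices as weighted integrals\<close>

lemma set_integrable_sum:
  fixes f :: "'i \<Rightarrow> 'a \<Rightarrow> real"
  assumes "\<And>i. i \<in> I \<Longrightarrow> set_integrable M A (f i)"
  shows "set_integrable M A (\<lambda>t. \<Sum>i\<in>I. f i t)"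
proof -
  have "integrable M (\<lambda>t. \<Sum>i\<in>I. indicator A t *\<^sub>R f i t)"
    using assms by (intro Bochner_Integration.integrable_sum) (auto simp: set_integrable_def)
  then show ?thesis by (simp add: set_integrable_def sum_distrib_left)
qed

lemma set_integral_sum:
  fixes f :: "'i \<Rightarrow> 'a \<Rightarrow> real"
  assumes "\<And>i. i \<in> I \<Longrightarrow> set_integrable M A (f i)"
  shows "(LINT t:A|M. \<Sum>i\<in>I. f i t) = (\<Sum>i\<in>I. LINT t:A|M. f i t)"
proof -
  have "(LINT t|M. (\<Sum>i\<in>I. indicator A t *\<^sub>R f i t)) = (\<Sum>i\<in>I. (LINT t|M. indicator A t *\<^sub>R f i t))"
    using assms by (intro Bochner_Integration.integral_sum) (auto simp: set_integrable_def)
  then show ?thesis by (simp add: set_lebesgue_integral_def sum_distrib_left)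
qed

lemma set_integrable_bounded_Icc:
  fixes f :: "real \<Rightarrow> real"
  assumes "set_borel_measurable lebesgue {a..b} f" "\<And>t. t \<in> {a..b} \<Longrightarrow> \<bar>f t\<bar> \<le> B"
  shows "set_integrable lebesgue {a..b} f"
  unfolding set_integrable_def
proof (rule integrableI_bounded_set[where A = "{a..b}" and B = B])
  show "(\<lambda>t. indicator {a..b} t *\<^sub>R f t) \<in> borel_measurable lebesgue"
    using assms(1) by (simp add: set_borel_measurable_def)
  show "emeasure lebesgue {a..b} < \<infinity>" by (simp add: emeasure_lborel_Icc_eq)
qed (use assms(2) in auto)

lemma set_borel_measurable_one: "set_borel_measurable lebesgue {a..b::real} (\<lambda>_. 1 :: real)"
proof -
  have "indicat_real {a..b} \<in> borel_measurable lebesgue" by (intro borel_measurable_indicator) simp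
  then show ?thesis by (simp add: set_borel_measurable_def)
qed

lemma borel_measurable_mult_square:
  assumes "g \<in> borel_measurable borel"
  shows "(\<lambda>\<epsilon>::real. g \<epsilon> * \<epsilon>\<^sup>2 :: real) \<in> borel_measurable borel"
  by (intro borel_measurable_times assms borel_measurable_continuous_onI[of "\<lambda>\<epsilon>. \<epsilon>\<^sup>2"] continuous_intros)

lemma set_borel_measurable_mult:
  fixes f g :: "real \<Rightarrow> real"
  assumes "set_borel_measurable lebesgue A f" "g \<in> borel_measurable borel"
  shows "set_borel_measurable lebesgue A (\<lambda>t. f t * g t)"
proof -
  have "g \<in> borel_measurable lebesgue" using assms(2) by (simp add: measurable_completion)
  moreover have "(\<lambda>t. indicator A t *\<^sub>R f t) \<in> borel_measurable lebesgue"
    using assms(1) by (simp add: set_borel_measurable_def)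
  ultimately have "(\<lambda>t. (indicator A t *\<^sub>R f t) * g t) \<in> borel_measurable lebesgue" by measurable
  then show ?thesis by (simp add: set_borel_measurable_def mult.assoc)
qed

definition bounded_borel :: "(real \<Rightarrow> real) \<Rightarrow> bool" where
  "bounded_borel g \<longleftrightarrow> g \<in> borel_measurable borel \<and> (\<exists>B. \<forall>t. \<bar>g t\<bar> \<le> B)"

lemma bounded_borel_mult:
  assumes "bounded_borel f" "bounded_borel g" shows "bounded_borel (\<lambda>t. f t * g t)"
proof -
  obtain B C where "\<And>t. \<bar>f t\<bar> \<le> B" "\<And>t. \<bar>g t\<bar> \<le> C"
    using assms unfolding bounded_borel_def by blast
  then have "\<bar>f t * g t\<bar> \<le> B * C" for t
    unfolding abs_mult by (intro mult_mono) (auto intro: order_trans[OF abs_ge_zero])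
  then show ?thesis using assms unfolding bounded_borel_def by (auto intro: borel_measurable_times)
qed

lemma bounded_borel_cmult: "bounded_borel f \<Longrightarrow> bounded_borel (\<lambda>t. c * f t)"
  by (rule bounded_borel_mult) (auto simp: bounded_borel_def)

lemma bounded_borel_sum:
  assumes "\<And>i. i \<in> I \<Longrightarrow> bounded_borel (f i)" shows "bounded_borel (\<lambda>t. \<Sum>i\<in>I. f i t)"
proof -
  have "\<forall>i\<in>I. \<exists>B. \<forall>t. \<bar>f i t\<bar> \<le> B" using assms unfolding bounded_borel_def by blast
  then obtain B where B: "\<And>i t. i \<in> I \<Longrightarrow> \<bar>f i t\<bar> \<le> B i" by metis
  have "\<bar>\<Sum>i\<in>I. f i t\<bar> \<le> (\<Sum>i\<in>I. B i)" for t
    by (rule order_trans[OF sum_abs]) (auto intro: sum_mono B)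
  then show ?thesis using assms unfolding bounded_borel_def by (auto intro!: borel_measurable_sum)
qed

lemma bounded_borel_set_integrable:
  assumes "bounded_borel g" shows "set_integrable lebesgue {a..b} g"
proof -
  obtain B where B: "\<And>t. \<bar>g t\<bar> \<le> B" using assms unfolding bounded_borel_def by blast
  have "set_borel_measurable lebesgue {a..b} (\<lambda>t. 1 * g t)"
    using assms by (intro set_borel_measurable_mult set_borel_measurable_one) (auto simp: bounded_borel_def)
  then show ?thesis using B by (intro set_integrable_bounded_Icc) auto
qed

text \<open>
  This treats the constant weight, the bounded opacity and the merely square integrable
  emissivity alike: all energy integrals below have such a weight and a bounded remaining factor.
\<close>

definition admissible_weight :: "real \<Rightarrow> (real \<Rightarrow> real) \<Rightarrow> bool" where
  "admissible_weight emax \<phi> \<longleftrightarrow>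
     (\<forall>g. bounded_borel g \<longrightarrow> set_integrable lebesgue {0..emax} (\<lambda>\<epsilon>. \<phi> \<epsilon> * g \<epsilon> * \<epsilon>\<^sup>2))"

lemma admissible_weight_bounded:
  assumes meas: "set_borel_measurable lebesgue {0..emax} \<phi>"
    and bound: "\<And>\<epsilon>. \<epsilon> \<in> {0..emax} \<Longrightarrow> \<bar>\<phi> \<epsilon>\<bar> \<le> B"
  shows "admissible_weight emax \<phi>"
  unfolding admissible_weight_def
proof (intro allI impI)
  fix g assume g: "bounded_borel g"
  then obtain C where C: "\<And>t. \<bar>g t\<bar> \<le> C" unfolding bounded_borel_def by blast
  have "(\<lambda>\<epsilon>. g \<epsilon> * \<epsilon>\<^sup>2) \<in> borel_measurable borel" using g by (auto simp: bounded_borel_def intro: borel_measurable_mult_square)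
  then have "set_borel_measurable lebesgue {0..emax} (\<lambda>\<epsilon>. \<phi> \<epsilon> * (g \<epsilon> * \<epsilon>\<^sup>2))"
    by (rule set_borel_measurable_mult[OF meas])
  moreover have "\<bar>\<phi> \<epsilon> * (g \<epsilon> * \<epsilon>\<^sup>2)\<bar> \<le> B * (C * emax\<^sup>2)" if "\<epsilon> \<in> {0..emax}" for \<epsilon>
    unfolding abs_mult using bound[OF that] C[of \<epsilon>] that
    by (intro mult_mono mult_nonneg_nonneg) (auto intro: order_trans[OF abs_ge_zero] power_mono)
  ultimately show "set_integrable lebesgue {0..emax} (\<lambda>\<epsilon>. \<phi> \<epsilon> * g \<epsilon> * \<epsilon>\<^sup>2)"
    unfolding mult.assoc by (rule set_integrable_bounded_Icc)
qed

text \<open>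
  The product of \<open>\<eta>\<close> and \<open>g\<close> is dominated by the sum of their squares.
\<close>

lemma admissible_weight_square_integrable:
  assumes meas: "set_borel_measurable lebesgue {0..emax} \<eta>"
    and sq: "set_integrable lebesgue {0..emax} (\<lambda>\<epsilon>. (\<eta> \<epsilon>)\<^sup>2 * \<epsilon>\<^sup>2)"
  shows "admissible_weight emax \<eta>"
  unfolding admissible_weight_def
proof (intro allI impI)
  fix g assume g: "bounded_borel g"
  have "set_integrable lebesgue {0..emax} (\<lambda>\<epsilon>. (g \<epsilon> * g \<epsilon>) * \<epsilon>\<^sup>2)"
  proof -
    have "admissible_weight emax (\<lambda>_. 1)"
      by (rule admissible_weight_bounded[of _ _ 1]) (simp_all add: set_borel_measurable_one)
    then show ?thesis using bounded_borel_mult[OF g g] unfolding admissible_weight_def by fastforce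
  qed
  then have int: "set_integrable lebesgue {0..emax} (\<lambda>\<epsilon>. (\<eta> \<epsilon>)\<^sup>2 * \<epsilon>\<^sup>2 + (g \<epsilon> * g \<epsilon>) * \<epsilon>\<^sup>2)"
    by (rule set_integral_add[OF sq])
  have meas': "set_borel_measurable lebesgue {0..emax} (\<lambda>\<epsilon>. \<eta> \<epsilon> * (g \<epsilon> * \<epsilon>\<^sup>2))"
    using g by (intro set_borel_measurable_mult[OF meas] borel_measurable_mult_square) (simp add: bounded_borel_def)
  have bound: "\<bar>\<eta> \<epsilon> * (g \<epsilon> * \<epsilon>\<^sup>2)\<bar> \<le> (\<eta> \<epsilon>)\<^sup>2 * \<epsilon>\<^sup>2 + (g \<epsilon> * g \<epsilon>) * \<epsilon>\<^sup>2" for \<epsilon>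
  proof -
    have "2 * (\<bar>\<eta> \<epsilon>\<bar> * \<bar>g \<epsilon>\<bar>) \<le> (\<eta> \<epsilon>)\<^sup>2 + (g \<epsilon>)\<^sup>2"
      using zero_le_power2[of "\<bar>\<eta> \<epsilon>\<bar> - \<bar>g \<epsilon>\<bar>"] by (simp add: power2_diff)
    then have "\<bar>\<eta> \<epsilon>\<bar> * \<bar>g \<epsilon>\<bar> \<le> (\<eta> \<epsilon>)\<^sup>2 + (g \<epsilon>)\<^sup>2"
      using mult_nonneg_nonneg[of "\<bar>\<eta> \<epsilon>\<bar>" "\<bar>g \<epsilon>\<bar>"] by linarith
    then have "(\<bar>\<eta> \<epsilon>\<bar> * \<bar>g \<epsilon>\<bar>) * \<epsilon>\<^sup>2 \<le> ((\<eta> \<epsilon>)\<^sup>2 + (g \<epsilon>)\<^sup>2) * \<epsilon>\<^sup>2"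
      by (rule mult_right_mono) simp
    then show ?thesis by (simp add: abs_mult power2_eq_square algebra_simps)
  qed
  show "set_integrable lebesgue {0..emax} (\<lambda>\<epsilon>. \<eta> \<epsilon> * g \<epsilon> * \<epsilon>\<^sup>2)"
    unfolding mult.assoc
    by (rule set_integrable_bound[OF int meas']) (intro AE_I2 impI, use bound in \<open>auto intro: order_trans\<close>)
qed

context orthonormal_system
begin

lemma basis_bounded_borel: "i < n \<Longrightarrow> bounded_borel (y i)"
  using basis_measurable basis_bounded by (auto simp: bounded_borel_def)

definition row_fun :: "real mat \<Rightarrow> nat \<Rightarrow> real \<Rightarrow> real" where
  "row_fun F i t = (\<Sum>j<n. F $$ (i, j) * y j t)"

lemma row_fun_bounded_borel: "bounded_borel (row_fun F i)"
  unfolding row_fun_def[abs_def] by (auto intro!: bounded_borel_sum bounded_borel_cmult basis_bounded_borel)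

lemma integral_combination_mult:
  "(LINT t:{a..b}|lebesgue. (\<Sum>i<n. c i * y i t) * (\<Sum>j<n. d j * y j t)) = (\<Sum>i<n. c i * d i)"
proof -
  have int: "set_integrable lebesgue {a..b} (\<lambda>t. c i * d j * (y i t * y j t))" if "i < n" "j < n" for i j
    using that by (intro bounded_borel_set_integrable bounded_borel_cmult bounded_borel_mult basis_bounded_borel)
  have "(LINT t:{a..b}|lebesgue. (\<Sum>i<n. c i * y i t) * (\<Sum>j<n. d j * y j t))
      = (LINT t:{a..b}|lebesgue. \<Sum>i<n. \<Sum>j<n. c i * d j * (y i t * y j t))"
    by (simp add: sum_product mult_ac)
  also have "\<dots> = (\<Sum>i<n. LINT t:{a..b}|lebesgue. \<Sum>j<n. c i * d j * (y i t * y j t))"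
    by (rule set_integral_sum, rule set_integrable_sum, rule int) simp_all
  also have "\<dots> = (\<Sum>i<n. \<Sum>j<n. LINT t:{a..b}|lebesgue. c i * d j * (y i t * y j t))"
    by (rule sum.cong[OF refl], rule set_integral_sum, rule int) simp_all
  also have "\<dots> = (\<Sum>i<n. \<Sum>j<n. c i * d j * (if i = j then 1 else 0))"
    by (intro sum.cong refl) (simp add: orthonormal)
  also have "\<dots> = (\<Sum>i<n. c i * d i)" by (simp add: sum.delta if_distrib cong: if_cong)
  finally show ?thesis .
qed

lemma integral_combination:
  "(LINT t:{a..b}|lebesgue. (\<Sum>i<n. c i * y i t)) = (\<Sum>i<n. c i * (LINT t:{a..b}|lebesgue. y i t))"
proof -
  have int: "set_integrable lebesgue {a..b} (\<lambda>t. c i * y i t)" if "i < n" for i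
    using that by (intro bounded_borel_set_integrable bounded_borel_cmult basis_bounded_borel)
  have "(LINT t:{a..b}|lebesgue. (\<Sum>i<n. c i * y i t)) = (\<Sum>i<n. (LINT t:{a..b}|lebesgue. c i * y i t))"
    by (rule set_integral_sum, rule int) simp
  then show ?thesis by simp
qed

lemma frob_weighted_mass:
  assumes \<phi>: "admissible_weight emax \<phi>"
    and F: "F \<in> carrier_mat p n" and G: "G \<in> carrier_mat p n"
  shows "frob (weighted_mass emax \<phi> n y) F G =
    (LINT \<epsilon>:{0..emax}|lebesgue. \<phi> \<epsilon> * (\<Sum>i<p. row_fun F i \<epsilon> * row_fun G i \<epsilon>) * \<epsilon>\<^sup>2)"
proof -
  define I where "I j l = (LINT \<epsilon>:{0..emax}|lebesgue. \<phi> \<epsilon> * y j \<epsilon> * y l \<epsilon> * \<epsilon>\<^sup>2)" for j l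
  have int: "set_integrable lebesgue {0..emax} (\<lambda>\<epsilon>. F $$ (i, j) * G $$ (i, l) * (\<phi> \<epsilon> * y j \<epsilon> * y l \<epsilon> * \<epsilon>\<^sup>2))"
    if "j < n" "l < n" for i j l
  proof -
    have "bounded_borel (\<lambda>\<epsilon>. y j \<epsilon> * y l \<epsilon>)" using that by (intro bounded_borel_mult basis_bounded_borel)
    then have "set_integrable lebesgue {0..emax} (\<lambda>\<epsilon>. \<phi> \<epsilon> * (y j \<epsilon> * y l \<epsilon>) * \<epsilon>\<^sup>2)"
      using \<phi> unfolding admissible_weight_def by blast
    then show ?thesis by (intro set_integrable_mult_right) (simp add: mult.assoc)
  qed
  have "\<phi> \<epsilon> * (\<Sum>i<p. row_fun F i \<epsilon> * row_fun G i \<epsilon>) * \<epsilon>\<^sup>2 =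
      (\<Sum>i<p. \<Sum>j<n. \<Sum>l<n. F $$ (i, j) * G $$ (i, l) * (\<phi> \<epsilon> * y j \<epsilon> * y l \<epsilon> * \<epsilon>\<^sup>2))" for \<epsilon>
    unfolding row_fun_def sum_product by (simp add: sum_distrib_left sum_distrib_right mult_ac)
  then have "(LINT \<epsilon>:{0..emax}|lebesgue. \<phi> \<epsilon> * (\<Sum>i<p. row_fun F i \<epsilon> * row_fun G i \<epsilon>) * \<epsilon>\<^sup>2) =
      (LINT \<epsilon>:{0..emax}|lebesgue. \<Sum>i<p. \<Sum>j<n. \<Sum>l<n. F $$ (i, j) * G $$ (i, l) * (\<phi> \<epsilon> * y j \<epsilon> * y l \<epsilon> * \<epsilon>\<^sup>2))"
    by simp
  also have "\<dots> = (\<Sum>i<p. LINT \<epsilon>:{0..emax}|lebesgue. \<Sum>j<n. \<Sum>l<n. F $$ (i, j) * G $$ (i, l) * (\<phi> \<epsilon> * y j \<epsilon> * y l \<epsilon> * \<epsilon>\<^sup>2))"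
    by (rule set_integral_sum, rule set_integrable_sum, rule set_integrable_sum, rule int) simp_all
  also have "\<dots> = (\<Sum>i<p. \<Sum>j<n. LINT \<epsilon>:{0..emax}|lebesgue. \<Sum>l<n. F $$ (i, j) * G $$ (i, l) * (\<phi> \<epsilon> * y j \<epsilon> * y l \<epsilon> * \<epsilon>\<^sup>2))"
    by (rule sum.cong[OF refl], rule set_integral_sum, rule set_integrable_sum, rule int) simp_all
  also have "\<dots> = (\<Sum>i<p. \<Sum>j<n. \<Sum>l<n. LINT \<epsilon>:{0..emax}|lebesgue. F $$ (i, j) * G $$ (i, l) * (\<phi> \<epsilon> * y j \<epsilon> * y l \<epsilon> * \<epsilon>\<^sup>2))"
    by (rule sum.cong[OF refl], rule sum.cong[OF refl], rule set_integral_sum, rule int) simp_all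
  also have "\<dots> = (\<Sum>i<p. \<Sum>j<n. \<Sum>l<n. F $$ (i, j) * G $$ (i, l) * I j l)"
    by (simp add: I_def)
  also have "\<dots> = (\<Sum>i<p. \<Sum>l<n. \<Sum>j<n. F $$ (i, j) * I j l * G $$ (i, l))"
    by (rule sum.cong[OF refl], subst sum.swap) (simp add: mult_ac)
  also have "\<dots> = frob (weighted_mass emax \<phi> n y) F G"
    using F G by (simp add: frob_def mat_trace_def weighted_mass_def scalar_prod_def atLeast0LessThan
        sum_distrib_right I_def)
  finally show ?thesis ..
qed

end

locale dg_bases = X: orthonormal_system "-1" 1 m x + Y: orthonormal_system 0 emax n y
  for emax :: real and m n :: nat and x y :: "nat \<Rightarrow> real \<Rightarrow> real"
begin

lemma expand_eq_rows:
  assumes "F \<in> carrier_mat m n"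
  shows "expand x y F \<mu> \<epsilon> = (\<Sum>i<m. Y.row_fun F i \<epsilon> * x i \<mu>)"
  using assms unfolding expand_def Y.row_fun_def by (simp add: sum_distrib_left sum_distrib_right mult_ac)

lemma weighted_inner_expand:
  assumes \<phi>: "admissible_weight emax \<phi>"
    and F: "F \<in> carrier_mat m n" and G: "G \<in> carrier_mat m n"
  shows "weighted_inner emax (\<lambda>\<mu> \<epsilon>. \<phi> \<epsilon> * expand x y F \<mu> \<epsilon>) (expand x y G) = frob (weighted_mass emax \<phi> n y) F G"
proof -
  have "(LINT \<mu>:{-1..1}|lebesgue. \<phi> \<epsilon> * expand x y F \<mu> \<epsilon> * expand x y G \<mu> \<epsilon> * \<epsilon>\<^sup>2) =
      \<phi> \<epsilon> * (\<Sum>i<m. Y.row_fun F i \<epsilon> * Y.row_fun G i \<epsilon>) * \<epsilon>\<^sup>2" for \<epsilon>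
  proof -
    have "(LINT \<mu>:{-1..1}|lebesgue. \<phi> \<epsilon> * expand x y F \<mu> \<epsilon> * expand x y G \<mu> \<epsilon> * \<epsilon>\<^sup>2) =
       (LINT \<mu>:{-1..1}|lebesgue. (\<phi> \<epsilon> * \<epsilon>\<^sup>2) * ((\<Sum>i<m. Y.row_fun F i \<epsilon> * x i \<mu>) * (\<Sum>i<m. Y.row_fun G i \<epsilon> * x i \<mu>)))"
      unfolding expand_eq_rows[OF F] expand_eq_rows[OF G] by (simp add: mult_ac)
    also have "\<dots> = (\<phi> \<epsilon> * \<epsilon>\<^sup>2) * (\<Sum>i<m. Y.row_fun F i \<epsilon> * Y.row_fun G i \<epsilon>)"
      by (simp only: set_integral_mult_right X.integral_combination_mult)
    finally show ?thesis by (simp add: mult_ac)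
  qed
  then show ?thesis unfolding weighted_inner_def Y.frob_weighted_mass[OF \<phi> F G] by (simp only:)
qed

lemma weighted_inner_source:
  assumes \<eta>: "admissible_weight emax \<eta>" and G: "G \<in> carrier_mat m n"
  defines "L\<^sub>0 \<equiv> Matrix.mat m 1 (\<lambda>(i, _). LINT \<mu>:{-1..1}|lebesgue. x i \<mu>)"
    and "L\<eta> \<equiv> Matrix.mat n 1 (\<lambda>(j, _). LINT \<epsilon>:{0..emax}|lebesgue. \<eta> \<epsilon> * y j \<epsilon> * \<epsilon>\<^sup>2)"
  shows "weighted_inner emax (\<lambda>\<mu> \<epsilon>. \<eta> \<epsilon>) (expand x y G) = mat_trace (L\<^sub>0 * L\<eta>\<^sup>T * G\<^sup>T)"
proof -
  define l where "l i = (LINT \<mu>:{-1..1}|lebesgue. x i \<mu>)" for i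
  have inner: "(LINT \<mu>:{-1..1}|lebesgue. \<eta> \<epsilon> * expand x y G \<mu> \<epsilon> * \<epsilon>\<^sup>2) =
      (\<Sum>i<m. \<Sum>j<n. l i * G $$ (i, j) * (\<eta> \<epsilon> * y j \<epsilon> * \<epsilon>\<^sup>2))" for \<epsilon>
  proof -
    have "(LINT \<mu>:{-1..1}|lebesgue. \<eta> \<epsilon> * expand x y G \<mu> \<epsilon> * \<epsilon>\<^sup>2) =
       (LINT \<mu>:{-1..1}|lebesgue. (\<eta> \<epsilon> * \<epsilon>\<^sup>2) * (\<Sum>i<m. Y.row_fun G i \<epsilon> * x i \<mu>))"
      unfolding expand_eq_rows[OF G] by (simp add: mult_ac)
    also have "\<dots> = (\<eta> \<epsilon> * \<epsilon>\<^sup>2) * (\<Sum>i<m. Y.row_fun G i \<epsilon> * l i)"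
      by (simp only: set_integral_mult_right X.integral_combination l_def)
    finally show ?thesis
      by (simp add: Y.row_fun_def sum_distrib_left sum_distrib_right mult_ac)
  qed
  have int: "set_integrable lebesgue {0..emax} (\<lambda>\<epsilon>. l i * G $$ (i, j) * (\<eta> \<epsilon> * y j \<epsilon> * \<epsilon>\<^sup>2))" if "j < n" for i j
    using \<eta> Y.basis_bounded_borel[OF that] unfolding admissible_weight_def
    by (intro set_integrable_mult_right) blast
  have "weighted_inner emax (\<lambda>\<mu> \<epsilon>. \<eta> \<epsilon>) (expand x y G) =
     (\<Sum>i<m. \<Sum>j<n. l i * G $$ (i, j) * (LINT \<epsilon>:{0..emax}|lebesgue. \<eta> \<epsilon> * y j \<epsilon> * \<epsilon>\<^sup>2))"
  proof -
    have "weighted_inner emax (\<lambda>\<mu> \<epsilon>. \<eta> \<epsilon>) (expand x y G) =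
       (\<Sum>i<m. LINT \<epsilon>:{0..emax}|lebesgue. \<Sum>j<n. l i * G $$ (i, j) * (\<eta> \<epsilon> * y j \<epsilon> * \<epsilon>\<^sup>2))"
      unfolding weighted_inner_def inner by (rule set_integral_sum, rule set_integrable_sum, rule int) simp_all
    also have "\<dots> = (\<Sum>i<m. \<Sum>j<n. LINT \<epsilon>:{0..emax}|lebesgue. l i * G $$ (i, j) * (\<eta> \<epsilon> * y j \<epsilon> * \<epsilon>\<^sup>2))"
      by (rule sum.cong[OF refl], rule set_integral_sum, rule int) simp_all
    finally show ?thesis by simp
  qed
  also have "\<dots> = mat_trace (L\<^sub>0 * L\<eta>\<^sup>T * G\<^sup>T)"
    using G by (simp add: mat_trace_def L\<^sub>0_def L\<eta>_def l_def scalar_prod_def atLeast0LessThan mult_ac)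
  finally show ?thesis .
qed

end

context orthonormal_system
begin

lemma coefficient_eq_integral:
  assumes "j < n" shows "(LINT t:{a..b}|lebesgue. row_fun F i t * y j t) = F $$ (i, j)"
proof -
  have "y j t = (\<Sum>l<n. (if l = j then 1 else 0) * y l t)" for t
    using assms by (simp add: if_distrib[of "\<lambda>c. c * _"] cong: if_cong)
  then have "(LINT t:{a..b}|lebesgue. row_fun F i t * y j t) =
      (LINT t:{a..b}|lebesgue. (\<Sum>l<n. F $$ (i, l) * y l t) * (\<Sum>l<n. (if l = j then 1 else 0) * y l t))"
    unfolding row_fun_def by (simp only:)
  also have "\<dots> = (\<Sum>l<n. F $$ (i, l) * (if l = j then 1 else 0))"
    by (rule integral_combination_mult)
  also have "\<dots> = F $$ (i, j)"
    using assms by (simp add: if_distrib cong: if_cong)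
  finally show ?thesis .
qed

end

lemma weighted_mass_carrier: "weighted_mass emax \<phi> n y \<in> carrier_mat n n"
  by (simp add: weighted_mass_def)

lemma weighted_mass_symmetric: "(weighted_mass emax \<phi> n y)\<^sup>T = weighted_mass emax \<phi> n y"
  by (intro eq_matI) (auto simp: weighted_mass_def mult_ac)

text \<open>
  The opacity bounds hold pointwise under the integral. For definiteness, a vanishing norm forces
  the row functions to vanish almost everywhere, because \<open>\<epsilon>\<^sup>2\<close> vanishes only at the origin, and
  the coefficients are recovered from the row functions by orthonormality.
\<close>

lemma mass_matrices_weighted_mass:
  assumes sys: "orthonormal_system 0 emax n y"
    and chi_meas: "set_borel_measurable lebesgue {0..emax} chi"
    and chi_min: "0 < chi_min"
    and chi_bounds: "\<And>\<epsilon>. \<epsilon> \<in> {0..emax} \<Longrightarrow> chi_min \<le> chi \<epsilon> \<and> chi \<epsilon> \<le> chi_max"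
  shows "mass_matrices n (weighted_mass emax (\<lambda>_. 1) n y) (weighted_mass emax chi n y) chi_min chi_max"
    and "admissible_weight emax chi" and "admissible_weight emax (\<lambda>_. 1)"
proof -
  interpret orthonormal_system 0 emax n y by (rule sys)
  show adm1: "admissible_weight emax (\<lambda>_. 1)"
    by (rule admissible_weight_bounded[of _ _ 1]) (simp_all add: set_borel_measurable_one)
  have "\<bar>chi \<epsilon>\<bar> \<le> chi_max" if "\<epsilon> \<in> {0..emax}" for \<epsilon> using chi_bounds[OF that] chi_min by auto
  then show admchi: "admissible_weight emax chi" by (rule admissible_weight_bounded[OF chi_meas])
  define sq where "sq F p \<epsilon> = (\<Sum>i<p. row_fun F i \<epsilon> * row_fun F i \<epsilon>)" for F :: "real mat" and p :: nat and \<epsilon> :: real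
  have sq0: "0 \<le> sq F p \<epsilon>" for F p \<epsilon> unfolding sq_def by (intro sum_nonneg) simp
  have sq_bb: "bounded_borel (sq F p)" for F p
    unfolding sq_def[abs_def] by (intro bounded_borel_sum bounded_borel_mult row_fun_bounded_borel)
  have int: "set_integrable lebesgue {0..emax} (\<lambda>\<epsilon>. \<phi> \<epsilon> * sq F p \<epsilon> * \<epsilon>\<^sup>2)" if "admissible_weight emax \<phi>" for \<phi> F p
    using that sq_bb unfolding admissible_weight_def by blast
  have frob1: "frob (weighted_mass emax (\<lambda>_. 1) n y) F F = (LINT \<epsilon>:{0..emax}|lebesgue. 1 * sq F p \<epsilon> * \<epsilon>\<^sup>2)"
    and frobchi: "frob (weighted_mass emax chi n y) F F = (LINT \<epsilon>:{0..emax}|lebesgue. chi \<epsilon> * sq F p \<epsilon> * \<epsilon>\<^sup>2)"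
    if "F \<in> carrier_mat p n" for F p
    using frob_weighted_mass[OF adm1 that that] frob_weighted_mass[OF admchi that that] by (simp_all add: sq_def)
  have mono: "c * sq F p \<epsilon> * \<epsilon>\<^sup>2 \<le> d * sq F p \<epsilon> * \<epsilon>\<^sup>2" if "c \<le> d" for c d F p and \<epsilon> :: real
    using that sq0 by (intro mult_right_mono) auto
  show "mass_matrices n (weighted_mass emax (\<lambda>_. 1) n y) (weighted_mass emax chi n y) chi_min chi_max"
  proof
    fix F :: "real mat" and p :: nat assume F: "F \<in> carrier_mat p n"
    have nn: "0 \<le> indicator {0..emax} \<epsilon> *\<^sub>R (1 * sq F p \<epsilon> * \<epsilon>\<^sup>2)" for \<epsilon>
      using sq0[of F p \<epsilon>] by simp
    show "0 \<le> frob (weighted_mass emax (\<lambda>_. 1) n y) F F"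
      unfolding frob1[OF F] set_lebesgue_integral_def by (intro integral_nonneg_AE AE_I2 nn)
    have "chi_min * frob (weighted_mass emax (\<lambda>_. 1) n y) F F =
        (LINT \<epsilon>:{0..emax}|lebesgue. chi_min * (1 * sq F p \<epsilon> * \<epsilon>\<^sup>2))"
      unfolding frob1[OF F] by simp
    also have "\<dots> \<le> frob (weighted_mass emax chi n y) F F"
      unfolding frobchi[OF F]
    proof (rule set_integral_mono)
      show "set_integrable lebesgue {0..emax} (\<lambda>\<epsilon>. chi_min * (1 * sq F p \<epsilon> * \<epsilon>\<^sup>2))"
        by (rule set_integrable_mult_right) (rule int[OF adm1])
      show "chi_min * (1 * sq F p \<epsilon> * \<epsilon>\<^sup>2) \<le> chi \<epsilon> * sq F p \<epsilon> * \<epsilon>\<^sup>2" if "\<epsilon> \<in> {0..emax}" for \<epsilon>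
        using mono[of chi_min "chi \<epsilon>"] chi_bounds[OF that] by (simp add: mult.assoc)
    qed (rule int[OF admchi])
    finally show "chi_min * frob (weighted_mass emax (\<lambda>_. 1) n y) F F \<le> frob (weighted_mass emax chi n y) F F" .
    have "frob (weighted_mass emax chi n y) F F \<le> (LINT \<epsilon>:{0..emax}|lebesgue. chi_max * (1 * sq F p \<epsilon> * \<epsilon>\<^sup>2))"
      unfolding frobchi[OF F]
    proof (rule set_integral_mono)
      show "set_integrable lebesgue {0..emax} (\<lambda>\<epsilon>. chi_max * (1 * sq F p \<epsilon> * \<epsilon>\<^sup>2))"
        by (rule set_integrable_mult_right) (rule int[OF adm1])
      show "chi \<epsilon> * sq F p \<epsilon> * \<epsilon>\<^sup>2 \<le> chi_max * (1 * sq F p \<epsilon> * \<epsilon>\<^sup>2)" if "\<epsilon> \<in> {0..emax}" for \<epsilon>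
        using mono[of "chi \<epsilon>" chi_max] chi_bounds[OF that] by (simp add: mult.assoc)
    qed (rule int[OF admchi])
    then show "frob (weighted_mass emax chi n y) F F \<le> chi_max * frob (weighted_mass emax (\<lambda>_. 1) n y) F F"
      unfolding frob1[OF F] by simp
    assume zero: "frob (weighted_mass emax (\<lambda>_. 1) n y) F F = 0"
    have "AE \<epsilon> in lebesgue. indicator {0..emax} \<epsilon> *\<^sub>R (1 * sq F p \<epsilon> * \<epsilon>\<^sup>2) = 0"
      using zero unfolding frob1[OF F] set_lebesgue_integral_def
      by (subst (asm) integral_nonneg_eq_0_iff_AE)
        (use int[OF adm1, of F p] nn in \<open>simp_all add: set_integrable_def\<close>)
    moreover have "AE \<epsilon> in lebesgue. \<epsilon> \<notin> {0 :: real}"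
      by (intro AE_not_in null_sets_completionI finite_imp_null_set_lborel) simp
    ultimately have ae: "AE \<epsilon> in lebesgue. \<epsilon> \<in> {0..emax} \<longrightarrow> sq F p \<epsilon> = 0"
      by eventually_elim auto
    show "F = 0\<^sub>m p n"
    proof (rule eq_matI)
      fix i j assume "i < dim_row (0\<^sub>m p n :: real mat)" "j < dim_col (0\<^sub>m p n :: real mat)"
      then have ij: "i < p" "j < n" by auto
      have "F $$ (i, j) = (LINT \<epsilon>:{0..emax}|lebesgue. row_fun F i \<epsilon> * y j \<epsilon>)"
        using coefficient_eq_integral[OF ij(2)] by simp
      also have "\<dots> = 0"
        unfolding set_lebesgue_integral_def
      proof (rule integral_eq_zero_AE, use ae in eventually_elim)
        fix \<epsilon> assume *: "\<epsilon> \<in> {0..emax} \<longrightarrow> sq F p \<epsilon> = 0"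
        have "row_fun F i \<epsilon> = 0" if "sq F p \<epsilon> = 0"
          using that ij(1) unfolding sq_def by (subst (asm) sum_nonneg_eq_0_iff) auto
        then show "indicat_real {0..emax} \<epsilon> *\<^sub>R (row_fun F i \<epsilon> * y j \<epsilon>) = 0"
          using * by (auto simp: indicator_def)
      qed
      finally show "F $$ (i, j) = 0\<^sub>m p n $$ (i, j)" using ij by simp
    qed (use F in auto)
  qed (simp_all add: weighted_mass_carrier weighted_mass_symmetric chi_min)
qed

context dg_bases
begin

lemma expand_diff:
  assumes "F \<in> carrier_mat m n" "G \<in> carrier_mat m n"
  shows "(\<lambda>\<mu> \<epsilon>. expand x y F \<mu> \<epsilon> - expand x y G \<mu> \<epsilon>) = expand x y (F - G)"
proof (intro ext)
  fix \<mu> \<epsilon>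
  have "F - G \<in> carrier_mat m n" using assms by (blast intro: mat_carrier_intros)
  moreover have "Y.row_fun (F - G) i \<epsilon> = Y.row_fun F i \<epsilon> - Y.row_fun G i \<epsilon>" if "i < m" for i
    using that assms unfolding Y.row_fun_def by (simp add: sum_subtractf left_diff_distrib)
  ultimately show "expand x y F \<mu> \<epsilon> - expand x y G \<mu> \<epsilon> = expand x y (F - G) \<mu> \<epsilon>"
    by (simp add: expand_eq_rows assms sum_subtractf left_diff_distrib)
qed

lemma weighted_norm_expand:
  assumes "admissible_weight emax (\<lambda>_. 1)" "F \<in> carrier_mat m n"
  shows "weighted_norm emax (expand x y F) = mat_norm (weighted_mass emax (\<lambda>_. 1) n y) F"
  using weighted_inner_expand[OF assms(1) assms(2,2)] by (simp add: weighted_norm_def mat_norm_eq_frob)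

text \<open>
  A sum of products of combinations of the bases is regrouped by pairs of basis functions; in the
  other direction a coefficient matrix is split into its rows.
\<close>

lemma tensor_space_span:
  assumes V: "V = {v. \<exists>c. v = (\<lambda>t. \<Sum>i<m. c i * x i t)}"
    and W: "W = {w. \<exists>c. w = (\<lambda>t. \<Sum>j<n. c j * y j t)}"
  shows "tensor_space V W = expand x y ` carrier_mat m n"
proof (intro equalityI subsetI)
  fix f assume "f \<in> tensor_space V W"
  then obtain d v w where vw: "\<And>l. l < d \<Longrightarrow> v l \<in> V \<and> w l \<in> W"
    and f: "f = (\<lambda>\<mu> \<epsilon>. \<Sum>l<(d::nat). v l \<mu> * w l \<epsilon>)"
    unfolding tensor_space_def by blast
  have "\<forall>l. \<exists>c. l < d \<longrightarrow> v l = (\<lambda>t. \<Sum>i<m. c i * x i t)" "\<forall>l. \<exists>c. l < d \<longrightarrow> w l = (\<lambda>t. \<Sum>j<n. c j * y j t)"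
    using vw unfolding V W by blast+
  then obtain \<alpha> \<beta> where \<alpha>: "\<And>l. l < d \<Longrightarrow> v l = (\<lambda>t. \<Sum>i<m. \<alpha> l i * x i t)"
    and \<beta>: "\<And>l. l < d \<Longrightarrow> w l = (\<lambda>t. \<Sum>j<n. \<beta> l j * y j t)" by metis
  define F where "F = Matrix.mat m n (\<lambda>(i, j). \<Sum>l<d. \<alpha> l i * \<beta> l j)"
  have F: "F \<in> carrier_mat m n" by (simp add: F_def)
  have "f \<mu> \<epsilon> = expand x y F \<mu> \<epsilon>" for \<mu> \<epsilon>
  proof -
    have "f \<mu> \<epsilon> = (\<Sum>l<d. \<Sum>i<m. \<Sum>j<n. x i \<mu> * (\<alpha> l i * \<beta> l j) * y j \<epsilon>)"
      unfolding f by (rule sum.cong[OF refl]) (simp add: \<alpha> \<beta> sum_product mult_ac)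
    also have "\<dots> = (\<Sum>i<m. \<Sum>l<d. \<Sum>j<n. x i \<mu> * (\<alpha> l i * \<beta> l j) * y j \<epsilon>)"
      by (rule sum.swap)
    also have "\<dots> = (\<Sum>i<m. \<Sum>j<n. \<Sum>l<d. x i \<mu> * (\<alpha> l i * \<beta> l j) * y j \<epsilon>)"
      by (rule sum.cong[OF refl], rule sum.swap)
    also have "\<dots> = expand x y F \<mu> \<epsilon>"
      by (simp add: expand_def F_def sum_distrib_left sum_distrib_right)
    finally show ?thesis .
  qed
  then have "f = expand x y F" by blast
  then show "f \<in> expand x y ` carrier_mat m n" using F by blast
next
  fix f assume "f \<in> expand x y ` carrier_mat m n"
  then obtain F where F: "F \<in> carrier_mat m n" and f: "f = expand x y F" by blast
  have "x i \<in> V" if "i < m" for i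
  proof -
    have "x i = (\<lambda>t. \<Sum>l<m. (if l = i then 1 else 0) * x l t)"
      using that by (simp add: if_distrib[of "\<lambda>c. c * _"] cong: if_cong)
    then show ?thesis unfolding V by (intro CollectI exI[of _ "\<lambda>l. if l = i then 1 else 0"])
  qed
  moreover have "Y.row_fun F i \<in> W" for i unfolding W Y.row_fun_def[abs_def]
    by (intro CollectI exI[of _ "\<lambda>j. F $$ (i, j)"] refl)
  moreover have "f = (\<lambda>\<mu> \<epsilon>. \<Sum>i<m. x i \<mu> * Y.row_fun F i \<epsilon>)"
    unfolding f using expand_eq_rows[OF F] by (intro ext) (simp add: mult.commute)
  ultimately show "f \<in> tensor_space V W"
    unfolding tensor_space_def
    by (intro CollectI exI[of _ m] exI[of _ x] exI[of _ "Y.row_fun F"]) simp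
qed

end

section \<open>From functions to coefficients\<close>

text \<open>
  The assumption \<open>source\<close> is the equilibrium equation: the source can be replaced by the
  absorption at equilibrium.
\<close>

locale dlr_dg = dg_bases emax m n x y + rank_one_equilibrium n A\<^sub>1 A_chi chi_min chi_max m r Ueq e s dt
  for emax m n x y A\<^sub>1 A_chi chi_min chi_max r Ueq e s dt +
  fixes \<eta> chi :: "real \<Rightarrow> real"
  assumes adm1: "admissible_weight emax (\<lambda>_. 1)" and admchi: "admissible_weight emax chi"
    and A1_eq: "A\<^sub>1 = weighted_mass emax (\<lambda>_. 1) n y" and Achi_eq: "A_chi = weighted_mass emax chi n y"
    and source: "W \<in> carrier_mat m n \<Longrightarrow> weighted_inner emax (\<lambda>\<mu> \<epsilon>. \<eta> \<epsilon>) (expand x y W) = frob A_chi Feq W"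
begin

lemma euler_galerkin_imp_galerkin:
  assumes V: "V \<subseteq> carrier_mat m n" and F: "F \<in> carrier_mat m n" and G: "G \<in> V"
    and eg: "euler_galerkin emax \<eta> chi dt (expand x y ` V) (expand x y F) (expand x y G)"
  shows "galerkin V F G"
  unfolding galerkin_def
proof (intro conjI ballI G)
  fix W assume W: "W \<in> V"
  then have Wc: "W \<in> carrier_mat m n" and Gc: "G \<in> carrier_mat m n" using V G by auto
  have d: "G - F \<in> carrier_mat m n" using Gc F by (blast intro: mat_carrier_intros)
  have "1 / dt * weighted_inner emax (\<lambda>\<mu> \<epsilon>. expand x y G \<mu> \<epsilon> - expand x y F \<mu> \<epsilon>) (expand x y W)
      = emission_absorption emax \<eta> chi (expand x y G) (expand x y W)"
    using eg W unfolding euler_galerkin_def by blast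
  also have "\<dots> = frob A_chi Feq W - frob A_chi G W"
    unfolding emission_absorption_def source[OF Wc] weighted_inner_expand[OF admchi Gc Wc] Achi_eq ..
  also have "weighted_inner emax (\<lambda>\<mu> \<epsilon>. expand x y G \<mu> \<epsilon> - expand x y F \<mu> \<epsilon>) (expand x y W) = frob A\<^sub>1 (G - F) W"
    unfolding expand_diff[OF Gc F] using weighted_inner_expand[OF adm1 d Wc] by (simp add: A1_eq)
  finally show "frob A\<^sub>1 (G - F) W = dt * (frob A_chi Feq W - frob A_chi G W)"
    using dt_pos by (simp add: field_simps)
qed

lemma dlr_dg_step_imp_step:
  assumes fac: "dlr_factors m n r A\<^sub>1 U S E"
    and st: "dlr_dg_step emax \<eta> chi x y m n r A\<^sub>1 dt U S E U' S' E'"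
  shows "step U S E U' S' E'"
proof -
  define F where "F = U * S * E\<^sup>T"
  from fac have U: "U \<in> carrier_mat m r" and S: "S \<in> carrier_mat r r" and E: "E \<in> carrier_mat n r"
    by (auto simp: dlr_factors_def)
  from st have fac': "dlr_factors m n r A\<^sub>1 U' S' E'"
    and gS: "euler_galerkin emax \<eta> chi dt (space_S x y r U' E') (expand x y F) (expand x y (U' * S' * E'\<^sup>T))"
    by (auto simp: dlr_dg_step_def F_def)
  from fac' have U': "U' \<in> carrier_mat m r" and S': "S' \<in> carrier_mat r r" and E': "E' \<in> carrier_mat n r"
    by (auto simp: dlr_factors_def)
  from st obtain K L R\<^sub>K R\<^sub>L where K: "K \<in> carrier_mat m r" and L: "L \<in> carrier_mat n r"
    and RK: "R\<^sub>K \<in> carrier_mat r r" and RL: "R\<^sub>L \<in> carrier_mat r r"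
    and gK: "euler_galerkin emax \<eta> chi dt (space_K x y m r E) (expand x y F) (expand x y (K * E\<^sup>T))"
    and gL: "euler_galerkin emax \<eta> chi dt (space_L x y n r U) (expand x y F) (expand x y (U * L\<^sup>T))"
    and KL: "K = U' * R\<^sub>K" "L = E' * R\<^sub>L"
    unfolding dlr_dg_step_def F_def by blast
  have ET: "E\<^sup>T \<in> carrier_mat r n" "E'\<^sup>T \<in> carrier_mat r n" using E E' by auto
  have F: "F \<in> carrier_mat m n" unfolding F_def using U S ET by (blast intro: mat_carrier_intros)
  have "V_K E \<subseteq> carrier_mat m n" unfolding V_K_def using ET by (blast intro: mat_carrier_intros)
  moreover have "space_K x y m r E = expand x y ` V_K E" unfolding space_K_def V_K_def by blast
  moreover have "K * E\<^sup>T \<in> V_K E" unfolding V_K_def using K by blast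
  ultimately have GK: "galerkin (V_K E) F (U' * R\<^sub>K * E\<^sup>T)"
    using euler_galerkin_imp_galerkin[OF _ F] gK KL by metis
  have "V_L U \<subseteq> carrier_mat m n" unfolding V_L_def using U by (blast intro: mat_carrier_intros)
  moreover have "space_L x y n r U = expand x y ` V_L U" unfolding space_L_def V_L_def by blast
  moreover have "U * L\<^sup>T \<in> V_L U" unfolding V_L_def using L by blast
  ultimately have GL: "galerkin (V_L U) F (U * (E' * R\<^sub>L)\<^sup>T)"
    using euler_galerkin_imp_galerkin[OF _ F] gL KL by metis
  have "V_S U' E' \<subseteq> carrier_mat m n" unfolding V_S_def using U' ET by (blast intro: mat_carrier_intros)
  moreover have "space_S x y r U' E' = expand x y ` V_S U' E'" unfolding space_S_def V_S_def by blast
  moreover have "U' * S' * E'\<^sup>T \<in> V_S U' E'" unfolding V_S_def using S' by blast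
  ultimately have GS: "galerkin (V_S U' E') F (U' * S' * E'\<^sup>T)"
    using euler_galerkin_imp_galerkin[OF _ F] gS by metis
  show ?thesis unfolding step_def F_def[symmetric] using fac' GK GL GS RK RL by blast
qed

lemma weighted_norm_error:
  assumes "F \<in> carrier_mat m n" "G \<in> carrier_mat m n"
  shows "weighted_norm emax (\<lambda>\<mu> \<epsilon>. expand x y F \<mu> \<epsilon> - expand x y G \<mu> \<epsilon>) = nrm (F - G)"
proof -
  have "F - G \<in> carrier_mat m n" using assms by (blast intro: mat_carrier_intros)
  then show ?thesis unfolding expand_diff[OF assms] using weighted_norm_expand[OF adm1] by (simp add: A1_eq)
qed

end

section \<open>Convergence of the scheme\<close>

theorem theorem4p12:
  fixes emax chi_min chi_max \<Delta>t \<alpha> \<beta> \<gamma>_star c :: real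
    and \<eta> chi :: "real \<Rightarrow> real"
    and k N\<mu> N\<epsilon> m n r :: nat
    and p\<mu> p\<epsilon> :: "nat \<Rightarrow> real"
    and x y :: "nat \<Rightarrow> real \<Rightarrow> real"
    and A\<^sub>1 A_chi L\<^sub>0 L\<eta> Ueq Eeq :: "real mat"
    and feq :: "real \<Rightarrow> real \<Rightarrow> real"
    and U S E :: "nat \<Rightarrow> real mat"
    and fhat :: "nat \<Rightarrow> real \<Rightarrow> real \<Rightarrow> real"
  assumes emax: "emax > 0"
    and \<eta>_pos: "\<And>\<epsilon>. \<epsilon> \<in> {0..emax} \<Longrightarrow> \<eta> \<epsilon> > 0"
    and \<eta>_meas: "set_borel_measurable lebesgue {0..emax} \<eta>"
    and \<eta>_sq: "set_integrable lebesgue {0..emax} (\<lambda>\<epsilon>. (\<eta> \<epsilon>)\<^sup>2 * \<epsilon>\<^sup>2)"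
    and chi_meas: "set_borel_measurable lebesgue {0..emax} chi"
    and chi_min: "0 < chi_min"
    and chi_bounds: "\<And>\<epsilon>. \<epsilon> \<in> {0..emax} \<Longrightarrow> chi_min \<le> chi \<epsilon> \<and> chi \<epsilon> \<le> chi_max"
    and part_\<mu>: "is_partition (-1) 1 N\<mu> p\<mu>"
    and part_\<epsilon>: "is_partition 0 emax N\<epsilon> p\<epsilon>"
    and m: "m = (k + 1) * N\<mu>"
    and n: "n = (k + 1) * N\<epsilon>"
    and r: "1 \<le> r" "r \<le> min m n"
    and x: "x = legendre_basis k p\<mu>"
    and y: "y = legendre_basis k p\<epsilon>"
    and A\<^sub>1: "A\<^sub>1 = weighted_mass emax (\<lambda>\<epsilon>. 1) n y"
    and A_chi: "A_chi = weighted_mass emax chi n y"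
    and L\<^sub>0: "L\<^sub>0 = Matrix.mat m 1 (\<lambda>(i, _). LINT \<mu>:{-1..1}|lebesgue. x i \<mu>)"
    and L\<eta>: "L\<eta> = Matrix.mat n 1 (\<lambda>(j, _). LINT \<epsilon>:{0..emax}|lebesgue. \<eta> \<epsilon> * y j \<epsilon> * \<epsilon>\<^sup>2)"
    and feq: "is_equilibrium emax \<eta> chi
                (tensor_space (pw_poly_space k N\<mu> p\<mu>) (pw_poly_space k N\<epsilon> p\<epsilon>)) feq"
    and Ueq: "Ueq = (1 / euclid_norm L\<^sub>0) \<cdot>\<^sub>m L\<^sub>0"
    and Eeq: "Eeq = (1 / mat_norm A\<^sub>1 (L\<eta>\<^sup>T * mat_inv A_chi)) \<cdot>\<^sub>m (mat_inv A_chi * L\<eta>)"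
    and \<Delta>t: "\<Delta>t > 0"
    and scheme: "dlr_dg_solution emax \<eta> chi x y m n r A\<^sub>1 \<Delta>t U S E"
    and fhat: "\<And>\<nn>. fhat \<nn> = expand x y (U \<nn> * S \<nn> * (E \<nn>)\<^sup>T)"
    and \<beta>: "0 < \<beta>" "\<beta> < 1"
    and \<alpha>: "0 < \<alpha>" "\<alpha> < 1"
    and init_U: "euclid_norm (proj_U (U 0) * Ueq) \<ge> \<beta>"
    and init_E: "mat_norm A\<^sub>1 (Eeq\<^sup>T * A_chi * proj_E_chi A_chi (E 0)) \<ge> \<alpha>"
    and \<gamma>_star: "\<alpha> < \<gamma>_star" "\<gamma>_star < 1"
    and \<gamma>_star_prop: "\<And>E'. E' \<in> carrier_mat n r \<Longrightarrow> E'\<^sup>T * A\<^sub>1 * E' = 1\<^sub>m r \<Longrightarrow>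
                    mat_norm A\<^sub>1 (Eeq\<^sup>T * A\<^sub>1 * proj_E E') \<ge> \<gamma>_star \<Longrightarrow>
                    mat_norm A\<^sub>1 (Eeq\<^sup>T * A_chi * proj_E_chi A_chi E') \<ge> \<alpha>"
    and c: "c = 1 / (1 + \<Delta>t * chi_min)"
  shows
    "(\<forall>\<delta> \<Delta>t\<^sub>0 \<delta>_chi.
        0 < \<delta> \<longrightarrow>
        \<delta> < (let b\<^sub>1 = (1 - c) * inverse (1 + chi_max / chi_min);
                 b\<^sub>2 = sqrt (2 * (1 - (max \<gamma>_star \<beta>)\<^sup>2)) * weighted_norm emax feq
                      / weighted_norm emax (\<lambda>\<mu> \<epsilon>. fhat 0 \<mu> \<epsilon> - feq \<mu> \<epsilon>)
             in if fhat 0 = feq then b\<^sub>1 else min b\<^sub>1 b\<^sub>2) \<longrightarrow>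
        \<Delta>t\<^sub>0 = sqrt 2 / \<delta> * max (sqrt (real r) / (\<beta> * chi_min))
                               (sqrt (real r) * sqrt chi_max / (\<alpha> * chi_min powr (3 / 2))) \<longrightarrow>
        \<delta>_chi = (1 + chi_max / chi_min) * \<delta> \<longrightarrow>
        \<Delta>t \<ge> \<Delta>t\<^sub>0 \<longrightarrow>
        (\<forall>\<nn>\<ge>1. weighted_norm emax (\<lambda>\<mu> \<epsilon>. fhat (\<nn> + 1) \<mu> \<epsilon> - feq \<mu> \<epsilon>)
                 \<le> (c + \<delta>_chi) ^ (\<nn> + 1) * weighted_norm emax (\<lambda>\<mu> \<epsilon>. fhat 0 \<mu> \<epsilon> - feq \<mu> \<epsilon>)))
     \<and> (fhat 0 = feq \<longrightarrow> (\<forall>\<nn>. fhat (\<nn> + 1) = feq))"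
proof -
  interpret X: orthonormal_system "-1" 1 m x
    unfolding x m by (rule orthonormal_system_legendre_basis[OF part_\<mu>])
  interpret Y: orthonormal_system 0 emax n y
    unfolding y n by (rule orthonormal_system_legendre_basis[OF part_\<epsilon>])
  interpret dg_bases emax m n x y ..
  have masses: "mass_matrices n (weighted_mass emax (\<lambda>_. 1) n y) (weighted_mass emax chi n y) chi_min chi_max"
    "admissible_weight emax chi" "admissible_weight emax (\<lambda>_. 1)"
    by (rule mass_matrices_weighted_mass[OF Y.orthonormal_system_axioms chi_meas chi_min]; erule chi_bounds)+
  have adm_\<eta>: "admissible_weight emax \<eta>"
    by (rule admissible_weight_square_integrable[OF \<eta>_meas \<eta>_sq])
  interpret mass_matrices n A\<^sub>1 A_chi chi_min chi_max
    unfolding A\<^sub>1 A_chi by (rule masses(1))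
  define Vh where "Vh = tensor_space (pw_poly_space k N\<mu> p\<mu>) (pw_poly_space k N\<epsilon> p\<epsilon>)"
  have Vh: "Vh = expand x y ` carrier_mat m n"
    unfolding Vh_def
    by (rule tensor_space_span)
      (simp_all only: pw_poly_space_eq_span[OF part_\<mu>] pw_poly_space_eq_span[OF part_\<epsilon>] x y m n)
  obtain Fq where Fq: "Fq \<in> carrier_mat m n" and feq_Fq: "feq = expand x y Fq"
    using feq unfolding is_equilibrium_def Vh_def[symmetric] Vh by blast
  have L0c: "L\<^sub>0 \<in> carrier_mat m 1" and L\<eta>c: "L\<eta> \<in> carrier_mat n 1"
    unfolding L\<^sub>0 L\<eta> by auto
  have source_trace: "weighted_inner emax (\<lambda>\<mu> \<epsilon>. \<eta> \<epsilon>) (expand x y W) = mat_trace (L\<^sub>0 * L\<eta>\<^sup>T * W\<^sup>T)"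
    if "W \<in> carrier_mat m n" for W
    unfolding L\<^sub>0 L\<eta> by (rule weighted_inner_source[OF adm_\<eta> that])
  have source_Fq: "weighted_inner emax (\<lambda>\<mu> \<epsilon>. \<eta> \<epsilon>) (expand x y W) = frob A_chi Fq W"
    if W: "W \<in> carrier_mat m n" for W
  proof -
    have "expand x y W \<in> Vh" unfolding Vh using W by blast
    then have "emission_absorption emax \<eta> chi feq (expand x y W) = 0"
      using feq unfolding is_equilibrium_def Vh_def[symmetric] by blast
    then show ?thesis
      using weighted_inner_expand[OF masses(2) Fq W] by (simp add: emission_absorption_def feq_Fq A_chi)
  qed
  have Fq_eq: "Fq = L\<^sub>0 * L\<eta>\<^sup>T * mat_inv A_chi"
    by (rule equilibrium_coefficients[OF Fq L0c L\<eta>c]) (simp add: source_trace flip: source_Fq)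
  define l N where "l = euclid_norm L\<^sub>0" and "N = mat_norm A\<^sub>1 (L\<eta>\<^sup>T * mat_inv A_chi)"
  from scheme have fac0: "dlr_factors m n r A\<^sub>1 (U 0) (S 0) (E 0)"
    and steps: "\<And>i. dlr_dg_step emax \<eta> chi x y m n r A\<^sub>1 \<Delta>t (U i) (S i) (E i) (U (Suc i)) (S (Suc i)) (E (Suc i))"
    unfolding dlr_dg_solution_def by auto
  have U0: "U 0 \<in> carrier_mat m r" and E0: "E 0 \<in> carrier_mat n r" using fac0 by (auto simp: dlr_factors_def)
  \<comment> \<open>the overlap conditions on the initial bases rule out the degenerate cases, in which the
    normalised factors would be zero by the convention \<open>1 / 0 = 0\<close>\<close>
  have l0: "l \<noteq> 0"
  proof
    assume "l = 0"
    then have "Ueq = 0\<^sub>m m 1" unfolding Ueq l_def using L0c by (intro eq_matI) auto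
    moreover have "proj_U (U 0) \<in> carrier_mat m m"
      unfolding proj_U_def using U0 by (auto intro: mult_carrier_mat[of _ _ r])
    ultimately have "euclid_norm (proj_U (U 0) * Ueq) = 0"
      by (simp add: euclid_norm_def L2_set_def)
    then show False using init_U \<beta> by simp
  qed
  have N0: "N \<noteq> 0"
  proof
    assume "N = 0"
    then have "Eeq = 0\<^sub>m n 1"
      unfolding Eeq N_def using L\<eta>c mat_inv_Achi(1) by (intro eq_matI) auto
    then have "Eeq\<^sup>T = 0\<^sub>m 1 n" by (simp add: transpose_mat_def) (intro eq_matI, auto)
    moreover have P: "proj_E_chi A_chi (E 0) \<in> carrier_mat n n"
      using E0 by (intro carrier_matI) (auto simp: proj_E_chi_def)
    ultimately have Z: "Eeq\<^sup>T * A_chi * proj_E_chi A_chi (E 0) = 0\<^sub>m 1 n"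
      by (simp only: left_mult_zero_mat[OF Achi_carrier] left_mult_zero_mat[OF P])
    have "(0\<^sub>m 1 n :: real mat)\<^sup>T \<in> carrier_mat n 1" by (simp del: One_nat_def)
    then have "mat_norm A\<^sub>1 (0\<^sub>m 1 n) = 0"
      by (simp add: mat_norm_def mat_trace_def left_mult_zero_mat[OF A1_carrier] left_mult_zero_mat del: One_nat_def)
    then show False using init_E \<alpha> unfolding Z by simp
  qed
  define s where "s = l * N"
  define e where "e = Eeq\<^sup>T"
  note eqf = normalised_equilibrium_factors[OF L0c L\<eta>c, folded l_def N_def, OF l0 N0,
      folded Ueq[folded l_def] Eeq[folded N_def] s_def e_def]
  interpret rank_one_equilibrium n A\<^sub>1 A_chi chi_min chi_max m r Ueq e s \<Delta>t
    by unfold_locales (use eqf \<Delta>t in simp_all)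
  have Feq: "Feq = Fq" unfolding Feq_def eqf(6) Fq_eq ..
  interpret dlr_dg emax m n x y A\<^sub>1 A_chi chi_min chi_max r Ueq e s \<Delta>t \<eta> chi
    by unfold_locales (simp_all add: masses A\<^sub>1 A_chi source_Fq[unfolded A_chi] Feq[unfolded A\<^sub>1 A_chi])
  have fac: "dlr_factors m n r A\<^sub>1 (U i) (S i) (E i)" for i
    by (cases i) (use fac0 steps in \<open>auto simp: dlr_dg_step_def\<close>)
  have st: "step (U i) (S i) (E i) (U (Suc i)) (S (Suc i)) (E (Suc i))" for i
    by (rule dlr_dg_step_imp_step[OF fac steps])
  define F where "F i = U i * S i * (E i)\<^sup>T" for i
  have F: "F i \<in> carrier_mat m n" for i
    using fac[of i] unfolding F_def dlr_factors_def by (blast intro: mat_carrier_intros)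
  have err: "weighted_norm emax (\<lambda>\<mu> \<epsilon>. fhat i \<mu> \<epsilon> - feq \<mu> \<epsilon>) = nrm (F i - Feq)" for i
    unfolding fhat feq_Fq F_def[symmetric] Feq by (rule weighted_norm_error[OF F Fq])
  have norm_feq: "weighted_norm emax feq = s"
  proof -
    have "weighted_norm emax feq = nrm Feq"
      unfolding feq_Fq Feq A\<^sub>1 by (rule weighted_norm_expand[OF masses(3) Fq])
    also have "\<dots> = s"
    proof -
      have Ue: "Ueq * e \<in> carrier_mat m n" using eqf(1,2) by (blast intro: mat_carrier_intros)
      have "frob A\<^sub>1 Feq Feq = s * (s * frob A\<^sub>1 (Ueq * e) (Ueq * e))"
        unfolding Feq_def frob_smult_left[OF A1_carrier Ue smult_carrier_mat[OF Ue]]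
          frob_smult_right[OF A1_carrier A1_sym Ue Ue] ..
      also have "frob A\<^sub>1 (Ueq * e) (Ueq * e) = 1"
        using frob_outer[OF A1_carrier eqf(1) eqf(1) eqf(2) eqf(2)] Ueq_unit e_unit by simp
      finally show ?thesis using s_nonneg by (simp add: mat_norm_eq_frob)
    qed
    finally show ?thesis .
  qed
  show ?thesis
  proof (intro conjI allI impI)
    fix \<delta> \<Delta>t\<^sub>0 \<delta>_chi :: real and i :: nat
    assume \<delta>: "0 < \<delta>"
      and \<delta>_less: "\<delta> < (let b\<^sub>1 = (1 - c) * inverse (1 + chi_max / chi_min);
                 b\<^sub>2 = sqrt (2 * (1 - (max \<gamma>_star \<beta>)\<^sup>2)) * weighted_norm emax feq
                      / weighted_norm emax (\<lambda>\<mu> \<epsilon>. fhat 0 \<mu> \<epsilon> - feq \<mu> \<epsilon>)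
             in if fhat 0 = feq then b\<^sub>1 else min b\<^sub>1 b\<^sub>2)"
      and \<Delta>t\<^sub>0: "\<Delta>t\<^sub>0 = sqrt 2 / \<delta> * max (sqrt (real r) / (\<beta> * chi_min))
                               (sqrt (real r) * sqrt chi_max / (\<alpha> * chi_min powr (3 / 2)))"
      and \<delta>_chi: "\<delta>_chi = (1 + chi_max / chi_min) * \<delta>"
      and large: "\<Delta>t\<^sub>0 \<le> \<Delta>t"
    define \<kappa> where "\<kappa> = chi_max / chi_min"
    have \<kappa>: "1 \<le> \<kappa>" unfolding \<kappa>_def using chi_min_le_max chi_min by simp
    have "\<delta> < (1 - c) * inverse (1 + \<kappa>)"
      using \<delta>_less by (simp add: Let_def \<kappa>_def split: if_splits)
    then have \<delta>\<kappa>: "(1 + \<kappa>) * \<delta> < 1 - c"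
      using \<kappa> by (simp add: field_simps)
    define g where "g = max \<gamma>_star \<beta>"
    have g: "0 < g" "g < 1" unfolding g_def using \<beta> \<gamma>_star \<alpha> by auto
    have g2: "g\<^sup>2 < 1" using g by (simp add: power_less_one_iff)
    have D0: "0 \<le> nrm (F 0 - Feq)" using nrm_nonneg F Feq_carrier by (blast intro: mat_carrier_intros)
    have \<delta>D: "\<delta> * nrm (F 0 - Feq) \<le> sqrt (2 * (1 - g\<^sup>2)) * s"
    proof (cases "fhat 0 = feq \<or> nrm (F 0 - Feq) = 0")
      case True
      have "nrm (F 0 - Feq) = 0"
        using True err[of 0] by (auto simp: weighted_norm_def weighted_inner_def)
      then show ?thesis using g2 s_nonneg by simp
    next
      case False
      then have "\<delta> < sqrt (2 * (1 - g\<^sup>2)) * s / nrm (F 0 - Feq)"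
        using \<delta>_less by (simp add: Let_def g_def norm_feq err)
      moreover have "0 < nrm (F 0 - Feq)" using False D0 by simp
      ultimately show ?thesis using pos_less_divide_eq less_imp_le by blast
    qed
    have sqrt_r: "1 \<le> sqrt (real r)" using r by simp
    have dt: "sqrt 2 * a \<le> \<delta> * (\<Delta>t * b)" if "sqrt 2 / \<delta> * (sqrt (real r) * a / b) \<le> \<Delta>t" "0 \<le> a" "0 < b" for a b
    proof -
      have "sqrt 2 * a \<le> sqrt (real r) * (sqrt 2 * a)"
        using sqrt_r that(2) mult_right_mono[of 1 "sqrt (real r)" "sqrt 2 * a"] by simp
      also have "\<dots> = \<delta> * (sqrt 2 / \<delta> * (sqrt (real r) * a / b) * b)" using \<delta> that(3) by simp
      also have "\<dots> \<le> \<delta> * (\<Delta>t * b)" using that(1,3) \<delta> by (intro mult_left_mono mult_right_mono) auto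
      finally show ?thesis .
    qed
    have large': "sqrt 2 / \<delta> * a \<le> \<Delta>t" if "a \<le> max (sqrt (real r) / (\<beta> * chi_min)) (sqrt (real r) * sqrt chi_max / (\<alpha> * chi_min powr (3 / 2)))" for a
    proof -
      have "sqrt 2 / \<delta> * a \<le> \<Delta>t\<^sub>0" unfolding \<Delta>t\<^sub>0 using \<delta> that by (intro mult_left_mono) auto
      then show ?thesis using large by simp
    qed
    have dt1: "sqrt 2 \<le> \<delta> * (\<Delta>t * \<beta> * chi_min)"
      using dt[of 1 "\<beta> * chi_min"] large'[of "sqrt (real r) / (\<beta> * chi_min)"] \<beta> chi_min by (simp add: mult.assoc)
    have powr: "chi_min powr (3 / 2) = chi_min * sqrt chi_min"
    proof -
      have "chi_min powr (3 / 2) = chi_min powr (1 + 1 / 2)" by simp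
      also have "\<dots> = chi_min * sqrt chi_min"
        unfolding powr_add using chi_min by (simp add: powr_half_sqrt)
      finally show ?thesis .
    qed
    have "sqrt (real r) * sqrt (chi_max / chi_min) / (\<alpha> * chi_min)
        = sqrt (real r) * sqrt chi_max / (\<alpha> * chi_min powr (3 / 2))"
      unfolding powr by (simp add: real_sqrt_divide)
    then have dt2: "sqrt 2 * sqrt (chi_max / chi_min) \<le> \<delta> * (\<Delta>t * \<alpha> * chi_min)"
      using dt[of "sqrt (chi_max / chi_min)" "\<alpha> * chi_min"] \<alpha> chi_min \<kappa>
        large'[of "sqrt (real r) * sqrt (chi_max / chi_min) / (\<alpha> * chi_min)"]
      by (simp add: mult.assoc \<kappa>_def)
    have "nrm (F (i + 1) - Feq) \<le>
        (1 / (1 + \<Delta>t * chi_min) + (1 + chi_max / chi_min) * \<delta>) ^ (i + 1) * nrm (F 0 - Feq)"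
      unfolding F_def
    proof (rule contraction[where \<alpha> = \<alpha> and \<beta> = \<beta> and \<gamma> = \<gamma>_star])
      show "\<alpha> \<le> nrm (e * A_chi * proj_E_chi A_chi (E 0))" using init_E by (simp add: e_def)
      show "\<alpha> \<le> nrm (e * A_chi * proj_E_chi A_chi E')"
        if "E' \<in> carrier_mat n r" "E'\<^sup>T * A\<^sub>1 * E' = 1\<^sub>m r" "\<gamma>_star \<le> nrm (e * A\<^sub>1 * proj_E E')" for E'
        using \<gamma>_star_prop[of E'] that by (simp add: e_def)
      show "(1 + chi_max / chi_min) * \<delta> < 1 - 1 / (1 + \<Delta>t * chi_min)"
        using \<delta>\<kappa> by (simp add: \<kappa>_def c)
      show "\<delta> * nrm (U 0 * S 0 * (E 0)\<^sup>T - Feq) \<le> sqrt (2 * (1 - (max \<gamma>_star \<beta>)\<^sup>2)) * s"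
        using \<delta>D by (simp add: F_def g_def)
      show "max \<gamma>_star \<beta> < 1" using g by (simp add: g_def)
    qed (use fac0 st \<alpha> \<beta> init_U \<gamma>_star \<delta> dt1 dt2 in simp_all)
    then show "weighted_norm emax (\<lambda>\<mu> \<epsilon>. fhat (i + 1) \<mu> \<epsilon> - feq \<mu> \<epsilon>)
       \<le> (c + \<delta>_chi) ^ (i + 1) * weighted_norm emax (\<lambda>\<mu> \<epsilon>. fhat 0 \<mu> \<epsilon> - feq \<mu> \<epsilon>)"
      unfolding err c \<delta>_chi .
  next
    fix i
    assume "fhat 0 = feq"
    then have "nrm (F 0 - Feq) = 0"
      using err[of 0] by (simp add: weighted_norm_def weighted_inner_def)
    then have "F 0 = Feq" by (rule eq_if_nrm_diff_eq_0[OF F Feq_carrier])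
    then have "F j = Feq" for j
    proof (induction j)
      case (Suc j)
      then show ?case using step_preserves_equilibrium[OF fac st] by (simp add: F_def)
    qed
    then show "fhat (i + 1) = feq" unfolding fhat feq_Fq F_def[symmetric] Feq by simp
  qed
qed

end
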